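(* Let $\nu$ be a non-zero finite Borel measure on $(0,1)$. Then $$\frac{\underline\delta_\nu}{1+\overline\delta_\nu}\le\underline s_\nu\le\overline s_\nu\le\frac{\delta_\nu^*}{1+\delta_\nu^*}\le\frac12,$$ and $$\overline s_\nu=\frac{\delta_\nu^*}{1+\delta_\nu^*}\iff\overline\delta_\nu=\delta_\nu^* .$$
   Context: $\Lambda$ is Lebesgue measure. For $n\in\mathbb N$ and $0\le k<2^n$ let $A^n_k:=(k2^{-n},(k+1)2^{-n}]$ and $\mathcal D_{\nu,n}:=\{A^n_k:\nu(A^n_k)>0\}$. For $q\in\mathbb R$ put $\beta^\nu_n(q):=\frac{1}{\log 2^n}\log\sum_{C\in\mathcal D_{\nu,n}}\nu(C)^q$ and $\beta_\nu(q):=\limsup_{n\to\infty}\beta_n^\nu(q)$. $\delta_\nu^*:=\overline{\dim}_M(\operatorname{supp}\nu)$ is the upper Minkowski (box) dimension of the topological support of $\nu$. $\overline\delta_\nu:=\lim_{t\nearrow1}\frac{\beta_\nu(t)}{1-t}$ and $\underline\delta_\nu:=\lim_{t\searrow1}\frac{\beta_\nu(t)}{1-t}$ (the negatives of the left, resp. right, derivative of $\beta_\nu$ at $1$). Spectral dimensions. $\nu$ is regarded as a measure on $[0,1]$. $H^1_0(0,1)$ is the space of functions $f:[0,1]\to\mathbb R$ with $f(x)=\int_{[0,x]}g\,d\Lambda$ for some $g\in L^2_\Lambda([0,1])$ and $f(0)=f(1)=0$; $\nabla_\Lambda f:=g$. $C_\nu([0,1])$ is the set of continuous real functions on $[0,1]$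 that are affine linear on every connected component of $[0,1]\setminus\operatorname{supp}\nu$. $\operatorname{dom}(\mathcal E_\nu):=H^1_0(0,1)\cap C_\nu([0,1])$, $\mathcal E_\nu(f,g):=\int_{(0,1)}\nabla_\Lambda f\,\nabla_\Lambda g\,d\Lambda$. A number $\lambda$ is an eigenvalue of $\mathcal E_\nu$ if there is $f\in\operatorname{dom}(\mathcal E_\nu)\setminus\{0\}$ with $\mathcal E_\nu(f,g)=\lambda\int fg\,d\nu$ for all $g\in\operatorname{dom}(\mathcal E_\nu)$. $N_\nu(x)$ is the number of eigenvalues $\le x$ (with multiplicity). $\underline{s}_\nu:=\liminf_{x\to\infty}\frac{\log N_\nu(x)}{\log x}$, $\overline{s}_\nu:=\limsup_{x\to\infty}\frac{\log N_\nu(x)}{\log x}$. *)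

theory Defs
  imports "HOL-Analysis.Analysis" "HOL-Library.Function_Algebras"
begin

text \<open>
  A Borel measure on the interval (0,1) is represented by a measure on the Borel sets of the real
  line for which the complement of (0,1) is a null set.
\<close>

definition borel_measure_on_unit :: "real measure \<Rightarrow> bool" where
  "borel_measure_on_unit \<nu> \<longleftrightarrow> sets \<nu> = sets borel \<and> emeasure \<nu> (- {0<..<1}) = 0"

definition topological_support :: "real measure \<Rightarrow> real set" where
  "topological_support \<nu> = {x. \<forall>U. open U \<longrightarrow> x \<in> U \<longrightarrow> emeasure \<nu> U > 0}"

text \<open>Logarithm of a cardinality, extended by \<open>log 0 = -\<infinity>\<close> and \<open>log \<infinity> = \<infinity>\<close>.\<close>

definition log_card :: "enat \<Rightarrow> ereal" where
  "log_card N = (case N of enat n \<Rightarrow> if n = 0 then -\<infinity> else ereal (ln (real n)) | \<infinity> \<Rightarrow> \<infinity>)"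


subsection \<open>Upper Minkowski dimension\<close>

text \<open>The least number of closed balls of radius \<open>\<epsilon>\<close> that cover \<open>A\<close>.\<close>

definition covering_number :: "real \<Rightarrow> 'a::metric_space set \<Rightarrow> enat" where
  "covering_number \<epsilon> A = (INF F \<in> {F. finite F \<and> A \<subseteq> (\<Union>x\<in>F. cball x \<epsilon>)}. enat (card F))"

definition upper_minkowski_dim :: "'a::metric_space set \<Rightarrow> ereal" where
  "upper_minkowski_dim A =
     Limsup (at_right 0) (\<lambda>\<epsilon>. log_card (covering_number \<epsilon> A) / ereal (ln (1 / \<epsilon>)))"

definition delta_star :: "real measure \<Rightarrow> ereal" where
  "delta_star \<nu> = upper_minkowski_dim (topological_support \<nu>)"


subsection \<open>The $L^q$-spectrum\<close>

definition dyadic_interval :: "nat \<Rightarrow> nat \<Rightarrow> real set" where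
  "dyadic_interval n k = {real k / 2 ^ n <.. real (k + 1) / 2 ^ n}"

definition charged_dyadics :: "real measure \<Rightarrow> nat \<Rightarrow> real set set" where
  "charged_dyadics \<nu> n = {dyadic_interval n k |k. k < 2 ^ n \<and> emeasure \<nu> (dyadic_interval n k) > 0}"

definition beta_n :: "real measure \<Rightarrow> nat \<Rightarrow> real \<Rightarrow> real" where
  "beta_n \<nu> n q = 1 / ln (2 ^ n) * ln (\<Sum>C\<in>charged_dyadics \<nu> n. measure \<nu> C powr q)"

definition beta :: "real measure \<Rightarrow> real \<Rightarrow> ereal" where
  "beta \<nu> q = limsup (\<lambda>n. ereal (beta_n \<nu> n q))"

text \<open>
  The one-sided limits below exist for every non-zero finite \<open>\<nu>\<close>, because \<open>beta \<nu>\<close> is then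
  convex, finite near 1, and vanishes at 1.
\<close>

definition delta_upper :: "real measure \<Rightarrow> ereal" where
  "delta_upper \<nu> = Lim (at_left 1) (\<lambda>t. beta \<nu> t / ereal (1 - t))"

definition delta_lower :: "real measure \<Rightarrow> ereal" where
  "delta_lower \<nu> = Lim (at_right 1) (\<lambda>t. beta \<nu> t / ereal (1 - t))"


subsection \<open>The Dirichlet form and its eigenvalues\<close>

definition is_weak_gradient :: "(real \<Rightarrow> real) \<Rightarrow> (real \<Rightarrow> real) \<Rightarrow> bool" where
  "is_weak_gradient f g \<longleftrightarrow>
     g \<in> borel_measurable borel \<and> set_integrable lborel {0..1} (\<lambda>x. (g x)\<^sup>2) \<and>
     (\<forall>x\<in>{0..1}. f x = (LINT t:{0..x}|lborel. g t))"

text \<open>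
  Functions on [0,1] are represented by functions on the real line that vanish outside [0,1], so
  that each of them has exactly one representative and the dimensions of eigenspaces are correct.
\<close>

definition H10 :: "(real \<Rightarrow> real) set" where
  "H10 = {f. (\<exists>g. is_weak_gradient f g) \<and> f 0 = 0 \<and> f 1 = 0 \<and> (\<forall>x. x \<notin> {0..1} \<longrightarrow> f x = 0)}"

text \<open>The weak gradient is determined almost everywhere on [0,1]; a representative is chosen.\<close>

definition weak_gradient :: "(real \<Rightarrow> real) \<Rightarrow> real \<Rightarrow> real" where
  "weak_gradient f = (SOME g. is_weak_gradient f g)"

definition C_affine :: "real measure \<Rightarrow> (real \<Rightarrow> real) set" where
  "C_affine \<nu> = {f. continuous_on {0..1} f \<and>
     (\<forall>K\<in>components ({0..1} - topological_support \<nu>). \<exists>a b. \<forall>x\<in>K. f x = a * x + b)}"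

definition form_dom :: "real measure \<Rightarrow> (real \<Rightarrow> real) set" where
  "form_dom \<nu> = H10 \<inter> C_affine \<nu>"

definition energy :: "(real \<Rightarrow> real) \<Rightarrow> (real \<Rightarrow> real) \<Rightarrow> real" where
  "energy f g = (LINT x:{0<..<1}|lborel. weak_gradient f x * weak_gradient g x)"

definition eigenspace :: "real measure \<Rightarrow> real \<Rightarrow> (real \<Rightarrow> real) set" where
  "eigenspace \<nu> l = {f \<in> form_dom \<nu>. \<forall>g\<in>form_dom \<nu>. energy f g = l * (LINT x|\<nu>. f x * g x)}"

definition eigenvalue :: "real measure \<Rightarrow> real \<Rightarrow> bool" where
  "eigenvalue \<nu> l \<longleftrightarrow> (\<exists>f\<in>eigenspace \<nu> l. f \<noteq> 0)"

interpretation real_fun: vector_space "\<lambda>(c::real) (f::real \<Rightarrow> real) x. c * f x"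
  by unfold_locales (auto simp: fun_eq_iff algebra_simps)

definition multiplicity_finite :: "real measure \<Rightarrow> real \<Rightarrow> bool" where
  "multiplicity_finite \<nu> l \<longleftrightarrow> (\<exists>B. finite B \<and> eigenspace \<nu> l \<subseteq> real_fun.span B)"

definition eigenvalue_count :: "real measure \<Rightarrow> real \<Rightarrow> enat" where
  "eigenvalue_count \<nu> x =
     (let E = {l. eigenvalue \<nu> l \<and> l \<le> x}
      in if finite E \<and> (\<forall>l\<in>E. multiplicity_finite \<nu> l)
         then enat (\<Sum>l\<in>E. real_fun.dim (eigenspace \<nu> l)) else \<infinity>)"

definition lower_spectral_dim :: "real measure \<Rightarrow> ereal" where
  "lower_spectral_dim \<nu> = Liminf at_top (\<lambda>x. log_card (eigenvalue_count \<nu> x) / ereal (ln x))"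

definition upper_spectral_dim :: "real measure \<Rightarrow> ereal" where
  "upper_spectral_dim \<nu> = Limsup at_top (\<lambda>x. log_card (eigenvalue_count \<nu> x) / ereal (ln x))"

end

theory Submission
  imports Defs "HOL-Complex_Analysis.Great_Picard"
begin

text \<open>
  Both bounds on the eigenvalue counting function $N_\nu(x)$ come from dyadic intervals.

  If $f$ vanishes at the left endpoint of a dyadic interval $Q$ of level $n$, then
  $\int_Q f^2\,d\nu \le \nu(Q) 2^{-n} \int_Q (\nabla f)^2$. Call $Q$ heavy if
  $x\,\nu(Q) 2^{-n} > 1/2$. Unless $(0,1]$ itself is
  not heavy, the non-heavy children of heavy intervals partition it; so
  $x \int f^2\,d\nu \le \frac12 \mathcal E_\nu(f,f)$ as soon as $f$ vanishes at the midpoints of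
  the heavy intervals. On the span of the eigenfunctions with eigenvalue at most $x$ the energy is
  at most $x \int f^2\,d\nu$, hence $N_\nu(x)$ is at most the number of heavy intervals. That
  number is at most $\sum_n \sum_Q (2x\nu(Q)2^{-n})^q = O(x^q)$ whenever $\beta_\nu(q) < q$.

  Conversely, every $Q$ with $x\,\nu(Q) \ge 2^{n+1}$ carries a trapezoid with energy at most $x$
  times its $\nu$-mass, and one third of these trapezoids have disjoint supports. To deduce a lower
  bound on $N_\nu(x)$ one needs eigenvalues to exist: take a maximising sequence for the quadratic
  form of the Green operator $T\phi(y) = \int (\min(y,z) - yz)\,\phi(z)\,d\nu(z)$ on the unit ball of
  the functions orthogonal to all eigenfunctions with eigenvalue at most $x$. Its image under $T$ is
  equicontinuous, and every uniform limit point of the image is an eigenfunction.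

  It remains to count intervals with $\nu(Q) \ge 2^{-\alpha n}$. Splitting
  $\sum_Q \nu(Q)^q$ at this threshold and comparing with other exponents, the slopes of the
  convex function $\beta_\nu$ at $1$ give the lower bounds, while $\beta_\nu(q) \le
  (1-q)\,\delta^*_\nu$ on $[0,1]$, with equality throughout exactly when
  $\overline\delta_\nu = \delta^*_\nu$, gives the upper bound and its case of equality.
\<close>

subsection \<open>Square-integrable functions on the unit interval\<close>

text \<open>Two obstacles shape the lower bound. The trapezoids need not be affine on the gaps of
  the support, so they lie in \<open>H10\<close> but in general outside
  \<open>form_dom \<nu>\<close>; and bounded Borel functions, which serve as the space on which T
  acts, do not form a complete space. The operator T removes both. It maps every bounded Borel
  function into \<open>form_dom \<nu>\<close>, and the energy of T \<phi> against \<open>u\<close>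
  equals the \<nu>-pairing of \<phi> and \<open>u\<close> for every \<open>u\<close> in
  \<open>H10\<close>, so Rayleigh quotients can be tested on all of \<open>H10\<close>. The
  maximising sequence itself is never passed to the limit, only its image.

  The exponents have the following origin. If an interval of level n has mass at least 2^(-\<alpha>
  n), its trapezoid passes the test for x = 2^(n (1 + \<alpha>) + 1); hence 2^(\<gamma> n) such
  intervals yield the exponent \<gamma> / (1 + \<alpha>). In the other direction every q > 0 with
  \<beta>(q) < q bounds the upper spectral dimension, and d / (1 + d) is the fixed point of the
  chord that sends q to (1 - q) d.\<close>

definition square_integrable :: "(real \<Rightarrow> real) \<Rightarrow> bool" where
  "square_integrable g \<longleftrightarrow>
     g \<in> borel_measurable borel \<and> set_integrable lborel {0..1} (\<lambda>x. (g x)\<^sup>2)"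

definition l2_inner :: "(real \<Rightarrow> real) \<Rightarrow> (real \<Rightarrow> real) \<Rightarrow> real" where
  "l2_inner g h = (LINT x:{0..1}|lborel. g x * h x)"

lemma square_integrable_mult:
  assumes "square_integrable g" "square_integrable h"
  shows "set_integrable lborel {0..1} (\<lambda>x. g x * h x)"
proof -
  have [measurable]: "g \<in> borel_measurable borel" "h \<in> borel_measurable borel"
    using assms by (auto simp: square_integrable_def)
  have "set_integrable lborel {0..1} (\<lambda>x. (g x)\<^sup>2 + (h x)\<^sup>2)"
    using assms by (intro set_integral_add) (auto simp: square_integrable_def)
  then show ?thesis
  proof (rule set_integrable_bound)
    show "set_borel_measurable lborel {0..1} (\<lambda>x. g x * h x)"
      unfolding set_borel_measurable_def by measurable
    have "\<bar>a * b\<bar> \<le> a\<^sup>2 + b\<^sup>2" for a b :: real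
    proof -
      have "2 * \<bar>a * b\<bar> \<le> a\<^sup>2 + b\<^sup>2"
        using sum_squares_bound[of "\<bar>a\<bar>" "\<bar>b\<bar>"] by (simp add: abs_mult mult.assoc)
      then show ?thesis by (smt (verit) abs_ge_zero)
    qed
    then show "AE x in lborel. x \<in> {0..1} \<longrightarrow> norm (g x * h x) \<le> norm ((g x)\<^sup>2 + (h x)\<^sup>2)"
      by (simp add: abs_of_nonneg)
  qed
qed

lemma square_integrable_bounded:
  assumes "g \<in> borel_measurable borel" "\<And>x. \<bar>g x\<bar> \<le> K"
  shows "square_integrable g"
proof -
  have "set_integrable lborel {0..1} (\<lambda>x. (g x)\<^sup>2)"
  proof (rule set_integrable_bound)
    show "set_integrable lborel {0..1::real} (\<lambda>x. K\<^sup>2)"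
      by (simp add: set_integrable_def)
    show "set_borel_measurable lborel {0..1} (\<lambda>x. (g x)\<^sup>2)"
      using assms(1) unfolding set_borel_measurable_def by measurable
    have "(g x)\<^sup>2 \<le> K\<^sup>2" for x
      using assms(2)[of x] by (metis abs_ge_zero power_mono power2_abs)
    then show "AE x in lborel. x \<in> {0..1} \<longrightarrow> norm ((g x)\<^sup>2) \<le> norm (K\<^sup>2)"
      by simp
  qed
  then show ?thesis using assms(1) by (simp add: square_integrable_def)
qed

lemma square_integrable_const: "square_integrable (\<lambda>x. c)"
  by (rule square_integrable_bounded[of _ "\<bar>c\<bar>"]) auto

lemma square_integrable_imp_set_integrable:
  assumes "square_integrable g"
  shows "set_integrable lborel {0..1} g"
  using square_integrable_mult[OF assms square_integrable_const[of 1]] by simp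

lemma square_integrable_subset:
  assumes "square_integrable g" "A \<subseteq> {0..1}" "A \<in> sets borel"
  shows "set_integrable lborel A g"
  using set_integrable_subset[OF square_integrable_imp_set_integrable[OF assms(1)]] assms by auto

lemma square_integrable_scale:
  assumes "square_integrable g"
  shows "square_integrable (\<lambda>x. c * g x)"
  using assms by (auto simp: square_integrable_def power_mult_distrib)

lemma square_integrable_add:
  assumes "square_integrable g" "square_integrable h"
  shows "square_integrable (\<lambda>x. g x + h x)"
proof -
  have "set_integrable lborel {0..1} (\<lambda>x. (g x)\<^sup>2 + (h x)\<^sup>2 + 2 * (g x * h x))"
    using assms square_integrable_mult[OF assms]
    by (intro set_integral_add set_integrable_mult_right) (auto simp: square_integrable_def)
  then have "set_integrable lborel {0..1} (\<lambda>x. (g x + h x)\<^sup>2)"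
    by (simp add: power2_sum algebra_simps)
  then show ?thesis using assms by (auto simp: square_integrable_def)
qed

lemma l2_inner_add_left:
  assumes "square_integrable g" "square_integrable h" "square_integrable k"
  shows "l2_inner (\<lambda>x. g x + h x) k = l2_inner g k + l2_inner h k"
  using square_integrable_mult[OF assms(1,3)] square_integrable_mult[OF assms(2,3)]
  unfolding l2_inner_def distrib_right by (rule set_integral_add)

lemma l2_inner_scale_left: "l2_inner (\<lambda>x. c * g x) k = c * l2_inner g k"
  unfolding l2_inner_def mult.assoc by (rule set_integral_mult_right)

lemma l2_inner_nonneg: "0 \<le> l2_inner g g"
  unfolding l2_inner_def set_lebesgue_integral_def
  by (rule Bochner_Integration.integral_nonneg) simp

lemma l2_inner_cong_AE:
  assumes "AE x in lborel. x \<in> {0..1} \<longrightarrow> g x = g' x" "AE x in lborel. x \<in> {0..1} \<longrightarrow> h x = h' x"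
    and [measurable]: "g \<in> borel_measurable borel" "h \<in> borel_measurable borel"
      "g' \<in> borel_measurable borel" "h' \<in> borel_measurable borel"
  shows "l2_inner g h = l2_inner g' h'"
  unfolding l2_inner_def set_lebesgue_integral_def
  by (rule integral_cong_AE; (measurable; fail)?)
     (use assms(1,2) in eventually_elim, auto simp: indicator_def)

text \<open>Cauchy-Schwarz against the constant 1, obtained by integrating
  \<open>(g t - m)\<^sup>2 \<ge> 0\<close> with \<open>m\<close> the mean of \<open>g\<close>. The
  factor \<open>b - a\<close> is the source of the division by \<open>2 ^ n\<close> in the Poincare
  estimates.\<close>

lemma square_of_integral_le:
  assumes g: "square_integrable g" and ab: "0 \<le> a" "a \<le> b" "b \<le> 1"
  shows "(LINT t:{a<..b}|lborel. g t)\<^sup>2 \<le> (b - a) * (LINT t:{a<..b}|lborel. (g t)\<^sup>2)"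
proof (cases "a = b")
  case True
  then show ?thesis by (simp add: set_lebesgue_integral_def)
next
  case False
  define I where "I = (LINT t:{a<..b}|lborel. g t)"
  define m where "m = I / (b - a)"
  have sub: "{a<..b} \<subseteq> {0..1}" using ab by auto
  have i1: "set_integrable lborel {a<..b} g"
    using square_integrable_subset[OF g sub] by simp
  have i2: "set_integrable lborel {a<..b} (\<lambda>t. (g t)\<^sup>2)"
    using g sub set_integrable_subset by (fastforce simp: square_integrable_def)
  have i3: "set_integrable lborel {a<..b} (\<lambda>t. m\<^sup>2)"
    using square_integrable_subset[OF square_integrable_const sub] by simp
  have "0 \<le> (LINT t:{a<..b}|lborel. (g t - m)\<^sup>2)"
    unfolding set_lebesgue_integral_def by (rule Bochner_Integration.integral_nonneg) simp
  also have "\<dots> = (LINT t:{a<..b}|lborel. (g t)\<^sup>2 + m\<^sup>2 - (2 * m) * g t)"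
    by (simp add: power2_diff algebra_simps)
  also have "\<dots> = (LINT t:{a<..b}|lborel. (g t)\<^sup>2) + (LINT t:{a<..b}|lborel. m\<^sup>2) - (2 * m) * I"
    unfolding I_def using i1 i2 i3
    by (subst set_integral_diff) (auto intro!: set_integral_add set_integrable_mult_right)
  also have "(LINT t:{a<..b}|lborel. m\<^sup>2) = (b - a) * m\<^sup>2"
    using ab by (simp add: set_lebesgue_integral_def)
  finally have *: "0 \<le> (LINT t:{a<..b}|lborel. (g t)\<^sup>2) + (b - a) * m\<^sup>2 - 2 * m * I" .
  have I: "I = m * (b - a)" using False by (simp add: m_def)
  have "0 \<le> (b - a) * ((LINT t:{a<..b}|lborel. (g t)\<^sup>2) + (b - a) * m\<^sup>2 - 2 * m * I)"
    using * ab by simp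
  also have "\<dots> = (b - a) * (LINT t:{a<..b}|lborel. (g t)\<^sup>2) - I\<^sup>2"
    by (simp add: I power2_eq_square algebra_simps)
  finally show ?thesis by (simp add: I_def)
qed

text \<open>The extension \<open>K\<close> of \<open>k\<close> by zero has vanishing integral over
  every ray \<open>{x<..}\<close>. Its positive and negative parts are therefore densities of two
  finite measures that agree on rays; so the measures are equal, and densities are unique almost
  everywhere.\<close>

lemma indefinite_integral_zero_imp_AE_zero:
  assumes k: "square_integrable k" and 0: "\<And>x. x \<in> {0..1} \<Longrightarrow> (LINT t:{0..x}|lborel. k t) = 0"
  shows "AE x in lborel. x \<in> {0..1} \<longrightarrow> k x = 0"
proof -
  define K where "K = (\<lambda>x. indicator {0..1} x * k x)"
  have [measurable]: "k \<in> borel_measurable borel" using k by (simp add: square_integrable_def)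
  have K [measurable]: "K \<in> borel_measurable borel" unfolding K_def by measurable
  have int: "integrable lborel K"
    using square_integrable_imp_set_integrable[OF k] by (simp add: K_def set_integrable_def)
  have tail: "(\<integral>t. K t * indicator {x<..} t \<partial>lborel) = 0" for x
  proof -
    have tot: "integral\<^sup>L lborel K = 0"
      using 0[of 1] by (simp add: K_def set_lebesgue_integral_def)
    have i: "integrable lborel (\<lambda>t. K t * indicator {..x} t)"
      using int by (intro integrable_real_mult_indicator) auto
    have "(\<integral>t. K t * indicator {..x} t \<partial>lborel) = 0"
    proof (cases "x < 0")
      case True
      then have "(\<lambda>t. K t * indicator {..x} t) = (\<lambda>t. 0)"
        by (auto simp: K_def indicator_def)
      then show ?thesis by simp
    next
      case False
      then have "(\<lambda>t. K t * indicator {..x} t) = (\<lambda>t. indicator {0..min x 1} t * k t)"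
        by (auto simp: K_def indicator_def fun_eq_iff)
      then show ?thesis using 0[of "min x 1"] False by (simp add: set_lebesgue_integral_def)
    qed
    moreover have "(\<lambda>t. K t * indicator {x<..} t) = (\<lambda>t. K t - K t * indicator {..x} t)"
      by (auto simp: indicator_def fun_eq_iff)
    ultimately show ?thesis using tot int i by simp
  qed
  have fin: "emeasure (density lborel (\<lambda>x. ennreal (s * K x))) {x<..} =
      ennreal (\<integral>t. max 0 (s * K t) * indicator {x<..} t \<partial>lborel)" for s x
  proof -
    have "emeasure (density lborel (\<lambda>x. ennreal (s * K x))) {x<..} =
      (\<integral>\<^sup>+t. ennreal (max 0 (s * K t) * indicator {x<..} t) \<partial>lborel)"
      by (subst emeasure_density) (auto intro!: nn_integral_cong simp: indicator_def max_def ennreal_neg)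
    also have "\<dots> = ennreal (\<integral>t. max 0 (s * K t) * indicator {x<..} t \<partial>lborel)"
      using int by (intro nn_integral_eq_integral integrable_real_mult_indicator) auto
    finally show ?thesis .
  qed
  have "density lborel (\<lambda>x. ennreal (1 * K x)) = density lborel (\<lambda>x. ennreal (-1 * K x))"
  proof (rule measure_eqI_lessThan)
    fix x
    show "emeasure (density lborel (\<lambda>x. ennreal (1 * K x))) {x<..} < \<infinity>"
      unfolding fin by simp
    have "(\<integral>t. max 0 (1 * K t) * indicator {x<..} t \<partial>lborel) - (\<integral>t. max 0 (-1 * K t) * indicator {x<..} t \<partial>lborel)
      = (\<integral>t. max 0 (1 * K t) * indicator {x<..} t - max 0 (-1 * K t) * indicator {x<..} t \<partial>lborel)"
      using int by (intro Bochner_Integration.integral_diff[symmetric] integrable_real_mult_indicator) auto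
    also have "\<dots> = (\<integral>t. K t * indicator {x<..} t \<partial>lborel)"
      by (intro Bochner_Integration.integral_cong) (auto simp: indicator_def)
    finally show "emeasure (density lborel (\<lambda>x. ennreal (1 * K x))) {x<..} =
        emeasure (density lborel (\<lambda>x. ennreal (-1 * K x))) {x<..}"
      unfolding fin tail by simp
  qed auto
  then have "AE x in lborel. ennreal (1 * K x) = ennreal (-1 * K x)"
    by (intro sigma_finite_measure.density_unique[OF lborel.sigma_finite_measure_axioms]) auto
  then show ?thesis
  proof eventually_elim
    case (elim x)
    \<comment> \<open>\<open>ennreal\<close> sends negative reals to 0, so \<open>K x\<close> and
      \<open>- K x\<close> have the same image only if both are 0.\<close>
    then have "K x = 0" by (cases "K x \<ge> 0") (auto simp: ennreal_neg ennreal_eq_0_iff)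
    then show ?case by (auto simp: K_def)
  qed
qed

subsection \<open>Weak gradients and the energy form\<close>

lemma is_weak_gradient_iff:
  "is_weak_gradient f g \<longleftrightarrow>
    square_integrable g \<and> (\<forall>x\<in>{0..1}. f x = (LINT t:{0..x}|lborel. g t))"
  by (auto simp: is_weak_gradient_def square_integrable_def)

lemma weak_gradient_unique:
  assumes "is_weak_gradient f g" "is_weak_gradient f h"
  shows "AE x in lborel. x \<in> {0..1} \<longrightarrow> g x = h x"
proof -
  have g: "square_integrable g" and h: "square_integrable h"
    using assms by (auto simp: is_weak_gradient_iff)
  have "square_integrable (\<lambda>x. g x + (-1) * h x)"
    by (intro square_integrable_add square_integrable_scale g h)
  moreover have "(LINT t:{0..x}|lborel. g t + (-1) * h t) = 0" if "x \<in> {0..1}" for x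
  proof -
    have sub: "{0..x} \<subseteq> {0..1}" using that by auto
    have "(LINT t:{0..x}|lborel. g t + (-1) * h t)
      = (LINT t:{0..x}|lborel. g t) + (LINT t:{0..x}|lborel. (-1) * h t)"
      using sub g square_integrable_scale[OF h, of "-1"]
      by (intro set_integral_add square_integrable_subset) auto
    also have "(LINT t:{0..x}|lborel. (-1) * h t) = (-1) * (LINT t:{0..x}|lborel. h t)"
      by (rule set_integral_mult_right)
    finally show ?thesis
      using assms that by (simp add: is_weak_gradient_iff)
  qed
  ultimately show ?thesis
    using indefinite_integral_zero_imp_AE_zero by force
qed

lemma weak_gradient_is_weak_gradient:
  assumes "is_weak_gradient f g"
  shows "is_weak_gradient f (weak_gradient f)"
  unfolding weak_gradient_def using someI[of "is_weak_gradient f", OF assms] .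

text \<open>\<open>weak_gradient\<close> is a choice among representatives that agree almost
  everywhere. Later computations may use any explicit gradient instead, and the closed interval in
  place of the open one, since two points are null.\<close>

lemma energy_eq:
  assumes f: "is_weak_gradient f g" and f': "is_weak_gradient f' g'"
  shows "energy f f' = l2_inner g g'"
proof -
  let ?w = "weak_gradient f" and ?w' = "weak_gradient f'"
  have w: "is_weak_gradient f ?w" "is_weak_gradient f' ?w'"
    using f f' weak_gradient_is_weak_gradient by blast+
  have [measurable]: "?w \<in> borel_measurable borel" "?w' \<in> borel_measurable borel"
    "g \<in> borel_measurable borel" "g' \<in> borel_measurable borel"
    using w f f' by (auto simp: is_weak_gradient_def)
  have ne: "AE x in lborel. x \<noteq> (0::real) \<and> x \<noteq> (1::real)"
    using AE_lborel_singleton[of "0::real"] AE_lborel_singleton[of "1::real"] by eventually_elim auto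
  have "energy f f' = l2_inner ?w ?w'"
    unfolding energy_def l2_inner_def set_lebesgue_integral_def
  proof (rule integral_cong_AE)
    from ne show "AE x in lborel. indicator {0<..<1} x *\<^sub>R (?w x * ?w' x) = indicator {0..1} x *\<^sub>R (?w x * ?w' x)"
      by eventually_elim (auto simp: indicator_def)
  qed measurable
  also have "\<dots> = l2_inner g g'"
    by (rule l2_inner_cong_AE[OF weak_gradient_unique[OF w(1) f] weak_gradient_unique[OF w(2) f']]) measurable
  finally show ?thesis .
qed

lemma is_weak_gradient_add:
  assumes "is_weak_gradient f g" "is_weak_gradient f' g'"
  shows "is_weak_gradient (f + f') (\<lambda>x. g x + g' x)"
proof -
  have "(LINT t:{0..x}|lborel. g t + g' t) = f x + f' x" if "x \<in> {0..1}" for x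
  proof -
    have sub: "{0..x} \<subseteq> {0..1}" using that by auto
    have "(LINT t:{0..x}|lborel. g t + g' t)
      = (LINT t:{0..x}|lborel. g t) + (LINT t:{0..x}|lborel. g' t)"
      using sub assms
      by (intro set_integral_add square_integrable_subset) (auto simp: is_weak_gradient_iff)
    then show ?thesis using assms that by (simp add: is_weak_gradient_iff)
  qed
  then show ?thesis
    using assms square_integrable_add by (auto simp: is_weak_gradient_iff)
qed

lemma is_weak_gradient_scale:
  assumes "is_weak_gradient f g"
  shows "is_weak_gradient (\<lambda>x. c * f x) (\<lambda>x. c * g x)"
  using assms square_integrable_scale by (auto simp: is_weak_gradient_iff)

lemma H10_add: "f \<in> H10 \<Longrightarrow> g \<in> H10 \<Longrightarrow> f + g \<in> H10"
  unfolding H10_def using is_weak_gradient_add by fastforce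

lemma H10_scale: "f \<in> H10 \<Longrightarrow> (\<lambda>x. c * f x) \<in> H10"
  unfolding H10_def using is_weak_gradient_scale by fastforce

lemma H10_zero: "(\<lambda>x. 0) \<in> H10"
  unfolding H10_def is_weak_gradient_iff
  by (auto intro!: exI[of _ "\<lambda>x. 0"] simp: square_integrable_const set_lebesgue_integral_def)

lemma H10D: "f \<in> H10 \<Longrightarrow> is_weak_gradient f (weak_gradient f)"
  unfolding H10_def using weak_gradient_is_weak_gradient by blast

lemma energy_commute: "energy f g = energy g f"
  by (simp add: energy_def mult.commute)

lemma energy_add_left:
  assumes "f \<in> H10" "g \<in> H10" "h \<in> H10"
  shows "energy (f + g) h = energy f h + energy g h"
proof -
  note w = assms[THEN H10D]
  show ?thesis
    unfolding energy_eq[OF w(1,3)] energy_eq[OF w(2,3)]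
      energy_eq[OF is_weak_gradient_add[OF w(1,2)] w(3)]
    using w by (intro l2_inner_add_left) (auto simp: is_weak_gradient_iff)
qed

lemma energy_scale_left:
  assumes "f \<in> H10" "h \<in> H10"
  shows "energy (\<lambda>x. c * f x) h = c * energy f h"
  unfolding energy_eq[OF H10D[OF assms(1)] H10D[OF assms(2)]]
    energy_eq[OF is_weak_gradient_scale[OF H10D[OF assms(1)]] H10D[OF assms(2)]]
  by (rule l2_inner_scale_left)

lemma energy_nonneg: "f \<in> H10 \<Longrightarrow> 0 \<le> energy f f"
  using energy_eq[OF H10D H10D] l2_inner_nonneg by metis

lemma weak_gradient_increment:
  assumes "is_weak_gradient f g" "0 \<le> a" "a \<le> b" "b \<le> 1"
  shows "f b - f a = (LINT t:{a<..b}|lborel. g t)"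
proof -
  have g: "square_integrable g" using assms by (simp add: is_weak_gradient_iff)
  have "(LINT t:{0..a} \<union> {a<..b}|lborel. g t)
      = (LINT t:{0..a}|lborel. g t) + (LINT t:{a<..b}|lborel. g t)"
    using assms by (intro set_integral_Un square_integrable_subset[OF g]) auto
  moreover have "{0..a} \<union> {a<..b} = {0..b}" using assms by auto
  ultimately show ?thesis using assms by (simp add: is_weak_gradient_iff)
qed

lemma weak_gradient_increment_square_le:
  assumes "is_weak_gradient f g" "0 \<le> a" "a \<le> b" "b \<le> 1"
  shows "(f b - f a)\<^sup>2 \<le> (b - a) * (LINT t:{a<..b}|lborel. (g t)\<^sup>2)"
  unfolding weak_gradient_increment[OF assms]
  using assms by (intro square_of_integral_le) (auto simp: is_weak_gradient_iff)

lemma set_integral_square_mono: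
  assumes "square_integrable g" "A \<subseteq> B" "B \<subseteq> {0..1}" "A \<in> sets borel" "B \<in> sets borel"
  shows "(LINT t:A|lborel. (g t)\<^sup>2) \<le> (LINT t:B|lborel. (g t)\<^sup>2)"
proof -
  have i: "set_integrable lborel C (\<lambda>t. (g t)\<^sup>2)" if "C \<subseteq> {0..1}" "C \<in> sets borel" for C
    using set_integrable_subset[of lborel "{0..1}" _ C] that assms(1) by (auto simp: square_integrable_def)
  show ?thesis
    unfolding set_lebesgue_integral_def
    using i[of A] i[of B] assms
    by (intro integral_mono) (auto simp: set_integrable_def indicator_def)
qed

text \<open>The 1/2-Hoelder estimate. Together with the boundary value at 0 it makes the energy
  definite, and it gives continuity, so that functions in \<open>H10\<close> can be evaluated at
  points and integrated against an arbitrary finite \<nu>.\<close>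

lemma H10_increment_square_le:
  assumes "f \<in> H10" "a \<in> {0..1}" "b \<in> {0..1}"
  shows "(f b - f a)\<^sup>2 \<le> \<bar>b - a\<bar> * energy f f"
proof -
  have *: "(f b - f a)\<^sup>2 \<le> (b - a) * energy f f" if "0 \<le> a" "a \<le> b" "b \<le> 1" for a b
  proof -
    let ?g = "weak_gradient f"
    have g: "square_integrable ?g" using H10D[OF assms(1)] by (simp add: is_weak_gradient_iff)
    have "(f b - f a)\<^sup>2 \<le> (b - a) * (LINT t:{a<..b}|lborel. (?g t)\<^sup>2)"
      using weak_gradient_increment_square_le[OF H10D[OF assms(1)] that] .
    also have "\<dots> \<le> (b - a) * (LINT t:{0..1}|lborel. (?g t)\<^sup>2)"
      using that by (intro mult_left_mono set_integral_square_mono[OF g]) auto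
    also have "(LINT t:{0..1}|lborel. (?g t)\<^sup>2) = energy f f"
      unfolding energy_eq[OF H10D[OF assms(1)] H10D[OF assms(1)]] l2_inner_def by (simp add: power2_eq_square)
    finally show ?thesis .
  qed
  show ?thesis
    using *[of a b] *[of b a] assms(2,3) by (cases "a \<le> b") (auto simp: power2_commute)
qed

lemma H10_boundary: "f \<in> H10 \<Longrightarrow> f 0 = 0" "f \<in> H10 \<Longrightarrow> f 1 = 0" "f \<in> H10 \<Longrightarrow> x \<notin> {0..1} \<Longrightarrow> f x = 0"
  unfolding H10_def by blast+

lemma H10_energy_zero_imp_zero:
  assumes "f \<in> H10" "energy f f = 0"
  shows "f = 0"
proof
  fix x
  show "f x = 0 x"
    using H10_increment_square_le[OF assms(1), of 0 x] assms H10_boundary[OF assms(1)]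
    by (cases "x \<in> {0..1}") auto
qed

lemma H10_continuous_on:
  assumes "f \<in> H10"
  shows "continuous_on {0..1} f"
proof (rule continuous_onI)
  fix x e :: real
  assume x: "x \<in> {0..1}" and e: "0 < e"
  define d where "d = e\<^sup>2 / (energy f f + 1)"
  have E: "0 \<le> energy f f" using energy_nonneg[OF assms] .
  have d: "0 < d" using e E by (auto simp: d_def intro!: divide_pos_pos)
  have "dist (f y) (f x) \<le> e" if y: "y \<in> {0..1}" "dist y x < d" for y
  proof -
    have "(f y - f x)\<^sup>2 \<le> \<bar>y - x\<bar> * energy f f"
      by (rule H10_increment_square_le[OF assms x y(1)])
    also have "\<dots> \<le> d * (energy f f + 1)"
      using y(2) E by (intro mult_mono) (auto simp: dist_real_def)
    also have "\<dots> = e\<^sup>2" using E by (simp add: d_def)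
    finally show ?thesis using e by (simp add: dist_real_def abs_le_square_iff[symmetric])
  qed
  then show "\<exists>d>0. \<forall>x'\<in>{0..1}. dist x' x < d \<longrightarrow> dist (f x') (f x) \<le> e"
    using d by blast
qed

text \<open>Plays the role of the L^2 space of \<nu>. Its members are genuine functions, integrable
  for every finite Borel measure and closed under products, and it contains
  \<open>H10\<close>.\<close>

definition bounded_borel :: "(real \<Rightarrow> real) \<Rightarrow> bool" where
  "bounded_borel f \<longleftrightarrow> f \<in> borel_measurable borel \<and> (\<exists>K. \<forall>x. \<bar>f x\<bar> \<le> K)"

lemma bounded_borel_measurable: "bounded_borel f \<Longrightarrow> f \<in> borel_measurable borel"
  by (simp add: bounded_borel_def)

lemma bounded_borelE:
  assumes "bounded_borel f"
  obtains K where "0 \<le> K" "\<And>x. \<bar>f x\<bar> \<le> K"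
  using assms unfolding bounded_borel_def by (meson abs_ge_zero order_trans)

lemma bounded_borel_scale: "bounded_borel f \<Longrightarrow> bounded_borel (\<lambda>x. c * f x)"
  unfolding bounded_borel_def abs_mult
  by (auto intro: mult_left_mono[OF _ abs_ge_zero])

lemma bounded_borel_add:
  assumes "bounded_borel f" "bounded_borel g"
  shows "bounded_borel (\<lambda>x. f x + g x)"
proof -
  obtain K L where "\<And>x. \<bar>f x\<bar> \<le> K" "\<And>x. \<bar>g x\<bar> \<le> L"
    using assms by (meson bounded_borelE)
  then have "\<bar>f x + g x\<bar> \<le> K + L" for x
    using abs_triangle_ineq[of "f x" "g x"] by (meson add_mono order_trans)
  then show ?thesis using assms unfolding bounded_borel_def by auto
qed

lemma bounded_borel_mult:
  assumes "bounded_borel f" "bounded_borel g"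
  shows "bounded_borel (\<lambda>x. f x * g x)"
proof -
  obtain K L where "0 \<le> K" "\<And>x. \<bar>f x\<bar> \<le> K" "\<And>x. \<bar>g x\<bar> \<le> L"
    using assms by (meson bounded_borelE)
  then have "\<bar>f x * g x\<bar> \<le> K * L" for x by (simp add: abs_mult mult_mono)
  then show ?thesis using assms unfolding bounded_borel_def by auto
qed

lemma continuous_imp_bounded_borel:
  assumes "continuous_on {0..1} f" "\<And>x. x \<notin> {0..1} \<Longrightarrow> f x = 0"
  shows "bounded_borel f"
proof -
  have "(\<lambda>x. indicator {0..1} x *\<^sub>R f x) \<in> borel_measurable borel"
    using assms(1) by (intro borel_measurable_continuous_on_indicator) auto
  moreover have "(\<lambda>x. indicator {0..1} x *\<^sub>R f x) = f"
    using assms(2) by (auto simp: indicator_def fun_eq_iff)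
  moreover have "bounded (f ` {0..1})"
    using assms(1) by (intro compact_imp_bounded compact_continuous_image) auto
  then obtain K where "\<And>x. x \<in> {0..1} \<Longrightarrow> \<bar>f x\<bar> \<le> K"
    unfolding bounded_iff by (metis imageI real_norm_def)
  then have "\<bar>f x\<bar> \<le> max K 0" for x
    using assms(2)[of x] by (cases "x \<in> {0..1}") (auto simp: le_max_iff_disj)
  ultimately show ?thesis unfolding bounded_borel_def by auto
qed

lemma H10_bounded_borel: "f \<in> H10 \<Longrightarrow> bounded_borel f"
  using continuous_imp_bounded_borel[OF H10_continuous_on] H10_boundary(3) by blast

lemma form_dom_H10: "f \<in> form_dom \<nu> \<Longrightarrow> f \<in> H10"
  by (simp add: form_dom_def)

lemma form_dom_add:
  assumes f: "f \<in> form_dom \<nu>" and g: "g \<in> form_dom \<nu>"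
  shows "f + g \<in> form_dom \<nu>"
proof -
  have "\<exists>a b. \<forall>x\<in>K. (f + g) x = a * x + b"
    if K: "K \<in> components ({0..1} - topological_support \<nu>)" for K
  proof -
    obtain a b where 1: "\<And>x. x \<in> K \<Longrightarrow> f x = a * x + b"
      using f K unfolding form_dom_def C_affine_def by blast
    obtain a' b' where 2: "\<And>x. x \<in> K \<Longrightarrow> g x = a' * x + b'"
      using g K unfolding form_dom_def C_affine_def by blast
    show ?thesis
      by (rule exI[of _ "a + a'"], rule exI[of _ "b + b'"]) (simp add: 1 2 algebra_simps)
  qed
  moreover have "continuous_on {0..1} (f + g)"
    using f g H10_continuous_on[OF H10_add] by (auto simp: form_dom_def)
  ultimately show ?thesis
    using f g H10_add by (simp add: form_dom_def C_affine_def)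
qed

lemma form_dom_scale:
  assumes f: "f \<in> form_dom \<nu>"
  shows "(\<lambda>x. c * f x) \<in> form_dom \<nu>"
proof -
  have "\<exists>a b. \<forall>x\<in>K. c * f x = a * x + b"
    if K: "K \<in> components ({0..1} - topological_support \<nu>)" for K
  proof -
    obtain a b where 1: "\<And>x. x \<in> K \<Longrightarrow> f x = a * x + b"
      using f K unfolding form_dom_def C_affine_def by blast
    show ?thesis
      by (rule exI[of _ "c * a"], rule exI[of _ "c * b"]) (simp add: 1 algebra_simps)
  qed
  moreover have "continuous_on {0..1} (\<lambda>x. c * f x)"
    using f H10_continuous_on[OF H10_scale] by (auto simp: form_dom_def)
  ultimately show ?thesis
    using f H10_scale by (simp add: form_dom_def C_affine_def)
qed

lemma form_dom_zero: "0 \<in> form_dom \<nu>"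
proof -
  have "\<exists>a b. \<forall>x\<in>K. (0::real) = a * x + b" for K :: "real set"
    by (rule exI[of _ 0], rule exI[of _ 0]) simp
  then show ?thesis using H10_zero by (simp add: form_dom_def C_affine_def zero_fun_def)
qed

text \<open>Gaussian elimination, by induction on the set of equations. It replaces the dimension
  counts: once to find a combination of eigenfunctions that vanishes at prescribed points, once to
  find a combination of test functions orthogonal to prescribed eigenfunctions.\<close>

lemma homogeneous_system_nontrivial_solution:
  fixes a :: "'s \<Rightarrow> 'p \<Rightarrow> 'b::field"
  assumes "finite P" "finite S" "card P < card S"
  shows "\<exists>c. (\<exists>s\<in>S. c s \<noteq> 0) \<and> (\<forall>p\<in>P. (\<Sum>s\<in>S. c s * a s p) = 0)"
  using assms
proof (induction P arbitrary: S a rule: finite_induct)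
  case empty
  then obtain s where "s \<in> S" by fastforce
  then show ?case by (intro exI[of _ "\<lambda>_. 1"]) auto
next
  case (insert p P)
  show ?case
  proof (cases "\<forall>s\<in>S. a s p = 0")
    case True
    obtain c where "\<exists>s\<in>S. c s \<noteq> 0" "\<forall>q\<in>P. (\<Sum>s\<in>S. c s * a s q) = 0"
      using insert.IH[of S a] insert.prems insert.hyps by auto
    then show ?thesis using True by (intro exI[of _ c]) auto
  next
    case False
    then obtain z where z: "z \<in> S" "a z p \<noteq> 0" by blast
    \<comment> \<open>The unknown \<open>z\<close> is eliminated through equation \<open>p\<close>,
      with pivot \<open>a z p\<close>; by construction \<open>b s p = 0\<close>.\<close>
    define b where "b = (\<lambda>s q. a s q - a s p / a z p * a z q)"
    have "card P < card (S - {z})" using insert.prems insert.hyps z by auto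
    then obtain c where c: "\<exists>s\<in>S - {z}. c s \<noteq> 0"
      and c0: "\<And>q. q \<in> P \<Longrightarrow> (\<Sum>s\<in>S - {z}. c s * b s q) = 0"
      using insert.IH[of "S - {z}" b] insert.prems by blast
    \<comment> \<open>The value at \<open>z\<close> is the one that equation \<open>p\<close>
      dictates.\<close>
    define d where "d = c(z := - (\<Sum>s\<in>S - {z}. c s * (a s p / a z p)))"
    have eq: "(\<Sum>s\<in>S. d s * a s q) = (\<Sum>s\<in>S - {z}. c s * b s q)" for q
    proof -
      have "(\<Sum>s\<in>S. d s * a s q) = d z * a z q + (\<Sum>s\<in>S - {z}. d s * a s q)"
        using z insert.prems by (simp add: sum.remove)
      also have "(\<Sum>s\<in>S - {z}. d s * a s q) = (\<Sum>s\<in>S - {z}. c s * a s q)"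
        by (intro sum.cong) (auto simp: d_def)
      moreover have "d z * a z q = - (\<Sum>s\<in>S - {z}. c s * (a s p / a z p) * a z q)"
        by (simp add: d_def sum_distrib_right)
      ultimately show ?thesis
        by (simp add: b_def sum_subtractf right_diff_distrib mult.assoc)
    qed
    have "(\<Sum>s\<in>S. d s * a s q) = 0" if "q \<in> insert p P" for q
    proof (cases "q = p")
      case True
      have "b s p = 0" for s using z by (simp add: b_def)
      then show ?thesis unfolding eq True by simp
    qed (use that c0 eq in auto)
    moreover have "\<exists>s\<in>S. d s \<noteq> 0" using c by (auto simp: d_def)
    ultimately show ?thesis by blast
  qed
qed

lemma real_fun_subspace_form_dom: "real_fun.subspace (form_dom \<nu>)"
  by (intro real_fun.subspaceI form_dom_zero form_dom_add form_dom_scale)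

lemma sum_apply: "(\<Sum>i\<in>I. F i) x = (\<Sum>i\<in>I. F i x)" for F :: "'i \<Rightarrow> 'a \<Rightarrow> 'b::comm_monoid_add"
  by (induction I rule: infinite_finite_induct) auto

lemma form_dom_sum: "(\<And>i. i \<in> I \<Longrightarrow> F i \<in> form_dom \<nu>) \<Longrightarrow> (\<Sum>i\<in>I. F i) \<in> form_dom \<nu>"
  by (rule real_fun.subspace_sum[OF real_fun_subspace_form_dom])

lemma H10_sum: "(\<And>i. i \<in> I \<Longrightarrow> F i \<in> H10) \<Longrightarrow> (\<Sum>i\<in>I. F i) \<in> H10"
  by (induction I rule: infinite_finite_induct)
     (use H10_zero in \<open>auto simp: zero_fun_def intro!: H10_add\<close>)

lemma energy_zero_left: "h \<in> H10 \<Longrightarrow> energy 0 h = 0"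
  using energy_scale_left[of h h 0] by (simp add: zero_fun_def)

lemma energy_sum_left:
  assumes "\<And>i. i \<in> I \<Longrightarrow> F i \<in> H10" "h \<in> H10"
  shows "energy (\<Sum>i\<in>I. F i) h = (\<Sum>i\<in>I. energy (F i) h)"
  using assms(1)
proof (induction I rule: infinite_finite_induct)
  case (insert i I)
  then have "energy (F i + (\<Sum>i\<in>I. F i)) h = energy (F i) h + energy (\<Sum>i\<in>I. F i) h"
    using assms(2) by (intro energy_add_left H10_sum) auto
  then show ?case
    using insert by (simp only: sum.insert if_False insert_iff simp_thms)
qed (use assms(2) in \<open>auto simp: energy_zero_left\<close>)

subsection \<open>Upper bound for the eigenvalue count\<close>

locale unit_borel_measure = finite_measure \<nu> for \<nu> :: "real measure" +
  assumes sets_nu: "sets \<nu> = sets borel"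
    and null_outside: "emeasure \<nu> (- {0<..<1}) = 0"
    and nonzero: "emeasure \<nu> {0<..<1} \<noteq> 0"
begin

lemma sets_nu_cong [measurable_cong]: "sets \<nu> = sets borel"
  by (rule sets_nu)

lemma space_nu [simp]: "space \<nu> = UNIV"
  using sets_nu by (metis sets_eq_imp_space_eq space_borel)

lemma measurable_nu: "f \<in> borel_measurable borel \<Longrightarrow> f \<in> borel_measurable \<nu>"
  using measurable_cong_sets[OF sets_nu refl] by auto

lemma AE_unit: "AE x in \<nu>. x \<in> {0<..<1}"
  using null_outside by (intro AE_I'[of "- {0<..<1}"]) (auto simp: null_sets_def sets_nu)

definition nu_inner :: "(real \<Rightarrow> real) \<Rightarrow> (real \<Rightarrow> real) \<Rightarrow> real" where
  "nu_inner f g = (LINT x|\<nu>. f x * g x)"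

lemma bounded_borel_integrable:
  assumes "bounded_borel f"
  shows "integrable \<nu> f"
proof -
  obtain K where "\<And>x. \<bar>f x\<bar> \<le> K" using assms by (meson bounded_borelE)
  then show ?thesis
    using assms by (intro integrable_const_bound[of _ K] measurable_nu) (auto simp: bounded_borel_def)
qed

lemma nu_inner_add_left:
  assumes "bounded_borel f" "bounded_borel g" "bounded_borel h"
  shows "nu_inner (f + g) h = nu_inner f h + nu_inner g h"
  unfolding nu_inner_def using assms
  by (simp add: distrib_right bounded_borel_integrable bounded_borel_mult)

lemma nu_inner_scale_left: "nu_inner (\<lambda>x. c * f x) h = c * nu_inner f h"
  unfolding nu_inner_def by (simp add: mult.assoc)

lemma nu_inner_commute: "nu_inner f g = nu_inner g f"
  by (simp add: nu_inner_def mult.commute)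

lemma nu_inner_nonneg: "0 \<le> nu_inner f f"
  unfolding nu_inner_def by (rule Bochner_Integration.integral_nonneg) simp

lemma bounded_borel_sum:
  "(\<And>i. i \<in> I \<Longrightarrow> bounded_borel (F i)) \<Longrightarrow> bounded_borel (\<Sum>i\<in>I. F i)"
proof (induction I rule: infinite_finite_induct)
  case (insert i I)
  then show ?case using bounded_borel_add[of "F i" "\<Sum>i\<in>I. F i"] by (simp add: plus_fun_def)
qed (auto simp: bounded_borel_def zero_fun_def)

lemma nu_inner_sum_left:
  assumes "\<And>i. i \<in> I \<Longrightarrow> bounded_borel (F i)" "bounded_borel h"
  shows "nu_inner (\<Sum>i\<in>I. F i) h = (\<Sum>i\<in>I. nu_inner (F i) h)"
  using assms(1)
proof (induction I rule: infinite_finite_induct)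
  case (insert i I)
  then have "nu_inner (F i + (\<Sum>i\<in>I. F i)) h = nu_inner (F i) h + nu_inner (\<Sum>i\<in>I. F i) h"
    using assms(2) by (intro nu_inner_add_left bounded_borel_sum) auto
  then show ?case
    using insert by (simp only: sum.insert if_False insert_iff simp_thms)
qed (auto simp: nu_inner_def)

lemma eigenspaceD:
  "f \<in> eigenspace \<nu> l \<Longrightarrow> f \<in> form_dom \<nu>"
  "f \<in> eigenspace \<nu> l \<Longrightarrow> g \<in> form_dom \<nu> \<Longrightarrow> energy f g = l * nu_inner f g"
  by (auto simp: eigenspace_def nu_inner_def)

lemma form_dom_bounded_borel: "f \<in> form_dom \<nu> \<Longrightarrow> bounded_borel f"
  by (rule H10_bounded_borel[OF form_dom_H10])

lemma subspace_eigenspace: "real_fun.subspace (eigenspace \<nu> l)"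
proof (rule real_fun.subspaceI)
  show "0 \<in> eigenspace \<nu> l"
    unfolding eigenspace_def using form_dom_zero form_dom_H10 energy_zero_left by auto
  fix f g assume f: "f \<in> eigenspace \<nu> l" and g: "g \<in> eigenspace \<nu> l"
  note d = eigenspaceD(1)[OF f] eigenspaceD(1)[OF g]
  show "f + g \<in> eigenspace \<nu> l"
    unfolding eigenspace_def nu_inner_def[symmetric]
  proof (intro CollectI conjI ballI form_dom_add d)
    fix h assume h: "h \<in> form_dom \<nu>"
    show "energy (f + g) h = l * nu_inner (f + g) h"
      using d h eigenspaceD(2)[OF f h] eigenspaceD(2)[OF g h]
      by (simp add: energy_add_left form_dom_H10 nu_inner_add_left form_dom_bounded_borel algebra_simps)
  qed
next
  fix c f assume f: "f \<in> eigenspace \<nu> l"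
  note d = eigenspaceD(1)[OF f]
  show "(\<lambda>x. c * f x) \<in> eigenspace \<nu> l"
    unfolding eigenspace_def nu_inner_def[symmetric]
  proof (intro CollectI conjI ballI form_dom_scale d)
    fix h assume h: "h \<in> form_dom \<nu>"
    show "energy (\<lambda>x. c * f x) h = l * nu_inner (\<lambda>x. c * f x) h"
      using d h eigenspaceD(2)[OF f h]
      by (simp add: energy_scale_left form_dom_H10 nu_inner_scale_left)
  qed
qed

lemma eigenfunctions_orthogonal:
  assumes f: "f \<in> eigenspace \<nu> l" and g: "g \<in> eigenspace \<nu> m" and "l \<noteq> m"
  shows "nu_inner f g = 0"
proof -
  have "l * nu_inner f g = m * nu_inner f g"
    using eigenspaceD(2)[OF f eigenspaceD(1)[OF g]] eigenspaceD(2)[OF g eigenspaceD(1)[OF f]]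
    by (simp add: energy_commute nu_inner_commute)
  then show ?thesis using \<open>l \<noteq> m\<close> by simp
qed

text \<open>Eigenfunctions for different eigenvalues are orthogonal for \<nu> and hence for the
  energy, so both forms split over \<open>L\<close>, with factors \<open>l \<le> x\<close> between
  the summands. The splitting of the energy is a conclusion of its own because zero energy of the
  sum must later force every component to vanish.\<close>

lemma sum_of_eigenfunctions_le:
  assumes L: "finite L" "\<And>l. l \<in> L \<Longrightarrow> l \<le> x" "\<And>l. l \<in> L \<Longrightarrow> F l \<in> eigenspace \<nu> l"
  shows "energy (\<Sum>l\<in>L. F l) (\<Sum>l\<in>L. F l) = (\<Sum>l\<in>L. energy (F l) (F l))"
    and "energy (\<Sum>l\<in>L. F l) (\<Sum>l\<in>L. F l) \<le> x * nu_inner (\<Sum>l\<in>L. F l) (\<Sum>l\<in>L. F l)"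
proof -
  let ?f = "\<Sum>l\<in>L. F l"
  have dom: "F l \<in> form_dom \<nu>" if "l \<in> L" for l
    using eigenspaceD(1) L(3) that by blast
  have f: "?f \<in> form_dom \<nu>" by (rule form_dom_sum) (rule dom)
  have *: "nu_inner (F l) ?f = nu_inner (F l) (F l)" if l: "l \<in> L" for l
  proof -
    have "nu_inner (F l) ?f = (\<Sum>m\<in>L. nu_inner (F m) (F l))"
      unfolding nu_inner_commute[of "F l" ?f]
      by (rule nu_inner_sum_left) (use dom l form_dom_bounded_borel in auto)
    also have "\<dots> = (\<Sum>m\<in>{l}. nu_inner (F m) (F l))"
      using L l by (intro sum.mono_neutral_right) (auto intro!: eigenfunctions_orthogonal)
    finally show ?thesis by simp
  qed
  have E: "energy ?f ?f = (\<Sum>l\<in>L. energy (F l) ?f)"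
    by (rule energy_sum_left) (use dom f form_dom_H10 in auto)
  have El: "energy (F l) ?f = l * nu_inner (F l) (F l)" if "l \<in> L" for l
    using eigenspaceD(2)[OF L(3)[OF that] f] *[OF that] by simp
  have El': "energy (F l) (F l) = l * nu_inner (F l) (F l)" if "l \<in> L" for l
    using eigenspaceD(2)[OF L(3)[OF that] dom[OF that]] .
  show "energy ?f ?f = (\<Sum>l\<in>L. energy (F l) (F l))"
    unfolding E using El El' by (intro sum.cong) auto
  have "nu_inner ?f ?f = (\<Sum>l\<in>L. nu_inner (F l) ?f)"
    by (rule nu_inner_sum_left) (use dom f form_dom_bounded_borel in auto)
  also have "\<dots> = (\<Sum>l\<in>L. nu_inner (F l) (F l))"
    using * by simp
  finally have N: "nu_inner ?f ?f = (\<Sum>l\<in>L. nu_inner (F l) (F l))" .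
  show "energy ?f ?f \<le> x * nu_inner ?f ?f"
    unfolding E N sum_distrib_left
    using L(2) El by (intro sum_mono) (simp add: mult_right_mono nu_inner_nonneg)
qed

section \<open>Heavy dyadic intervals and the number of independent eigenfunctions\<close>

definition charge :: "nat \<Rightarrow> nat \<Rightarrow> real" where
  "charge n k = measure \<nu> (dyadic_interval n k)"

text \<open>The threshold is 1/2 and not 1 to leave slack: for a combination of eigenfunctions one
  has \<open>energy f f \<le> x * nu_inner f f\<close>, and only a bound of the right side by a
  proper fraction of the energy forces zero energy.\<close>

definition heavy :: "real \<Rightarrow> (nat \<times> nat) set" where
  "heavy x = {(n, k). k < 2 ^ n \<and> 1 / 2 < x * charge n k / 2 ^ n}"

lemma heavy_level_bounded:
  assumes "0 < x"
  obtains N where "\<And>n k. (n, k) \<in> heavy x \<Longrightarrow> n < N"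
proof -
  obtain N where N: "2 * x * measure \<nu> UNIV < 2 ^ N"
    using real_arch_pow[of 2 "2 * x * measure \<nu> UNIV"] by auto
  have "n < N" if "(n, k) \<in> heavy x" for n k
  proof (rule ccontr)
    assume "\<not> n < N"
    have "2 ^ n < 2 * x * charge n k"
      using that by (simp add: heavy_def field_simps)
    also have "\<dots> \<le> 2 * x * measure \<nu> UNIV"
      using assms bounded_measure[of "dyadic_interval n k"]
      by (intro mult_left_mono) (auto simp: charge_def)
    also have "\<dots> < 2 ^ N" by (rule N)
    also have "\<dots> \<le> 2 ^ n" using \<open>\<not> n < N\<close> by (intro power_increasing) auto
    finally show False by simp
  qed
  then show ?thesis by (rule that)
qed

lemma finite_heavy:
  assumes "0 < x"
  shows "finite (heavy x)"
proof -
  obtain N where "\<And>n k. (n, k) \<in> heavy x \<Longrightarrow> n < N"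
    using heavy_level_bounded[OF assms] by blast
  then have "heavy x \<subseteq> (SIGMA n:{..<N}. {..<2 ^ n})"
    by (auto simp: heavy_def)
  then show ?thesis by (rule finite_subset) auto
qed

lemma dyadic_interval_sets [measurable]: "dyadic_interval n k \<in> sets borel"
  by (simp add: dyadic_interval_def)

lemma dyadic_interval_split:
  "dyadic_interval n k = dyadic_interval (Suc n) (2 * k) \<union> dyadic_interval (Suc n) (2 * k + 1)"
  "dyadic_interval (Suc n) (2 * k) \<inter> dyadic_interval (Suc n) (2 * k + 1) = {}"
  by (auto simp: dyadic_interval_def field_simps)

lemma dyadic_interval_subset:
  assumes "k < 2 ^ n"
  shows "dyadic_interval n k \<subseteq> {0<..1}"
proof -
  have "real (k + 1) \<le> 2 ^ n"
    using assms by (metis Suc_eq_plus1 Suc_leI of_nat_le_iff of_nat_numeral of_nat_power)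
  then have 1: "real (k + 1) / 2 ^ n \<le> 1" by simp
  have 0: "0 \<le> real k / 2 ^ n" by simp
  show ?thesis
  proof
    fix y assume "y \<in> dyadic_interval n k"
    then have "real k / 2 ^ n < y" "y \<le> real (k + 1) / 2 ^ n"
      unfolding dyadic_interval_def by (simp_all only: greaterThanAtMost_iff)
    with 0 1 show "y \<in> {0<..1}" by (meson greaterThanAtMost_iff le_less_trans order_trans)
  qed
qed

lemma nu_set_integrable: "bounded_borel f \<Longrightarrow> A \<in> sets borel \<Longrightarrow> set_integrable \<nu> A f"
  unfolding set_integrable_def using bounded_borel_integrable sets_nu
  by (intro integrable_mult_indicator) auto

lemma dyadic_poincare:
  assumes f: "f \<in> H10" and k: "k < 2 ^ n" and 0: "f (real k / 2 ^ n) = 0"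
  shows "(LINT y:dyadic_interval n k|\<nu>. (f y)\<^sup>2)
     \<le> charge n k / 2 ^ n * (LINT t:dyadic_interval n k|lborel. (weak_gradient f t)\<^sup>2)"
proof -
  let ?g = "weak_gradient f" and ?A = "dyadic_interval n k"
  let ?G = "LINT t:?A|lborel. (?g t)\<^sup>2"
  have g: "square_integrable ?g" using H10D[OF f] by (simp add: is_weak_gradient_iff)
  have sub: "?A \<subseteq> {0<..1}" by (rule dyadic_interval_subset[OF k])
  have "(f y)\<^sup>2 \<le> ?G / 2 ^ n" if y: "y \<in> ?A" for y
  proof -
    let ?a = "real k / 2 ^ n"
    have y': "?a \<le> y" "y \<le> 1" "y - ?a \<le> 1 / 2 ^ n" "{?a<..y} \<subseteq> ?A"
      using y sub by (auto simp: dyadic_interval_def add_divide_distrib)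
    have "(f y - f ?a)\<^sup>2 \<le> (y - ?a) * (LINT t:{?a<..y}|lborel. (?g t)\<^sup>2)"
      using y' by (intro weak_gradient_increment_square_le[OF H10D[OF f]]) auto
    also have "\<dots> \<le> (1 / 2 ^ n) * ?G"
    proof (rule mult_mono)
      show "(LINT t:{?a<..y}|lborel. (?g t)\<^sup>2) \<le> ?G"
        using sub by (intro set_integral_square_mono[OF g y'(4)]) auto
      show "0 \<le> (LINT t:{?a<..y}|lborel. (?g t)\<^sup>2)"
        unfolding set_lebesgue_integral_def by (rule Bochner_Integration.integral_nonneg) simp
    qed (use y' in auto)
    finally show ?thesis using 0 by simp
  qed
  then have "(LINT y:?A|\<nu>. (f y)\<^sup>2) \<le> (LINT y:?A|\<nu>. ?G / 2 ^ n)"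
    using bounded_borel_mult[OF H10_bounded_borel[OF f] H10_bounded_borel[OF f]]
    by (intro set_integral_mono nu_set_integrable)
       (auto simp: power2_eq_square bounded_borel_def)
  also have "\<dots> = charge n k / 2 ^ n * ?G"
    by (simp add: set_lebesgue_integral_def charge_def sets_nu)
  finally show ?thesis .
qed

lemma not_heavy_poincare:
  assumes f: "f \<in> H10" and x: "0 < x" and n: "(n, k) \<notin> heavy x" "k < 2 ^ n" "f (real k / 2 ^ n) = 0"
  shows "x * (LINT y:dyadic_interval n k|\<nu>. (f y)\<^sup>2)
      \<le> 1 / 2 * (LINT t:dyadic_interval n k|lborel. (weak_gradient f t)\<^sup>2)"
proof -
  let ?G = "LINT t:dyadic_interval n k|lborel. (weak_gradient f t)\<^sup>2"
  have "x * (LINT y:dyadic_interval n k|\<nu>. (f y)\<^sup>2) \<le> x * (charge n k / 2 ^ n * ?G)"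
    using dyadic_poincare[OF f n(2,3)] x by (intro mult_left_mono) auto
  also have "\<dots> = (x * charge n k / 2 ^ n) * ?G" by simp
  also have "\<dots> \<le> 1 / 2 * ?G"
  proof (rule mult_right_mono)
    show "0 \<le> ?G"
      unfolding set_lebesgue_integral_def by (rule Bochner_Integration.integral_nonneg) simp
  qed (use n in \<open>auto simp: heavy_def\<close>)
  finally show ?thesis .
qed

text \<open>Induction on the distance \<open>d\<close> to a level \<open>N\<close> from which on no
  interval is heavy. A heavy interval is halved: the left child inherits the zero at the left
  endpoint of its parent, and the left endpoint of the right child is the midpoint where
  \<open>mid\<close> provides a zero. An interval that is not heavy satisfies the estimate by
  itself.\<close>

lemma heavy_midpoints_induct:
  assumes f: "f \<in> H10" and x: "0 < x"
    and mid: "\<And>m j. (m, j) \<in> heavy x \<Longrightarrow> f (real (2 * j + 1) / 2 ^ Suc m) = 0"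
    and N: "\<And>m j. (m, j) \<in> heavy x \<Longrightarrow> m < N"
  shows "n + d = N \<Longrightarrow> k < 2 ^ n \<Longrightarrow> f (real k / 2 ^ n) = 0 \<Longrightarrow>
    x * (LINT y:dyadic_interval n k|\<nu>. (f y)\<^sup>2)
      \<le> 1 / 2 * (LINT t:dyadic_interval n k|lborel. (weak_gradient f t)\<^sup>2)"
proof (induction d arbitrary: n k)
  case 0
  then have "(n, k) \<notin> heavy x" using N[of n k] by auto
  then show ?case using not_heavy_poincare[OF f x] 0 by blast
  next
  case (Suc d)
  show ?case
  proof (cases "(n, k) \<in> heavy x")
    case False
    then show ?thesis using not_heavy_poincare[OF f x] Suc.prems by blast
  next
    case True
    let ?L = "dyadic_interval (Suc n) (2 * k)" and ?R = "dyadic_interval (Suc n) (2 * k + 1)"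
    let ?g = "weak_gradient f"
    have g: "square_integrable ?g" using H10D[OF f] by (simp add: is_weak_gradient_iff)
    have k2: "2 * k < 2 ^ Suc n" "2 * k + 1 < 2 ^ Suc n" using Suc.prems(2) by auto
    have "f (real (2 * k) / 2 ^ Suc n) = 0" using Suc.prems(3) by simp
    then have 1: "x * (LINT y:?L|\<nu>. (f y)\<^sup>2) \<le> 1 / 2 * (LINT t:?L|lborel. (?g t)\<^sup>2)"
      using Suc.IH[of "Suc n" "2 * k"] Suc.prems(1) k2 by simp
    have 2: "x * (LINT y:?R|\<nu>. (f y)\<^sup>2) \<le> 1 / 2 * (LINT t:?R|lborel. (?g t)\<^sup>2)"
      using Suc.IH[of "Suc n" "2 * k + 1"] Suc.prems(1) k2 mid[OF True] by simp
    have "(LINT y:?L \<union> ?R|\<nu>. (f y)\<^sup>2) = (LINT y:?L|\<nu>. (f y)\<^sup>2) + (LINT y:?R|\<nu>. (f y)\<^sup>2)"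
      using bounded_borel_mult[OF H10_bounded_borel[OF f] H10_bounded_borel[OF f]]
      by (intro set_integral_Un dyadic_interval_split nu_set_integrable) (auto simp: power2_eq_square)
    moreover have "(LINT t:?L \<union> ?R|lborel. (?g t)\<^sup>2) = (LINT t:?L|lborel. (?g t)\<^sup>2) + (LINT t:?R|lborel. (?g t)\<^sup>2)"
    proof (intro set_integral_Un dyadic_interval_split)
      have "{0<..1} \<subseteq> {0..1::real}" by auto
      then have "?L \<subseteq> {0..1}" "?R \<subseteq> {0..1}" using dyadic_interval_subset k2 by blast+
      then show "set_integrable lborel ?L (\<lambda>t. (?g t)\<^sup>2)" "set_integrable lborel ?R (\<lambda>t. (?g t)\<^sup>2)"
        using g by (auto simp: square_integrable_def elim!: set_integrable_subset)
    qed
    ultimately show ?thesis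
      using 1 2 unfolding dyadic_interval_split(1)[of n k] by (simp add: algebra_simps)
  qed
qed

lemma heavy_midpoints_zero_imp:
  assumes f: "f \<in> H10" and x: "0 < x"
    and mid: "\<And>m j. (m, j) \<in> heavy x \<Longrightarrow> f (real (2 * j + 1) / 2 ^ Suc m) = 0"
  shows "x * nu_inner f f \<le> energy f f / 2"
proof -
  let ?g = "weak_gradient f"
  have g: "square_integrable ?g" using H10D[OF f] by (simp add: is_weak_gradient_iff)
  obtain N where "\<And>m j. (m, j) \<in> heavy x \<Longrightarrow> m < N"
    using heavy_level_bounded[OF x] by blast
  \<comment> \<open>The root \<open>(0, 1]\<close> also needs a zero at its left endpoint; this is
    the boundary value \<open>f 0 = 0\<close>.\<close>
  from heavy_midpoints_induct[OF f x mid this, where n = 0 and d = N and k = 0]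
  have *: "x * (LINT y:{0<..1}|\<nu>. (f y)\<^sup>2) \<le> 1 / 2 * (LINT t:{0<..1}|lborel. (?g t)\<^sup>2)"
    using H10_boundary[OF f] by (simp add: dyadic_interval_def)
  have "(LINT y:{0<..1}|\<nu>. (f y)\<^sup>2) = nu_inner f f"
    unfolding nu_inner_def set_lebesgue_integral_def
  proof (rule integral_cong_AE)
    have [measurable]: "f \<in> borel_measurable borel"
      using H10_bounded_borel[OF f] by (rule bounded_borel_measurable)
    show "(\<lambda>x. f x * f x) \<in> borel_measurable \<nu>"
      "(\<lambda>y. indicator {0<..1} y *\<^sub>R (f y)\<^sup>2) \<in> borel_measurable \<nu>"
      by measurable
    show "AE y in \<nu>. indicator {0<..1} y *\<^sub>R (f y)\<^sup>2 = f y * f y"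
      using AE_unit by eventually_elim (simp add: power2_eq_square)
  qed
  moreover have "(LINT t:{0<..1}|lborel. (?g t)\<^sup>2) \<le> (LINT t:{0..1}|lborel. (?g t)\<^sup>2)"
    by (rule set_integral_square_mono[OF g]) auto
  moreover have "(LINT t:{0..1}|lborel. (?g t)\<^sup>2) = energy f f"
    unfolding energy_eq[OF H10D[OF f] H10D[OF f]] l2_inner_def by (simp add: power2_eq_square)
  ultimately show ?thesis using * by simp
qed

text \<open>One zero is prescribed per heavy interval. If there are more functions than zeros, some
  nontrivial combination satisfies
  \<open>energy f f \<le> x * nu_inner f f \<le> energy f f / 2\<close>, so its energy is 0. The
  energy splits over the eigenvalues, hence each component \<open>F l\<close> vanishes, and
  independence inside one eigenspace annihilates the coefficients. The families are arbitrary finite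
  ones because the lemma must also yield that eigenspaces are finite-dimensional and that the
  eigenvalues up to \<open>x\<close> are finite in number.\<close>

lemma independent_eigenfunctions_card_le:
  assumes x: "0 < x" and L: "finite L" "\<And>l. l \<in> L \<Longrightarrow> l \<le> x"
    and B: "\<And>l. l \<in> L \<Longrightarrow> finite (B l)" "\<And>l. l \<in> L \<Longrightarrow> B l \<subseteq> eigenspace \<nu> l"
      "\<And>l. l \<in> L \<Longrightarrow> real_fun.independent (B l)"
  shows "card (Sigma L B) \<le> card (heavy x)"
proof (rule ccontr)
  assume "\<not> card (Sigma L B) \<le> card (heavy x)"
  then have "card (heavy x) < card (Sigma L B)" by simp
  moreover have "finite (Sigma L B)" using L B by auto
  ultimately obtain c where c: "\<exists>s\<in>Sigma L B. c s \<noteq> 0"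
    and c0: "\<forall>p\<in>heavy x. (\<Sum>s\<in>Sigma L B. c s * snd s (real (2 * snd p + 1) / 2 ^ Suc (fst p))) = 0"
    using homogeneous_system_nontrivial_solution[OF finite_heavy[OF x], of "Sigma L B"
        "\<lambda>s p. snd s (real (2 * snd p + 1) / 2 ^ Suc (fst p))"] by blast
  define F where "F = (\<lambda>l. \<Sum>b\<in>B l. (\<lambda>y. c (l, b) * b y))"
  define f where "f = (\<Sum>l\<in>L. F l)"
  have F: "F l \<in> eigenspace \<nu> l" if "l \<in> L" for l
    unfolding F_def using that B(2) subspace_eigenspace
    by (intro real_fun.subspace_sum real_fun.subspace_scale) auto
  have f: "f \<in> H10"
    unfolding f_def using F eigenspaceD(1) form_dom_H10 by (intro H10_sum) blast
  have fy: "f y = (\<Sum>s\<in>Sigma L B. c s * snd s y)" for y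
    unfolding f_def F_def sum_apply
    by (subst sum.Sigma) (use L B in \<open>auto simp: case_prod_beta\<close>)
  have "x * nu_inner f f \<le> energy f f / 2"
    by (rule heavy_midpoints_zero_imp[OF f x]) (use c0 in \<open>force simp: fy\<close>)
  moreover have "energy f f \<le> x * nu_inner f f"
    unfolding f_def by (rule sum_of_eigenfunctions_le(2)[OF L F])
  ultimately have "energy f f = 0" using energy_nonneg[OF f] by simp
  then have "(\<Sum>l\<in>L. energy (F l) (F l)) = 0"
    using sum_of_eigenfunctions_le(1)[OF L F] by (simp add: f_def)
  moreover have FH: "F l \<in> H10" if "l \<in> L" for l
    using F[OF that] eigenspaceD(1) form_dom_H10 by blast
  ultimately have "\<forall>l\<in>L. energy (F l) (F l) = 0"
    using L(1) by (subst (asm) sum_nonneg_eq_0_iff) (auto intro: energy_nonneg)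
  then have "F l = 0" if "l \<in> L" for l
    using that FH H10_energy_zero_imp_zero by blast
  then have "c (l, b) = 0" if "l \<in> L" "b \<in> B l" for l b
    using that real_fun.independentD[OF B(3)[OF that(1)] B(1)[OF that(1)] subset_refl, of "\<lambda>b. c (l, b)" b]
    unfolding F_def by simp
  then show False using c by auto
qed

text \<open>\<open>eigenvalue_count\<close> has the value infinity unless finiteness is established,
  so this comes first: an infinite basis, or infinitely many eigenvalues up to \<open>x\<close>,
  would supply \<open>card (heavy x) + 1\<close> independent eigenfunctions. The bases are returned
  because the lower bound needs functions orthogonal to all of them.\<close>

theorem eigenvalue_count_bases:
  assumes x: "0 < x"
  defines "E \<equiv> {l. eigenvalue \<nu> l \<and> l \<le> x}"
  obtains B where "finite E" "\<And>l. l \<in> E \<Longrightarrow> finite (B l)"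
    "\<And>l. l \<in> E \<Longrightarrow> B l \<subseteq> eigenspace \<nu> l" "\<And>l. l \<in> E \<Longrightarrow> eigenspace \<nu> l \<subseteq> real_fun.span (B l)"
    "eigenvalue_count \<nu> x = enat (card (Sigma E B))" "card (Sigma E B) \<le> card (heavy x)"
proof -
  have "\<exists>B. B \<subseteq> eigenspace \<nu> l \<and> real_fun.independent B \<and> eigenspace \<nu> l \<subseteq> real_fun.span B" for l
    by (rule real_fun.maximal_independent_subset) auto
  then obtain B where B: "\<And>l. B l \<subseteq> eigenspace \<nu> l" "\<And>l. real_fun.independent (B l)"
    "\<And>l. eigenspace \<nu> l \<subseteq> real_fun.span (B l)" by metis
  have finB: "finite (B l)" if "l \<in> E" for l
  proof (rule ccontr)
    assume "infinite (B l)"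
    then obtain C where C: "C \<subseteq> B l" "finite C" "card C = Suc (card (heavy x))"
      using infinite_arbitrarily_large by blast
    have "card (Sigma {l} (\<lambda>_. C)) \<le> card (heavy x)"
      using that C B real_fun.independent_mono[OF B(2)[of l] C(1)]
      by (intro independent_eigenfunctions_card_le[OF x]) (auto simp: E_def)
    then show False using C by simp
  qed
  have ne: "\<exists>f. f \<in> eigenspace \<nu> l \<and> f \<noteq> 0" if "l \<in> E" for l
    using that by (auto simp: E_def eigenvalue_def)
  have finE: "finite E"
  proof (rule ccontr)
    assume "infinite E"
    then obtain L where L: "L \<subseteq> E" "finite L" "card L = Suc (card (heavy x))"
      using infinite_arbitrarily_large by blast
    obtain h where h: "\<And>l. l \<in> E \<Longrightarrow> h l \<in> eigenspace \<nu> l \<and> h l \<noteq> 0"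
      using ne by metis
    have "card (Sigma L (\<lambda>l. {h l})) \<le> card (heavy x)"
    proof (rule independent_eigenfunctions_card_le[OF x L(2)])
      fix l assume "l \<in> L"
      then show "real_fun.independent {h l}"
        using real_fun.dependent_single h L(1) by blast
    qed (use L h in \<open>auto simp: E_def\<close>)
    then show False using L by simp
  qed
  have "real_fun.dim (eigenspace \<nu> l) = card (B l)" for l
    using real_fun.basis_card_eq_dim[OF B(1) B(3) B(2)] by simp
  moreover have "\<forall>l\<in>E. multiplicity_finite \<nu> l"
    unfolding multiplicity_finite_def using finB B(3) by blast
  ultimately have "eigenvalue_count \<nu> x = enat (\<Sum>l\<in>E. card (B l))"
    unfolding eigenvalue_count_def using finE by (simp add: E_def)
  also have "(\<Sum>l\<in>E. card (B l)) = card (Sigma E B)"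
    using finE finB by simp
  finally have "eigenvalue_count \<nu> x = enat (card (Sigma E B))" .
  moreover have "card (Sigma E B) \<le> card (heavy x)"
    using finE finB B by (intro independent_eigenfunctions_card_le[OF x]) (auto simp: E_def)
  ultimately show ?thesis using that finE finB B by blast
qed

end

subsection \<open>The Green operator\<close>

lemma quadratic_nonneg_imp_discriminant:
  fixes A B C :: real
  assumes "\<And>t. 0 \<le> A + 2 * t * B + t\<^sup>2 * C" "0 \<le> C"
  shows "B\<^sup>2 \<le> A * C"
proof (cases "C = 0")
  case True
  have "B = 0"
  proof (rule ccontr)
    assume "B \<noteq> 0"
    then have "2 * (- (A + 1) / (2 * B)) * B = - (A + 1)" by simp
    then show False using assms(1)[of "- (A + 1) / (2 * B)"] True by simp
  qed
  then show ?thesis using True by simp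
next
  case False
  then have "0 < C" using assms(2) by simp
  have "0 \<le> (A + 2 * (- B / C) * B + (- B / C)\<^sup>2 * C) * C"
    using assms(1)[of "- B / C"] \<open>0 < C\<close> by (intro mult_nonneg_nonneg) auto
  also have "\<dots> = A * C - B\<^sup>2"
    using \<open>0 < C\<close> by (simp add: field_simps power2_eq_square)
  finally show ?thesis by simp
qed

lemma energy_Cauchy_Schwarz:
  assumes "f \<in> H10" "g \<in> H10"
  shows "(energy f g)\<^sup>2 \<le> energy f f * energy g g"
proof (rule quadratic_nonneg_imp_discriminant)
  fix t
  let ?tg = "\<lambda>x. t * g x"
  note H = assms(1) H10_scale[OF assms(2), of t] H10_add[OF assms(1) H10_scale[OF assms(2), of t]]
  have "energy (f + ?tg) (f + ?tg) = energy f f + 2 * t * energy f g + t\<^sup>2 * energy g g"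
    using energy_add_left[OF H(1,2,3)] energy_add_left[OF H(1,2,1)] energy_add_left[OF H(1,2,2)]
      energy_scale_left[OF assms(2,1), of t] energy_scale_left[OF assms(2) H(2), of t]
      energy_scale_left[OF assms(2) assms(2), of t]
      energy_commute[of f "f + ?tg"] energy_commute[of ?tg "f + ?tg"] energy_commute[of ?tg f]
      energy_commute[of g f] energy_commute[of g ?tg]
    by (simp add: algebra_simps power2_eq_square)
  then show "0 \<le> energy f f + 2 * t * energy f g + t\<^sup>2 * energy g g"
    using energy_nonneg[OF H(3)] by metis
qed (rule energy_nonneg[OF assms(2)])

context unit_borel_measure
begin

lemma nu_inner_Cauchy_Schwarz:
  assumes "bounded_borel f" "bounded_borel g"
  shows "(nu_inner f g)\<^sup>2 \<le> nu_inner f f * nu_inner g g"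
proof (rule quadratic_nonneg_imp_discriminant)
  fix t
  have i: "integrable \<nu> (\<lambda>x. f x * f x)" "integrable \<nu> (\<lambda>x. f x * g x)" "integrable \<nu> (\<lambda>x. g x * g x)"
    using assms by (auto intro!: bounded_borel_integrable bounded_borel_mult)
  have "0 \<le> (LINT x|\<nu>. (f x + t * g x)\<^sup>2)"
    by (rule Bochner_Integration.integral_nonneg) simp
  also have "(LINT x|\<nu>. (f x + t * g x)\<^sup>2) = (LINT x|\<nu>. f x * f x + 2 * t * (f x * g x) + t\<^sup>2 * (g x * g x))"
    by (simp add: power2_eq_square algebra_simps)
  also have "\<dots> = nu_inner f f + 2 * t * nu_inner f g + t\<^sup>2 * nu_inner g g"
    unfolding nu_inner_def using i by simp
  finally show "0 \<le> nu_inner f f + 2 * t * nu_inner f g + t\<^sup>2 * nu_inner g g" .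
qed (rule nu_inner_nonneg)

text \<open>The norm that controls the Green operator: the supremum and the Lipschitz constant of
  \<open>green f\<close> are at most \<open>nu_norm1 f\<close>, so convergence of arguments in mean
  gives uniform convergence of images.\<close>

definition nu_norm1 :: "(real \<Rightarrow> real) \<Rightarrow> real" where
  "nu_norm1 f = (LINT x|\<nu>. \<bar>f x\<bar>)"

lemma bounded_borel_abs: "bounded_borel f \<Longrightarrow> bounded_borel (\<lambda>x. \<bar>f x\<bar>)"
  by (auto simp: bounded_borel_def)

lemma nu_norm1_nonneg: "0 \<le> nu_norm1 f"
  unfolding nu_norm1_def by (rule Bochner_Integration.integral_nonneg) simp

lemma nu_norm1_square_le:
  assumes "bounded_borel f"
  shows "(nu_norm1 f)\<^sup>2 \<le> measure \<nu> UNIV * nu_inner f f"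
proof -
  have "bounded_borel (\<lambda>x. 1)" by (auto simp: bounded_borel_def)
  from nu_inner_Cauchy_Schwarz[OF bounded_borel_abs[OF assms] this]
  show ?thesis by (simp add: nu_norm1_def nu_inner_def mult.commute flip: abs_mult)
qed

text \<open>The derivative in \<open>t\<close> of the Green kernel \<open>min t y - t * y\<close> on the unit square.\<close>

definition green_kernel_gradient :: "real \<Rightarrow> real \<Rightarrow> real" where
  "green_kernel_gradient t y = indicator {0<..<1} y * (indicator {..y} t - y)"

definition green_gradient :: "(real \<Rightarrow> real) \<Rightarrow> real \<Rightarrow> real" where
  "green_gradient \<phi> t = (LINT y|\<nu>. green_kernel_gradient t y * \<phi> y)"

text \<open>Defined by integrating a gradient instead of the kernel itself, so that the weak
  gradient is known by definition and membership in \<open>H10\<close> reduces to the boundary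
  values.\<close>

definition green :: "(real \<Rightarrow> real) \<Rightarrow> real \<Rightarrow> real" where
  "green \<phi> x = (if x \<in> {0..1} then LINT t:{0..x}|lborel. green_gradient \<phi> t else 0)"

text \<open>The cut-off to \<open>0 < y < 1\<close> in the kernel gradient makes this bound hold on
  the whole line; it costs nothing, as \<nu> does not charge the complement.\<close>

lemma green_kernel_gradient_abs_le: "\<bar>green_kernel_gradient t y\<bar> \<le> 1"
  by (auto simp: green_kernel_gradient_def indicator_def)

lemma green_kernel_gradient_measurable [measurable]:
  "(\<lambda>(t, y). green_kernel_gradient t y) \<in> borel_measurable (borel \<Otimes>\<^sub>M borel)"
proof -
  have "(\<lambda>(t, y). green_kernel_gradient t y) =
     (\<lambda>p. indicator {0<..<1} (snd p) * ((if fst p \<le> snd p then 1 else 0) - snd p))"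
    by (auto simp: green_kernel_gradient_def indicator_def fun_eq_iff)
  also have "\<dots> \<in> borel_measurable (borel \<Otimes>\<^sub>M borel)" by measurable
  finally show ?thesis .
qed

lemma green_kernel_bounded_borel: "bounded_borel (green_kernel_gradient t)"
  unfolding bounded_borel_def using green_kernel_gradient_abs_le by (auto intro!: exI[of _ 1])

lemma green_gradient_measurable:
  assumes [measurable]: "\<phi> \<in> borel_measurable borel"
  shows "green_gradient \<phi> \<in> borel_measurable borel"
  unfolding green_gradient_def by measurable

lemma green_gradient_abs_le:
  assumes "bounded_borel \<phi>"
  shows "\<bar>green_gradient \<phi> t\<bar> \<le> nu_norm1 \<phi>"
proof -
  have "\<bar>green_gradient \<phi> t\<bar> \<le> (LINT y|\<nu>. \<bar>green_kernel_gradient t y * \<phi> y\<bar>)"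
    unfolding green_gradient_def by (rule integral_abs_bound)
  also have "\<dots> \<le> nu_norm1 \<phi>"
    unfolding nu_norm1_def abs_mult
    by (intro integral_mono bounded_borel_integrable bounded_borel_mult bounded_borel_abs
        green_kernel_bounded_borel assms mult_left_le_one_le green_kernel_gradient_abs_le) auto
  finally show ?thesis .
qed

lemma green_gradient_square_integrable: "bounded_borel \<phi> \<Longrightarrow> square_integrable (green_gradient \<phi>)"
  by (intro square_integrable_bounded[OF green_gradient_measurable green_gradient_abs_le])
     (auto simp: bounded_borel_def)

text \<open>The integrand is dominated by \<open>\<bar>h t\<bar> * \<bar>\<phi> y\<bar>\<close>,
  since the kernel gradient is bounded by 1. The choice \<open>h = 1\<close> gives the boundary
  value at 1, the gradient of \<open>u\<close> gives the energy against \<open>u\<close>.\<close>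

lemma green_gradient_Fubini:
  assumes \<phi>: "bounded_borel \<phi>" and h: "square_integrable h"
  shows "l2_inner (green_gradient \<phi>) h
     = (LINT y|\<nu>. \<phi> y * (LINT t:{0..1}|lborel. green_kernel_gradient t y * h t))"
proof -
  interpret pair_sigma_finite lborel \<nu> ..
  have [measurable]: "\<phi> \<in> borel_measurable borel" "h \<in> borel_measurable borel"
    using \<phi> h by (auto simp: bounded_borel_def square_integrable_def)
  define F where "F = (\<lambda>t y. (indicator {0..1} t * h t) * (green_kernel_gradient t y * \<phi> y))"
  have [measurable]: "case_prod F \<in> borel_measurable (lborel \<Otimes>\<^sub>M \<nu>)"
    unfolding F_def by measurable
  have bb: "bounded_borel (\<lambda>y. green_kernel_gradient t y * \<phi> y)" for t
    by (intro bounded_borel_mult green_kernel_bounded_borel \<phi>)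
  have Fi: "integrable \<nu> (F t)" for t
    unfolding F_def by (intro integrable_mult_right bounded_borel_integrable bb)
  have F: "integrable (lborel \<Otimes>\<^sub>M \<nu>) (case_prod F)"
  proof (rule Fubini_integrable)
    have "integrable lborel (\<lambda>t. nu_norm1 \<phi> * (indicator {0..1} t *\<^sub>R h t))"
      using square_integrable_imp_set_integrable[OF h]
      by (intro integrable_mult_right) (simp add: set_integrable_def)
    then show "integrable lborel (\<lambda>t. \<integral>y. norm (case_prod F (t, y)) \<partial>\<nu>)"
    proof (rule Bochner_Integration.integrable_bound)
      show "(\<lambda>t. \<integral>y. norm (case_prod F (t, y)) \<partial>\<nu>) \<in> borel_measurable lborel"
        by measurable
      have "(\<integral>y. \<bar>F t y\<bar> \<partial>\<nu>) \<le> \<bar>nu_norm1 \<phi> * (indicator {0..1} t *\<^sub>R h t)\<bar>" for t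
      proof -
        have "(\<integral>y. \<bar>F t y\<bar> \<partial>\<nu>) \<le> (\<integral>y. \<bar>indicator {0..1} t * h t\<bar> * \<bar>\<phi> y\<bar> \<partial>\<nu>)"
        proof (rule integral_mono)
          show "integrable \<nu> (\<lambda>y. \<bar>F t y\<bar>)" using Fi by (rule integrable_abs)
          show "integrable \<nu> (\<lambda>y. \<bar>indicator {0..1} t * h t\<bar> * \<bar>\<phi> y\<bar>)"
            by (intro integrable_mult_right bounded_borel_integrable bounded_borel_abs \<phi>)
          show "\<bar>F t y\<bar> \<le> \<bar>indicator {0..1} t * h t\<bar> * \<bar>\<phi> y\<bar>" for y
            unfolding F_def abs_mult[of "indicator {0..1} t * h t"] abs_mult[of _ "\<phi> y"]
            by (intro mult_left_mono mult_left_le_one_le green_kernel_gradient_abs_le) auto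
        qed
        also have "\<dots> = \<bar>nu_norm1 \<phi> * (indicator {0..1} t *\<^sub>R h t)\<bar>"
          by (simp add: nu_norm1_def[symmetric] abs_mult nu_norm1_nonneg)
        finally show ?thesis .
      qed
      then show "AE t in lborel. norm (\<integral>y. norm (case_prod F (t, y)) \<partial>\<nu>) \<le> norm (nu_norm1 \<phi> * (indicator {0..1} t *\<^sub>R h t))"
        by (simp add: abs_of_nonneg)
    qed
    show "AE t in lborel. integrable \<nu> (\<lambda>y. case_prod F (t, y))"
      using Fi by simp
  qed (measurable)
  have "l2_inner (green_gradient \<phi>) h = (\<integral>t. (\<integral>y. F t y \<partial>\<nu>) \<partial>lborel)"
  proof -
    have "(\<integral>y. F t y \<partial>\<nu>) = (indicator {0..1} t * h t) * green_gradient \<phi> t" for t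
      unfolding F_def green_gradient_def by (rule integral_mult_right_zero)
    then show ?thesis
      by (simp add: l2_inner_def set_lebesgue_integral_def mult.commute mult.left_commute)
  qed
  also have "\<dots> = (\<integral>y. (\<integral>t. F t y \<partial>lborel) \<partial>\<nu>)"
    using Fubini_integral[OF F] by simp
  also have "\<dots> = (LINT y|\<nu>. \<phi> y * (LINT t:{0..1}|lborel. green_kernel_gradient t y * h t))"
  proof -
    have "(\<integral>t. F t y \<partial>lborel) = \<phi> y * (LINT t:{0..1}|lborel. green_kernel_gradient t y * h t)" for y
    proof -
      have "(\<lambda>t. F t y) = (\<lambda>t. \<phi> y * (indicator {0..1} t *\<^sub>R (green_kernel_gradient t y * h t)))"
        by (simp add: F_def fun_eq_iff)
      then show ?thesis
        unfolding set_lebesgue_integral_def by (simp only: integral_mult_right_zero)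
    qed
    then show ?thesis by simp
  qed
  finally show ?thesis .
qed

lemma green_kernel_gradient_integral:
  assumes h: "square_integrable h" and y: "y \<in> {0<..<1}"
  shows "(LINT t:{0..1}|lborel. green_kernel_gradient t y * h t)
     = (LINT t:{0..y}|lborel. h t) - y * (LINT t:{0..1}|lborel. h t)"
proof -
  have i: "integrable lborel (\<lambda>t. indicator {0..y} t *\<^sub>R h t)" "integrable lborel (\<lambda>t. indicator {0..1} t *\<^sub>R h t)"
    using square_integrable_subset[OF h, of "{0..y}"] square_integrable_imp_set_integrable[OF h] y
    by (auto simp: set_integrable_def)
  have "(LINT t:{0..1}|lborel. green_kernel_gradient t y * h t)
    = (LINT t|lborel. indicator {0..y} t *\<^sub>R h t - y * (indicator {0..1} t *\<^sub>R h t))"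
    unfolding set_lebesgue_integral_def using y
    by (intro Bochner_Integration.integral_cong)
       (auto simp: green_kernel_gradient_def indicator_def algebra_simps)
  also have "\<dots> = (LINT t:{0..y}|lborel. h t) - y * (LINT t:{0..1}|lborel. h t)"
    using i by (simp add: set_lebesgue_integral_def)
  finally show ?thesis .
qed

lemma green_gradient_total_zero:
  assumes \<phi>: "bounded_borel \<phi>"
  shows "(LINT t:{0..1}|lborel. green_gradient \<phi> t) = 0"
proof -
  have "(LINT t:{0..1}|lborel. green_gradient \<phi> t) = l2_inner (green_gradient \<phi>) (\<lambda>t. 1)"
    by (simp add: l2_inner_def)
  also have "\<dots> = (LINT y|\<nu>. \<phi> y * (LINT t:{0..1}|lborel. green_kernel_gradient t y * 1))"
    by (rule green_gradient_Fubini[OF \<phi> square_integrable_const])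
  also have "\<dots> = 0"
  proof (rule integral_eq_zero_AE)
    show "AE y in \<nu>. \<phi> y * (LINT t:{0..1}|lborel. green_kernel_gradient t y * 1) = 0"
      using AE_unit
    proof eventually_elim
      case (elim y)
      show ?case
        using elim unfolding green_kernel_gradient_integral[OF square_integrable_const elim]
        by (simp add: set_lebesgue_integral_def)
    qed
  qed
  finally show ?thesis .
qed

lemma green_is_weak_gradient: "bounded_borel \<phi> \<Longrightarrow> is_weak_gradient (green \<phi>) (green_gradient \<phi>)"
  by (simp add: is_weak_gradient_iff green_gradient_square_integrable green_def)

lemma green_H10:
  assumes "bounded_borel \<phi>"
  shows "green \<phi> \<in> H10"
proof -
  have "(LINT t:{0..0}|lborel. green_gradient \<phi> t) = 0"
  proof -
    have "AE t in lborel. indicator {0..0} t *\<^sub>R green_gradient \<phi> t = 0"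
      using AE_lborel_singleton[of "0::real"] by eventually_elim auto
    then show ?thesis unfolding set_lebesgue_integral_def by (rule integral_eq_zero_AE)
  qed
  then show ?thesis
    unfolding H10_def using green_is_weak_gradient[OF assms] green_gradient_total_zero[OF assms]
    by (auto simp: green_def)
qed

text \<open>The weak form of -(T \<phi>)'' = \<phi> \<nu>: for fixed \<open>y\<close> the inner
  integral is \<open>u y - y * u 1 = u y\<close>. It matters that \<open>u\<close> ranges over all
  of \<open>H10\<close> and not only over \<open>form_dom \<nu>\<close>, because combinations of
  trapezoids are inserted later.\<close>

lemma energy_green:
  assumes \<phi>: "bounded_borel \<phi>" and u: "u \<in> H10"
  shows "energy (green \<phi>) u = nu_inner \<phi> u"
proof -
  let ?h = "weak_gradient u"
  have h: "square_integrable ?h" and hu: "\<And>y. y \<in> {0..1} \<Longrightarrow> (LINT t:{0..y}|lborel. ?h t) = u y"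
    using H10D[OF u] by (auto simp: is_weak_gradient_iff)
  have [measurable]: "\<phi> \<in> borel_measurable borel" "u \<in> borel_measurable borel" "?h \<in> borel_measurable borel"
    using \<phi> H10_bounded_borel[OF u] h by (auto simp: bounded_borel_def square_integrable_def)
  have "energy (green \<phi>) u = l2_inner (green_gradient \<phi>) ?h"
    by (rule energy_eq[OF green_is_weak_gradient[OF \<phi>] H10D[OF u]])
  also have "\<dots> = (LINT y|\<nu>. \<phi> y * (LINT t:{0..1}|lborel. green_kernel_gradient t y * ?h t))"
    by (rule green_gradient_Fubini[OF \<phi> h])
  also have "\<dots> = nu_inner \<phi> u"
    unfolding nu_inner_def
  proof (rule integral_cong_AE)
    show "AE y in \<nu>. \<phi> y * (LINT t:{0..1}|lborel. green_kernel_gradient t y * ?h t) = \<phi> y * u y"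
      using AE_unit
    proof eventually_elim
      case (elim y)
      show ?case
        using elim unfolding green_kernel_gradient_integral[OF h elim]
        by (simp add: hu H10_boundary[OF u])
    qed
    show "(\<lambda>y. \<phi> y * (LINT t:{0..1}|lborel. green_kernel_gradient t y * ?h t)) \<in> borel_measurable \<nu>"
      unfolding set_lebesgue_integral_def by measurable
  qed measurable
  finally show ?thesis .
qed

lemma green_abs_le:
  assumes "bounded_borel \<phi>" "x \<in> {0..1}" "x' \<in> {0..1}"
  shows "\<bar>green \<phi> x - green \<phi> x'\<bar> \<le> nu_norm1 \<phi> * \<bar>x - x'\<bar>"
proof -
  have *: "\<bar>green \<phi> b - green \<phi> a\<bar> \<le> nu_norm1 \<phi> * (b - a)" if "0 \<le> a" "a \<le> b" "b \<le> 1" for a b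
  proof -
    have i: "set_integrable lborel {a<..b} (green_gradient \<phi>)"
      using that by (intro square_integrable_subset[OF green_gradient_square_integrable[OF assms(1)]]) auto
    have "\<bar>green \<phi> b - green \<phi> a\<bar> = \<bar>LINT t:{a<..b}|lborel. green_gradient \<phi> t\<bar>"
      using weak_gradient_increment[OF green_is_weak_gradient[OF assms(1)] that] by simp
    also have "\<dots> \<le> (LINT t|lborel. \<bar>indicator {a<..b} t *\<^sub>R green_gradient \<phi> t\<bar>)"
      unfolding set_lebesgue_integral_def by (rule integral_abs_bound)
    also have "\<dots> \<le> (LINT t|lborel. nu_norm1 \<phi> * indicator {a<..b} t)"
    proof (rule integral_mono)
      show "integrable lborel (\<lambda>t. \<bar>indicator {a<..b} t *\<^sub>R green_gradient \<phi> t\<bar>)"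
        using i by (intro integrable_abs) (simp add: set_integrable_def)
      show "integrable lborel (\<lambda>t. nu_norm1 \<phi> * indicator {a<..b} t)"
        using that by (intro integrable_mult_right integrable_real_indicator) auto
      show "\<bar>indicator {a<..b} t *\<^sub>R green_gradient \<phi> t\<bar> \<le> nu_norm1 \<phi> * indicator {a<..b} t" for t
        using green_gradient_abs_le[OF assms(1)] by (simp add: indicator_def)
    qed
    also have "\<dots> = nu_norm1 \<phi> * (b - a)" using that by simp
    finally show ?thesis .
  qed
  show ?thesis
    using *[of x x'] *[of x' x] assms(2,3) by (cases "x \<le> x'") (auto simp: abs_minus_commute)
qed

lemma green_sup_le:
  assumes "bounded_borel \<phi>"
  shows "\<bar>green \<phi> x\<bar> \<le> nu_norm1 \<phi>"
proof (cases "x \<in> {0..1}")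
  case True
  have "\<bar>green \<phi> x - green \<phi> 0\<bar> \<le> nu_norm1 \<phi> * \<bar>x - 0\<bar>"
    using True by (intro green_abs_le assms) auto
  also have "\<dots> \<le> nu_norm1 \<phi> * 1"
    using True by (intro mult_left_mono nu_norm1_nonneg) auto
  finally show ?thesis using H10_boundary[OF green_H10[OF assms]] by simp
qed (use H10_boundary[OF green_H10[OF assms]] nu_norm1_nonneg in auto)

lemma green_add_scale:
  assumes \<phi>: "bounded_borel \<phi>" and \<psi>: "bounded_borel \<psi>"
  shows "green (\<lambda>y. \<phi> y + c * \<psi> y) x = green \<phi> x + c * green \<psi> x"
proof (cases "x \<in> {0..1}")
  case True
  then have sub: "{0..x} \<subseteq> {0..1}" by auto
  have i: "integrable \<nu> (\<lambda>y. green_kernel_gradient t y * \<phi> y)" "integrable \<nu> (\<lambda>y. green_kernel_gradient t y * \<psi> y)" for t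
    by (intro bounded_borel_integrable bounded_borel_mult green_kernel_bounded_borel \<phi> \<psi>)+
  have g: "green_gradient (\<lambda>y. \<phi> y + c * \<psi> y) = (\<lambda>t. green_gradient \<phi> t + c * green_gradient \<psi> t)"
  proof
    fix t
    have "green_gradient (\<lambda>y. \<phi> y + c * \<psi> y) t
      = (LINT y|\<nu>. green_kernel_gradient t y * \<phi> y + c * (green_kernel_gradient t y * \<psi> y))"
      unfolding green_gradient_def by (simp add: algebra_simps)
    then show "green_gradient (\<lambda>y. \<phi> y + c * \<psi> y) t = green_gradient \<phi> t + c * green_gradient \<psi> t"
      using i by (simp add: green_gradient_def)
  qed
  have "(LINT t:{0..x}|lborel. green_gradient \<phi> t + c * green_gradient \<psi> t)
     = (LINT t:{0..x}|lborel. green_gradient \<phi> t) + (LINT t:{0..x}|lborel. c * green_gradient \<psi> t)"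
    using sub by (intro set_integral_add set_integrable_mult_right square_integrable_subset
        green_gradient_square_integrable \<phi> \<psi>) auto
  then show ?thesis using True by (simp add: green_def g)
qed (auto simp: green_def)

text \<open>The complement of the support is the union of all open null sets, and by Lindelof
  countably many of them suffice.\<close>

lemma AE_topological_support: "AE y in \<nu>. y \<in> topological_support \<nu>"
proof -
  define \<U> where "\<U> = {U. open U \<and> emeasure \<nu> U = 0}"
  obtain \<V> where \<V>: "\<V> \<subseteq> \<U>" "countable \<V>" "\<Union>\<V> = \<Union>\<U>"
    using Lindelof[of \<U>] by (auto simp: \<U>_def)
  have "(\<Union>U\<in>\<V>. U) \<in> null_sets \<nu>"
    using \<V>(1,2) by (intro null_sets_UN') (auto simp: \<U>_def null_sets_def sets_nu)
  moreover have "- topological_support \<nu> = \<Union>\<U>"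
    unfolding topological_support_def \<U>_def by (auto simp: zero_less_iff_neq_zero)
  ultimately have "- topological_support \<nu> \<in> null_sets \<nu>"
    using \<V>(3) by simp
  then show ?thesis
    by (intro AE_I'[of "- topological_support \<nu>"]) auto
qed

text \<open>\<open>green_gradient \<phi> t\<close> changes only when \<open>t\<close> passes mass of
  \<nu>, so it is constant on each gap of the support and \<open>green \<phi>\<close> is affine
  there. Thus a multiple of some \<open>green \<phi>\<close> satisfies the domain condition
  automatically.\<close>

lemma green_form_dom:
  assumes \<phi>: "bounded_borel \<phi>"
  shows "green \<phi> \<in> form_dom \<nu>"
proof -
  have "\<exists>a b. \<forall>x\<in>K. green \<phi> x = a * x + b"
    if K: "K \<in> components ({0..1} - topological_support \<nu>)" for K
  proof -
    have sub: "K \<subseteq> {0..1} - topological_support \<nu>" using K by (rule in_components_subset)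
    have conn: "connected K" using K by (rule in_components_connected)
    obtain x0 where x0: "x0 \<in> K" using in_components_nonempty[OF K] by blast
    have less: "green_gradient \<phi> x = green_gradient \<phi> x'" if "x \<in> K" "x' \<in> K" "x \<le> x'" for x x'
    proof -
      have I: "{x..x'} \<subseteq> K" using conn that by (simp add: connected_contains_Icc)
      have "AE y in \<nu>. green_kernel_gradient x y * \<phi> y = green_kernel_gradient x' y * \<phi> y"
        using AE_topological_support
      proof eventually_elim
        case (elim y)
        then have "y \<notin> {x..x'}" using I sub by blast
        then have "(x \<le> y) = (x' \<le> y)" using \<open>x \<le> x'\<close> by auto
        then show ?case by (simp add: green_kernel_gradient_def indicator_def)
      qed
      then show ?thesis
        unfolding green_gradient_def
        using bounded_borel_mult[OF green_kernel_bounded_borel \<phi>]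
        by (intro integral_cong_AE) (auto intro!: measurable_nu simp: bounded_borel_def)
    qed
    then have const: "green_gradient \<phi> x = green_gradient \<phi> x0" if "x \<in> K" for x
      using that x0 by (metis linear)
    have inc: "green \<phi> b - green \<phi> a = green_gradient \<phi> x0 * (b - a)" if "a \<in> K" "b \<in> K" "a \<le> b" for a b
    proof -
      have I: "{a..b} \<subseteq> K" using conn that by (simp add: connected_contains_Icc)
      have "green \<phi> b - green \<phi> a = (LINT t:{a<..b}|lborel. green_gradient \<phi> t)"
        using that sub by (intro weak_gradient_increment[OF green_is_weak_gradient[OF \<phi>]]) auto
      also have "\<dots> = (LINT t:{a<..b}|lborel. green_gradient \<phi> x0)"
        unfolding set_lebesgue_integral_def
      proof (rule Bochner_Integration.integral_cong[OF refl])
        fix t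
        show "indicator {a<..b} t *\<^sub>R green_gradient \<phi> t = indicator {a<..b} t *\<^sub>R green_gradient \<phi> x0"
        proof (cases "t \<in> {a<..b}")
          case True
          then have "t \<in> {a..b}" by simp
          then show ?thesis using I const[of t] by auto
        qed auto
      qed
      also have "\<dots> = green_gradient \<phi> x0 * (b - a)"
        using that by (simp add: set_lebesgue_integral_def)
      finally show ?thesis .
    qed
    have "green \<phi> x = green_gradient \<phi> x0 * x + (green \<phi> x0 - green_gradient \<phi> x0 * x0)" if "x \<in> K" for x
      using inc[of x x0] inc[of x0 x] that x0 by (cases "x \<le> x0") (auto simp: algebra_simps)
    then show ?thesis by blast
  qed
  then show ?thesis
    using green_H10[OF \<phi>] H10_continuous_on by (simp add: form_dom_def C_affine_def)
qed


subsection \<open>Existence of eigenfunctions and lower bound for the eigenvalue count\<close>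

lemma nu_inner_tendsto:
  assumes u: "\<And>n. bounded_borel (u n)" "bounded_borel v" and v: "\<And>n. bounded_borel (w n)" "bounded_borel z"
    and K: "\<And>n x. \<bar>u n x\<bar> \<le> K" "\<And>n x. \<bar>w n x\<bar> \<le> L"
    and lim: "\<And>x. (\<lambda>n. u n x) \<longlonglongrightarrow> v x" "\<And>x. (\<lambda>n. w n x) \<longlonglongrightarrow> z x"
  shows "(\<lambda>n. nu_inner (u n) (w n)) \<longlonglongrightarrow> nu_inner v z"
  unfolding nu_inner_def
proof (rule integral_dominated_convergence)
  show "integrable \<nu> (\<lambda>x. K * L)" by (intro bounded_borel_integrable) (auto simp: bounded_borel_def)
  show "(\<lambda>x. v x * z x) \<in> borel_measurable \<nu>" "\<And>n. (\<lambda>x. u n x * w n x) \<in> borel_measurable \<nu>"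
    using u v by (auto intro!: borel_measurable_integrable bounded_borel_integrable bounded_borel_mult)
  show "AE x in \<nu>. (\<lambda>n. u n x * w n x) \<longlonglongrightarrow> v x * z x"
    using lim by (intro AE_I2 tendsto_mult) auto
  have "\<bar>u n x * w n x\<bar> \<le> K * L" for n x
    unfolding abs_mult using K abs_ge_zero order_trans by (intro mult_mono) blast+
  then show "\<And>n. AE x in \<nu>. norm (u n x * w n x) \<le> K * L" by simp
qed

definition orthogonal_to :: "(real \<Rightarrow> real) set \<Rightarrow> (real \<Rightarrow> real) \<Rightarrow> bool" where
  "orthogonal_to C f \<longleftrightarrow> bounded_borel f \<and> (\<forall>b\<in>C. nu_inner f b = 0)"

text \<open>Pairing \<open>green f\<close> with an eigenfunction \<open>b\<close> gives
  \<open>1 / l\<close> times the pairing of \<open>f\<close> with \<open>b\<close>. The value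
  \<open>l = 0\<close> occurs only for \<open>b = 0\<close>, since the energy of \<open>b\<close> is
  then 0.\<close>

lemma orthogonal_to_green:
  assumes C: "\<And>b. b \<in> C \<Longrightarrow> \<exists>l. b \<in> eigenspace \<nu> l" and f: "orthogonal_to C f"
  shows "orthogonal_to C (green f)"
proof -
  have bf: "bounded_borel f" using f by (simp add: orthogonal_to_def)
  have "nu_inner (green f) b = 0" if bC: "b \<in> C" for b
  proof -
    obtain l where b: "b \<in> eigenspace \<nu> l" using C[OF bC] by blast
    have H: "b \<in> H10" using form_dom_H10[OF eigenspaceD(1)[OF b]] .
    show ?thesis
    proof (cases "l = 0")
      case True
      then have "energy b b = 0" using eigenspaceD(2)[OF b eigenspaceD(1)[OF b]] by simp
      then have "b = 0" using H10_energy_zero_imp_zero[OF H] by blast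
      then show ?thesis by (simp add: nu_inner_def)
    next
      case False
      have "l * nu_inner b (green f) = nu_inner f b"
        using eigenspaceD(2)[OF b green_form_dom[OF bf]] energy_green[OF bf H]
        by (simp add: energy_commute)
      then show ?thesis using False f bC by (simp add: orthogonal_to_def nu_inner_commute)
    qed
  qed
  then show ?thesis using H10_bounded_borel[OF green_H10[OF bf]] by (simp add: orthogonal_to_def)
qed

text \<open>The supremum of the Rayleigh quotient of T on the functions orthogonal to
  \<open>C\<close>. Once a suitable test function shows it to be positive, it is the reciprocal of
  an eigenvalue with an eigenfunction orthogonal to \<open>C\<close>.\<close>

definition green_sup :: "(real \<Rightarrow> real) set \<Rightarrow> real" where
  "green_sup C = Sup {nu_inner (green f) f |f. orthogonal_to C f \<and> nu_inner f f \<le> 1}"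

lemma green_form_le:
  assumes "bounded_borel f"
  shows "nu_inner (green f) f \<le> measure \<nu> UNIV * nu_inner f f"
proof -
  have bb: "bounded_borel (\<lambda>y. green f y * f y)"
    by (rule bounded_borel_mult[OF H10_bounded_borel[OF green_H10[OF assms]] assms])
  have "nu_inner (green f) f \<le> (LINT y|\<nu>. nu_norm1 f * \<bar>f y\<bar>)"
    unfolding nu_inner_def
  proof (rule integral_mono)
    show "integrable \<nu> (\<lambda>y. green f y * f y)" by (rule bounded_borel_integrable[OF bb])
    show "integrable \<nu> (\<lambda>y. nu_norm1 f * \<bar>f y\<bar>)"
      by (intro integrable_mult_right bounded_borel_integrable bounded_borel_abs assms)
    show "green f y * f y \<le> nu_norm1 f * \<bar>f y\<bar>" for y
    proof -
      have "green f y * f y \<le> \<bar>green f y\<bar> * \<bar>f y\<bar>" by (metis abs_ge_self abs_mult)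
      also have "\<dots> \<le> nu_norm1 f * \<bar>f y\<bar>" by (intro mult_right_mono green_sup_le assms) auto
      finally show ?thesis .
    qed
  qed
  also have "\<dots> = (nu_norm1 f)\<^sup>2" by (simp add: nu_norm1_def power2_eq_square)
  also have "\<dots> \<le> measure \<nu> UNIV * nu_inner f f" by (rule nu_norm1_square_le[OF assms])
  finally show ?thesis .
qed

lemma green_scale:
  assumes "bounded_borel f"
  shows "green (\<lambda>y. c * f y) x = c * green f x"
proof -
  have "bounded_borel (\<lambda>_. 0)" by (auto simp: bounded_borel_def)
  \<comment> \<open>The second instance says that the image of the zero function equals twice
    itself, hence is 0.\<close>
  then show ?thesis
    using green_add_scale[of "\<lambda>_. 0" f c x] green_add_scale[of "\<lambda>_. 0" "\<lambda>_. 0" 1 x] assms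
    by simp
qed

lemma green_sup_bdd: "bdd_above {nu_inner (green f) f |f. orthogonal_to C f \<and> nu_inner f f \<le> 1}"
proof (rule bdd_aboveI)
  fix m assume "m \<in> {nu_inner (green f) f |f. orthogonal_to C f \<and> nu_inner f f \<le> 1}"
  then obtain f where f: "orthogonal_to C f" "nu_inner f f \<le> 1" "m = nu_inner (green f) f" by blast
  have "m \<le> measure \<nu> UNIV * nu_inner f f"
    using f green_form_le by (simp add: orthogonal_to_def)
  also have "\<dots> \<le> measure \<nu> UNIV * 1" using f by (intro mult_left_mono) auto
  finally show "m \<le> measure \<nu> UNIV" by simp
qed

lemma green_form_le_sup:
  assumes f: "orthogonal_to C f"
  shows "nu_inner (green f) f \<le> green_sup C * nu_inner f f"
proof (cases "nu_inner f f = 0")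
  \<comment> \<open>Such an \<open>f\<close> cannot be normalised, but the crude bound by the total
    mass already gives 0.\<close>
  case True
  then show ?thesis using green_form_le[of f] f by (simp add: orthogonal_to_def)
next
  case False
  define n where "n = nu_inner f f"
  have n: "0 < n" using False nu_inner_nonneg[of f] by (simp add: n_def)
  define c where "c = 1 / sqrt n"
  let ?g = "\<lambda>y. c * f y"
  have bf: "bounded_borel f" using f by (simp add: orthogonal_to_def)
  have cc: "c * c = 1 / n" using n by (simp add: c_def)
  have g: "orthogonal_to C ?g"
    using f by (auto simp: orthogonal_to_def nu_inner_scale_left bounded_borel_scale)
  have "nu_inner ?g ?g = c * c * n"
    using nu_inner_scale_left[of c f ?g] nu_inner_scale_left[of c f f] nu_inner_commute[of f ?g]
    by (simp add: n_def)
  then have "nu_inner ?g ?g \<le> 1" using cc n by simp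
  then have "nu_inner (green ?g) ?g \<le> green_sup C"
    unfolding green_sup_def using g by (intro cSup_upper green_sup_bdd) blast
  moreover have "green ?g = (\<lambda>x. c * green f x)"
    using green_scale[OF bf] by blast
  moreover have "nu_inner (\<lambda>x. c * green f x) ?g = c * c * nu_inner (green f) f"
    using nu_inner_scale_left[of c "green f" ?g] nu_inner_scale_left[of c f "green f"]
      nu_inner_commute[of "green f"] by simp
  ultimately show ?thesis using cc n by (simp add: n_def[symmetric] field_simps)
qed

text \<open>The operator inequality T^2 \<le> M T with M the supremum, which makes the residual of a
  maximising sequence small. It comes from Cauchy-Schwarz in the energy for T f and T (T f): the
  mixed term is the \<nu>-square of T f, the energy of T (T f) is at most M times that square, and
  one factor cancels.\<close>

lemma green_norm_le:
  assumes C: "\<And>b. b \<in> C \<Longrightarrow> \<exists>l. b \<in> eigenspace \<nu> l" and f: "orthogonal_to C f"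
  shows "nu_inner (green f) (green f) \<le> green_sup C * nu_inner (green f) f"
proof -
  let ?g = "green f"
  have bf: "bounded_borel f" using f by (simp add: orthogonal_to_def)
  have H: "?g \<in> H10" "green ?g \<in> H10" and bg: "bounded_borel ?g"
    using green_H10 H10_bounded_borel bf by blast+
  have a: "energy ?g ?g = nu_inner ?g f" "energy (green ?g) (green ?g) = nu_inner (green ?g) ?g"
    "energy ?g (green ?g) = nu_inner ?g ?g"
    using energy_green[OF bf H(1)] energy_green[OF bg H(2)] energy_green[OF bg H(1)]
    by (simp_all add: nu_inner_commute energy_commute)
  have "(nu_inner ?g ?g)\<^sup>2 \<le> nu_inner ?g f * nu_inner (green ?g) ?g"
    using energy_Cauchy_Schwarz[OF H] unfolding a .
  also have "\<dots> \<le> nu_inner ?g f * (green_sup C * nu_inner ?g ?g)"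
    using green_form_le_sup[OF orthogonal_to_green[OF C f]] energy_nonneg[OF H(1)] unfolding a(1)
    by (intro mult_left_mono) auto
  finally have *: "nu_inner ?g ?g * nu_inner ?g ?g \<le> (green_sup C * nu_inner ?g f) * nu_inner ?g ?g"
    by (simp add: power2_eq_square algebra_simps)
  show ?thesis
  proof (cases "nu_inner ?g ?g = 0")
    \<comment> \<open>Nothing can be cancelled here; it suffices that the supremum is nonnegative,
      which the zero function witnesses.\<close>
    case True
    have "0 \<in> {nu_inner (green f) f |f. orthogonal_to C f \<and> nu_inner f f \<le> 1}"
      by (intro CollectI exI[of _ "\<lambda>_. 0"]) (auto simp: nu_inner_def orthogonal_to_def bounded_borel_def)
    then have "0 \<le> green_sup C" unfolding green_sup_def by (rule cSup_upper[OF _ green_sup_bdd])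
    then show ?thesis using True energy_nonneg[OF H(1)] a(1) by simp
  next
    case False
    then show ?thesis using * nu_inner_nonneg[of ?g] by (simp add: mult_le_cancel_right)
  qed
qed

text \<open>The sequence \<open>\<phi>\<close> need not converge, but a subsequence of its images
  does so uniformly. The limit satisfies \<open>green h = M * h\<close>, which makes
  \<open>h\<close> a member of the form domain and an eigenfunction for \<open>1 / M\<close>. The
  test function \<open>f0\<close> ensures \<open>0 < M\<close>.\<close>

theorem exists_eigenfunction_orthogonal_to:
  assumes C: "\<And>b. b \<in> C \<Longrightarrow> \<exists>l. b \<in> eigenspace \<nu> l"
    and f0: "orthogonal_to C f0" "f0 \<in> H10" "nu_inner f0 f0 > 0"
  defines "M \<equiv> green_sup C"
  obtains h where "0 < M" "h \<in> eigenspace \<nu> (1 / M)" "h \<noteq> 0" "orthogonal_to C h"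
proof -
  have bf0: "bounded_borel f0" using f0 by (simp add: orthogonal_to_def)
  have Mpos: "0 < M"
  proof (rule ccontr)
    assume "\<not> 0 < M"
    \<comment> \<open>A nonpositive supremum forces the energy of \<open>green f0\<close> to vanish,
      so \<open>green f0 = 0\<close>; taking the energy against \<open>f0\<close>, which lies in
      \<open>H10\<close>, then yields \<open>nu_inner f0 f0 = 0\<close>.\<close>
    then have "nu_inner (green f0) f0 \<le> 0"
      using green_form_le_sup[OF f0(1)] f0(3) unfolding M_def[symmetric]
      by (meson mult_nonpos_nonneg not_less order_trans less_imp_le)
    then have "energy (green f0) (green f0) \<le> 0"
      using energy_green[OF bf0 green_H10[OF bf0]] by (simp add: nu_inner_commute)
    then have "green f0 = 0"
      using energy_nonneg[OF green_H10[OF bf0]] H10_energy_zero_imp_zero[OF green_H10[OF bf0]] by force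
    then have "nu_inner f0 f0 = 0"
      using energy_green[OF bf0 f0(2)] energy_zero_left[OF f0(2)] by simp
    then show False using f0(3) by simp
  qed
  have "\<exists>f. orthogonal_to C f \<and> nu_inner f f \<le> 1 \<and> M - 1 / real (Suc k) < nu_inner (green f) f" for k
  proof -
    have "{nu_inner (green f) f |f. orthogonal_to C f \<and> nu_inner f f \<le> 1} \<noteq> {}"
      by (auto intro!: exI[of _ "\<lambda>_. 0"] simp: nu_inner_def orthogonal_to_def bounded_borel_def)
    moreover have "M - 1 / real (Suc k) < M" by simp
    ultimately show ?thesis
      unfolding M_def green_sup_def by (auto simp: less_cSup_iff[OF _ green_sup_bdd])
  qed
  then obtain \<phi> where \<phi>: "\<And>k. orthogonal_to C (\<phi> k)" "\<And>k. nu_inner (\<phi> k) (\<phi> k) \<le> 1"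
    "\<And>k. M - 1 / real (Suc k) < nu_inner (green (\<phi> k)) (\<phi> k)"
    by metis
  have b\<phi>: "bounded_borel (\<phi> k)" for k using \<phi>(1) by (simp add: orthogonal_to_def)
  define V where "V = measure \<nu> UNIV"
  define K where "K = sqrt V"
  have V: "0 \<le> V" by (simp add: V_def)
  have norm1: "nu_norm1 f \<le> sqrt (V * r)" if "bounded_borel f" "nu_inner f f \<le> r" for f r
  proof -
    have "(nu_norm1 f)\<^sup>2 \<le> V * nu_inner f f" using nu_norm1_square_le[OF that(1)] by (simp add: V_def)
    also have "\<dots> \<le> V * r" using that(2) V by (rule mult_left_mono)
    finally show ?thesis using real_le_rsqrt by blast
  qed
  have K: "nu_norm1 (\<phi> k) \<le> K" for k
    using norm1[OF b\<phi> \<phi>(2)] by (simp add: K_def)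
  have Kpos: "0 \<le> K" using V by (simp add: K_def)
  have sup: "\<bar>green (\<phi> k) x\<bar> \<le> K" for k x
    using green_sup_le[OF b\<phi>] K order_trans by blast
  have lip: "\<bar>green (\<phi> k) x - green (\<phi> k) y\<bar> \<le> K * \<bar>x - y\<bar>" if "x \<in> {0..1}" "y \<in> {0..1}" for k x y
    using green_abs_le[OF b\<phi> that, of k] K[of k] by (meson abs_ge_zero mult_right_mono order_trans)
  obtain g r where g: "continuous_on {0..1} g" and r: "strict_mono (r :: nat \<Rightarrow> nat)"
    and unif: "\<And>e. 0 < e \<Longrightarrow> \<exists>N. \<forall>n x. n \<ge> N \<and> x \<in> {0..1} \<longrightarrow> norm (green (\<phi> (r n)) x - g x) < e"
  proof (rule Arzela_Ascoli[of "{0..1::real}" "\<lambda>k. green (\<phi> k)" K])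
    fix x e :: real assume "x \<in> {0..1}" "0 < e"
    define d where "d = e / (K + 1)"
    have "0 < d" using \<open>0 < e\<close> Kpos by (simp add: d_def)
    moreover have "norm (green (\<phi> k) x - green (\<phi> k) y) < e" if y: "y \<in> {0..1}" "norm (x - y) < d" for k y
    proof -
      have "\<bar>green (\<phi> k) x - green (\<phi> k) y\<bar> \<le> K * \<bar>x - y\<bar>" by (rule lip) fact+
      also have "\<dots> \<le> K * d" using y Kpos by (intro mult_left_mono) auto
      also have "\<dots> < (K + 1) * d" using \<open>0 < d\<close> by (simp add: distrib_right)
      also have "\<dots> = e" using Kpos by (simp add: d_def)
      finally show ?thesis by simp
    qed
    ultimately show "\<exists>d>0. \<forall>n y. y \<in> {0..1} \<and> norm (x - y) < d \<longrightarrow> norm (green (\<phi> n) x - green (\<phi> n) y) < e"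
      by blast
  qed (use sup in auto)
  \<comment> \<open>The Arzela-Ascoli limit is determined on \<open>[0, 1]\<close> only; the
    extension by 0 matches the representatives used in \<open>H10\<close>.\<close>
  define h where "h = (\<lambda>x. if x \<in> {0..1} then g x else 0)"
  define \<psi> where "\<psi> = (\<lambda>n. green (\<phi> (r n)))"
  have \<psi>H: "\<psi> n \<in> H10" for n by (simp add: \<psi>_def green_H10 b\<phi>)
  have b\<psi>: "bounded_borel (\<psi> n)" for n using \<psi>H by (rule H10_bounded_borel)
  have bh: "bounded_borel h"
  proof (rule continuous_imp_bounded_borel)
    show "continuous_on {0..1} h" using g by (rule continuous_on_eq) (simp add: h_def)
  qed (auto simp: h_def)
  have lim: "(\<lambda>n. \<psi> n x) \<longlonglongrightarrow> h x" for x
  proof (cases "x \<in> {0..1}")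
    case True
    show ?thesis
      unfolding LIMSEQ_iff \<psi>_def using unif True by (fastforce simp: h_def)
  next
    case False
    then have "\<psi> n x = 0" for n using H10_boundary(3)[OF \<psi>H] by blast
    moreover have "h x = 0" using False unfolding h_def by (rule if_not_P)
    ultimately show ?thesis by simp
  qed
  have \<psi>K: "\<bar>\<psi> n x\<bar> \<le> K" for n x by (simp add: \<psi>_def sup)
  have hK: "\<bar>h x\<bar> \<le> K" for x
    using lim[of x] \<psi>K by (intro tendsto_upperbound[OF tendsto_rabs[OF lim]]) auto
  have inner_lim: "(\<lambda>n. nu_inner (\<psi> n) b) \<longlonglongrightarrow> nu_inner h b" if b: "bounded_borel b" for b
  proof -
    obtain L where "\<And>x. \<bar>b x\<bar> \<le> L" using b by (meson bounded_borelE)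
    then show ?thesis using b\<psi> bh b \<psi>K lim by (intro nu_inner_tendsto[where K = K and L = L]) auto
  qed
  have hC: "orthogonal_to C h"
  proof -
    have "nu_inner h b = 0" if "b \<in> C" for b
    proof -
      have "bounded_borel b" using C[OF that] eigenspaceD(1) form_dom_bounded_borel by blast
      from inner_lim[OF this] have "(\<lambda>n. 0) \<longlonglongrightarrow> nu_inner h b"
        using orthogonal_to_green[OF C \<phi>(1)] that by (simp add: \<psi>_def orthogonal_to_def)
      then show ?thesis using LIMSEQ_unique tendsto_const by blast
    qed
    then show ?thesis using bh by (simp add: orthogonal_to_def)
  qed
  define s where "s = (\<lambda>n. inverse (real (Suc n)))"
  have s: "s \<longlonglongrightarrow> 0" unfolding s_def by (rule LIMSEQ_inverse_real_of_nat)
  have form_ge: "M - s n \<le> nu_inner (\<psi> n) (\<phi> (r n))" for n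
  proof -
    have "1 / real (Suc (r n)) \<le> s n"
      unfolding s_def inverse_eq_divide using seq_suble[OF r, of n] by (intro frac_le) auto
    then show ?thesis using \<phi>(3)[of "r n"] by (simp add: \<psi>_def)
  qed
  \<comment> \<open>T \<psi> - M \<psi> is T applied to \<open>?d\<close>, which is T \<phi> - M
    \<phi>. Expanding the \<nu>-square of \<open>?d\<close> and using T^2 \<le> M T bounds it by M
    times the gap between M and the quadratic form at \<phi>. Applying T upgrades this mean square
    bound to a uniform one.\<close>
  have residual: "\<bar>green (\<psi> n) x - M * \<psi> n x\<bar> \<le> sqrt (V * (M * s n))" for n x
  proof -
    let ?\<phi> = "\<phi> (r n)"
    let ?d = "\<lambda>y. \<psi> n y + (- M) * ?\<phi> y"
    have bd: "bounded_borel ?d" by (intro bounded_borel_add bounded_borel_scale b\<psi> b\<phi>)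
    have i: "integrable \<nu> (\<lambda>y. \<psi> n y * \<psi> n y)" "integrable \<nu> (\<lambda>y. \<psi> n y * ?\<phi> y)" "integrable \<nu> (\<lambda>y. ?\<phi> y * ?\<phi> y)"
      by (intro bounded_borel_integrable bounded_borel_mult b\<psi> b\<phi>)+
    have "nu_inner ?d ?d = (LINT y|\<nu>. \<psi> n y * \<psi> n y - (2 * M) * (\<psi> n y * ?\<phi> y) + M\<^sup>2 * (?\<phi> y * ?\<phi> y))"
      unfolding nu_inner_def by (simp add: power2_eq_square algebra_simps)
    also have "\<dots> = nu_inner (\<psi> n) (\<psi> n) - (2 * M) * nu_inner (\<psi> n) ?\<phi> + M\<^sup>2 * nu_inner ?\<phi> ?\<phi>"
      unfolding nu_inner_def using i by simp
    also have "\<dots> \<le> M * nu_inner (\<psi> n) ?\<phi> - (2 * M) * nu_inner (\<psi> n) ?\<phi> + M\<^sup>2 * 1"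
    proof -
      have "nu_inner (\<psi> n) (\<psi> n) \<le> M * nu_inner (\<psi> n) ?\<phi>"
        using green_norm_le[OF C \<phi>(1)[of "r n"]] by (simp add: \<psi>_def M_def)
      moreover have "M\<^sup>2 * nu_inner ?\<phi> ?\<phi> \<le> M\<^sup>2 * 1" using \<phi>(2) by (rule mult_left_mono) simp
      ultimately show ?thesis by linarith
    qed
    also have "\<dots> = M * (M - nu_inner (\<psi> n) ?\<phi>)" by (simp add: power2_eq_square algebra_simps)
    also have "\<dots> \<le> M * s n" using form_ge[of n] Mpos by (intro mult_left_mono) auto
    finally have "nu_norm1 ?d \<le> sqrt (V * (M * s n))" by (rule norm1[OF bd])
    moreover have "green ?d x = green (\<psi> n) x - M * \<psi> n x"
      using green_add_scale[OF b\<psi> b\<phi>, of n "- M" "r n" x] by (simp add: \<psi>_def)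
    ultimately show ?thesis using green_sup_le[OF bd, of x] by simp
  qed
  \<comment> \<open>T is continuous from the L^1 norm of \<nu> to the supremum norm, so dominated
    convergence of \<open>\<psi> n\<close> to \<open>h\<close> suffices.\<close>
  have green_lim: "(\<lambda>n. green (\<psi> n) x) \<longlonglongrightarrow> green h x" for x
  proof -
    have "(\<lambda>n. nu_norm1 (\<lambda>y. \<psi> n y + (-1) * h y)) \<longlonglongrightarrow> (LINT y|\<nu>. 0)"
      unfolding nu_norm1_def
    proof (rule integral_dominated_convergence)
      show "integrable \<nu> (\<lambda>x. 2 * K)" by (intro bounded_borel_integrable) (auto simp: bounded_borel_def)
      show "\<And>n. (\<lambda>y. \<bar>\<psi> n y + (-1) * h y\<bar>) \<in> borel_measurable \<nu>"
        by (intro borel_measurable_integrable bounded_borel_integrable bounded_borel_abs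
            bounded_borel_add bounded_borel_scale b\<psi> bh)
      show "AE y in \<nu>. (\<lambda>n. \<bar>\<psi> n y + (-1) * h y\<bar>) \<longlonglongrightarrow> 0"
      proof (rule AE_I2)
        fix y
        have "(\<lambda>n. \<bar>\<psi> n y + (-1) * h y\<bar>) \<longlonglongrightarrow> \<bar>h y + (-1) * h y\<bar>"
          by (intro tendsto_intros lim)
        then show "(\<lambda>n. \<bar>\<psi> n y + (-1) * h y\<bar>) \<longlonglongrightarrow> 0" by simp
      qed
      show "\<And>n. AE y in \<nu>. norm \<bar>\<psi> n y + (-1) * h y\<bar> \<le> 2 * K"
      proof (rule AE_I2)
        fix n y
        show "norm \<bar>\<psi> n y + (-1) * h y\<bar> \<le> 2 * K" using \<psi>K[of n y] hK[of y] by simp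
      qed
    qed auto
    then have "(\<lambda>n. nu_norm1 (\<lambda>y. \<psi> n y + (-1) * h y)) \<longlonglongrightarrow> 0" by simp
    then have "(\<lambda>n. green (\<psi> n) x - green h x) \<longlonglongrightarrow> 0"
    proof (rule Lim_null_comparison[rotated])
      have "\<bar>green (\<psi> n) x - green h x\<bar> \<le> nu_norm1 (\<lambda>y. \<psi> n y + (-1) * h y)" for n
        using green_add_scale[OF b\<psi> bh, of n "-1" x]
          green_sup_le[OF bounded_borel_add[OF b\<psi> bounded_borel_scale[OF bh]], of n "-1" x] by simp
      then show "\<forall>\<^sub>F n in sequentially. norm (green (\<psi> n) x - green h x) \<le> nu_norm1 (\<lambda>y. \<psi> n y + (-1) * h y)"
        by simp
    qed
    then show ?thesis by (rule LIM_zero_cancel)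
  qed
  have eig: "green h x = M * h x" for x
  proof -
    have "(\<lambda>n. sqrt (V * (M * s n))) \<longlonglongrightarrow> sqrt (V * (M * 0))" by (intro tendsto_intros s)
    then have "(\<lambda>n. sqrt (V * (M * s n))) \<longlonglongrightarrow> 0" by simp
    then have "(\<lambda>n. green (\<psi> n) x - M * \<psi> n x) \<longlonglongrightarrow> 0"
      by (rule Lim_null_comparison[rotated]) (simp add: residual)
    moreover have "(\<lambda>n. green (\<psi> n) x - M * \<psi> n x) \<longlonglongrightarrow> green h x - M * h x"
      by (intro tendsto_intros green_lim lim)
    ultimately have "0 = green h x - M * h x" by (rule LIMSEQ_unique)
    then show ?thesis by simp
  qed
  \<comment> \<open>This keeps the limit away from 0:
    \<open>M - s n \<le> nu_inner (\<psi> n) (\<phi> (r n))\<close>, and Cauchy-Schwarz passes the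
    bound on to \<open>\<psi> n\<close>. The maximum with 0 makes squaring monotone also where
    \<open>M - s n\<close> is negative.\<close>
  have hh: "M\<^sup>2 \<le> nu_inner h h"
  proof (rule LIMSEQ_le)
    show "(\<lambda>n. nu_inner (\<psi> n) (\<psi> n)) \<longlonglongrightarrow> nu_inner h h"
      using b\<psi> bh \<psi>K lim by (intro nu_inner_tendsto[where K = K and L = K]) auto
    have "(\<lambda>n. (max 0 (M - s n))\<^sup>2) \<longlonglongrightarrow> (max 0 (M - 0))\<^sup>2" by (intro tendsto_intros s)
    then show "(\<lambda>n. (max 0 (M - s n))\<^sup>2) \<longlonglongrightarrow> M\<^sup>2" using Mpos by simp
    have "(max 0 (M - s n))\<^sup>2 \<le> nu_inner (\<psi> n) (\<psi> n)" for n
    proof -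
      have "0 \<le> nu_inner (\<psi> n) (\<phi> (r n))"
        using energy_green[OF b\<phi> \<psi>H] energy_nonneg[OF \<psi>H] by (metis \<psi>_def nu_inner_commute)
      then have "(max 0 (M - s n))\<^sup>2 \<le> (nu_inner (\<psi> n) (\<phi> (r n)))\<^sup>2"
        using form_ge[of n] by (intro power_mono) auto
      also have "\<dots> \<le> nu_inner (\<psi> n) (\<psi> n) * nu_inner (\<phi> (r n)) (\<phi> (r n))"
        by (rule nu_inner_Cauchy_Schwarz[OF b\<psi> b\<phi>])
      also have "\<dots> \<le> nu_inner (\<psi> n) (\<psi> n) * 1"
        using \<phi>(2) by (intro mult_left_mono nu_inner_nonneg) auto
      finally show ?thesis by simp
    qed
    then show "\<exists>N. \<forall>n\<ge>N. (max 0 (M - s n))\<^sup>2 \<le> nu_inner (\<psi> n) (\<psi> n)" by blast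
  qed
  then have "h \<noteq> 0" using Mpos by (auto simp: nu_inner_def)
  moreover have "h \<in> eigenspace \<nu> (1 / M)"
  proof -
    have h_eq: "h = (\<lambda>x. (1 / M) * green h x)" using eig Mpos by auto
    have "h \<in> form_dom \<nu>"
      by (subst h_eq) (intro form_dom_scale green_form_dom bh)
    moreover have "energy h u = 1 / M * nu_inner h u" if u: "u \<in> form_dom \<nu>" for u
    proof -
      have "energy h u = energy (\<lambda>x. (1 / M) * green h x) u" by (subst h_eq) simp
      also have "\<dots> = 1 / M * nu_inner h u"
        unfolding energy_scale_left[OF green_H10[OF bh] form_dom_H10[OF u]]
          energy_green[OF bh form_dom_H10[OF u]] ..
      finally show ?thesis .
    qed
    ultimately show ?thesis by (simp add: eigenspace_def nu_inner_def)
  qed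
  ultimately show ?thesis using that Mpos hC by blast
qed

text \<open>The half of the min-max principle that produces eigenvalues. If the \<open>F i\<close>
  outnumbered the eigenfunctions counted up to \<open>x\<close>, some combination \<open>f\<close>
  would be orthogonal to all of these. Then there is an eigenfunction orthogonal to them as well,
  necessarily with eigenvalue \<open>1 / M > x\<close>, whereas the energy bound on \<open>f\<close>
  forces \<open>x * M \<ge> 1\<close>.\<close>

theorem eigenvalue_count_ge:
  fixes F :: "'i \<Rightarrow> real \<Rightarrow> real"
  assumes x: "0 < x" and I: "finite I" and F: "\<And>i. i \<in> I \<Longrightarrow> F i \<in> H10"
    and orth: "\<And>i j. i \<in> I \<Longrightarrow> j \<in> I \<Longrightarrow> i \<noteq> j \<Longrightarrow> nu_inner (F i) (F j) = 0"
      "\<And>i j. i \<in> I \<Longrightarrow> j \<in> I \<Longrightarrow> i \<noteq> j \<Longrightarrow> energy (F i) (F j) = 0"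
    and pos: "\<And>i. i \<in> I \<Longrightarrow> 0 < nu_inner (F i) (F i)"
    and le: "\<And>i. i \<in> I \<Longrightarrow> energy (F i) (F i) \<le> x * nu_inner (F i) (F i)"
  shows "enat (card I) \<le> eigenvalue_count \<nu> x"
proof -
  define E where "E = {l. eigenvalue \<nu> l \<and> l \<le> x}"
  obtain B where finE: "finite E" and finB: "\<And>l. l \<in> E \<Longrightarrow> finite (B l)"
    and B: "\<And>l. l \<in> E \<Longrightarrow> B l \<subseteq> eigenspace \<nu> l" "\<And>l. l \<in> E \<Longrightarrow> eigenspace \<nu> l \<subseteq> real_fun.span (B l)"
    and count: "eigenvalue_count \<nu> x = enat (card (Sigma E B))"
    using eigenvalue_count_bases[OF x, folded E_def] by metis
  have "card I \<le> card (Sigma E B)"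
  proof (rule ccontr)
    assume "\<not> card I \<le> card (Sigma E B)"
    then have less: "card (Sigma E B) < card I" by simp
    have "finite (Sigma E B)" using finE finB by auto
    from homogeneous_system_nontrivial_solution[OF this I less, of "\<lambda>i p. nu_inner (F i) (snd p)"]
    obtain c where c: "\<exists>i\<in>I. c i \<noteq> 0"
      and c0: "\<forall>p\<in>Sigma E B. (\<Sum>i\<in>I. c i * nu_inner (F i) (snd p)) = 0" by blast
    define G where "G = (\<lambda>i y. c i * F i y)"
    define f where "f = (\<Sum>i\<in>I. G i)"
    define C where "C = (\<Union>l\<in>E. B l)"
    have GH: "G i \<in> H10" if "i \<in> I" for i unfolding G_def by (intro H10_scale F that)
    have Gb: "bounded_borel (G i)" if "i \<in> I" for i using GH[OF that] by (rule H10_bounded_borel)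
    have fH: "f \<in> H10" unfolding f_def by (intro H10_sum GH)
    have fb: "bounded_borel f" using fH by (rule H10_bounded_borel)
    have Gn: "nu_inner (G i) (G j) = c i * (c j * nu_inner (F i) (F j))" for i j
      unfolding G_def nu_inner_scale_left nu_inner_commute[of "F i"] ..
    have Ge: "energy (G i) (G j) = c i * (c j * energy (F i) (F j))" if "i \<in> I" "j \<in> I" for i j
      using energy_scale_left[OF F[OF that(1)] GH[OF that(2)], of "c i"]
        energy_scale_left[OF F[OF that(2)] F[OF that(1)], of "c j"] energy_commute[of "F i"]
      by (simp add: G_def)
    have fn: "nu_inner f f = (\<Sum>i\<in>I. c i * (c i * nu_inner (F i) (F i)))"
    proof -
      have "nu_inner f f = (\<Sum>i\<in>I. nu_inner (G i) f)"
        unfolding f_def by (rule nu_inner_sum_left[OF Gb bounded_borel_sum[OF Gb]])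
      also have "\<dots> = (\<Sum>i\<in>I. \<Sum>j\<in>I. nu_inner (G j) (G i))"
        unfolding nu_inner_commute[of "G _" f] unfolding f_def
        by (intro sum.cong refl nu_inner_sum_left[OF Gb Gb])
      also have "\<dots> = (\<Sum>i\<in>I. \<Sum>j\<in>{i}. nu_inner (G j) (G i))"
        using I orth(1) by (intro sum.cong refl sum.mono_neutral_right) (auto simp: Gn)
      finally show ?thesis by (simp add: Gn)
    qed
    have fe: "energy f f = (\<Sum>i\<in>I. c i * (c i * energy (F i) (F i)))"
    proof -
      have "energy f f = (\<Sum>i\<in>I. energy (G i) f)"
        unfolding f_def by (rule energy_sum_left[OF GH H10_sum[OF GH]])
      also have "\<dots> = (\<Sum>i\<in>I. \<Sum>j\<in>I. energy (G j) (G i))"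
        unfolding energy_commute[of "G _" f] unfolding f_def
        by (intro sum.cong refl energy_sum_left[OF GH GH])
      also have "\<dots> = (\<Sum>i\<in>I. \<Sum>j\<in>{i}. energy (G j) (G i))"
        using I orth(2) by (intro sum.cong refl sum.mono_neutral_right) (auto simp: Ge)
      finally show ?thesis by (simp add: Ge)
    qed
    have fpos: "0 < nu_inner f f"
    proof -
      obtain i where i: "i \<in> I" "c i \<noteq> 0" using c by blast
      have "0 < c i * (c i * nu_inner (F i) (F i))"
        using i pos[OF i(1)] by (simp flip: mult.assoc add: zero_less_mult_iff) (meson linorder_neqE_linordered_idom)
      then show ?thesis unfolding fn
        using i I nu_inner_nonneg by (intro sum_pos2[of _ i]) (auto simp flip: mult.assoc)
    qed
    have fle: "energy f f \<le> x * nu_inner f f"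
      unfolding fn fe sum_distrib_left
    proof (rule sum_mono)
      fix i assume "i \<in> I"
      then have "(c i * c i) * energy (F i) (F i) \<le> (c i * c i) * (x * nu_inner (F i) (F i))"
        by (intro mult_left_mono le) auto
      then show "c i * (c i * energy (F i) (F i)) \<le> x * (c i * (c i * nu_inner (F i) (F i)))"
        by (simp add: mult.assoc mult.left_commute)
    qed
    have CE: "\<exists>l. b \<in> eigenspace \<nu> l" if "b \<in> C" for b using that B(1) by (auto simp: C_def)
    have fC: "orthogonal_to C f"
    proof -
      have "nu_inner f b = 0" if bC: "b \<in> C" for b
      proof -
        obtain l where l: "l \<in> E" "b \<in> B l" using bC by (auto simp: C_def)
        then have bb: "bounded_borel b" using B(1) eigenspaceD(1) form_dom_bounded_borel by blast
        have "nu_inner f b = (\<Sum>i\<in>I. nu_inner (G i) b)"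
          unfolding f_def by (rule nu_inner_sum_left[OF Gb bb])
        also have "\<dots> = (\<Sum>i\<in>I. c i * nu_inner (F i) b)" by (simp add: G_def nu_inner_scale_left)
        also have "\<dots> = 0" using c0 l by force
        finally show ?thesis .
      qed
      then show ?thesis using fb by (simp add: orthogonal_to_def)
    qed
    define M where "M = green_sup C"
    obtain h where M: "0 < M" and h: "h \<in> eigenspace \<nu> (1 / M)" "h \<noteq> 0" "orthogonal_to C h"
      using exists_eigenfunction_orthogonal_to[OF CE fC fH fpos] unfolding M_def by blast
    have hb: "bounded_borel h" using h(3) by (simp add: orthogonal_to_def)
    \<comment> \<open>Otherwise \<open>h\<close> would belong to the span of
      \<open>B (1 / M)\<close>, all of which is orthogonal to \<open>h\<close>, and would
      vanish.\<close>
    have "x < 1 / M"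
    proof (rule ccontr)
      assume "\<not> x < 1 / M"
      then have E: "1 / M \<in> E" using h by (auto simp: E_def eigenvalue_def)
      have "real_fun.subspace {b. bounded_borel b \<and> nu_inner h b = 0}"
      proof (rule real_fun.subspaceI)
        show "0 \<in> {b. bounded_borel b \<and> nu_inner h b = 0}"
          by (auto simp: nu_inner_def bounded_borel_def zero_fun_def)
        show "a + b \<in> {b. bounded_borel b \<and> nu_inner h b = 0}"
          if "a \<in> {b. bounded_borel b \<and> nu_inner h b = 0}" "b \<in> {b. bounded_borel b \<and> nu_inner h b = 0}" for a b
        proof -
          have "bounded_borel (a + b)" using that bounded_borel_add[of a b] by (simp add: plus_fun_def)
          then show ?thesis
            using that nu_inner_add_left[of a b h] hb by (simp add: nu_inner_commute)
        qed
        show "(\<lambda>x. c * a x) \<in> {b. bounded_borel b \<and> nu_inner h b = 0}"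
          if "a \<in> {b. bounded_borel b \<and> nu_inner h b = 0}" for c a
          using that nu_inner_scale_left[of c a h] bounded_borel_scale[of a c] by (simp add: nu_inner_commute)
      qed
      moreover have "B (1 / M) \<subseteq> {b. bounded_borel b \<and> nu_inner h b = 0}"
      proof
        fix b assume b: "b \<in> B (1 / M)"
        then have "b \<in> C" using E by (auto simp: C_def)
        moreover have "b \<in> eigenspace \<nu> (1 / M)" using B(1)[OF E] b by blast
        ultimately show "b \<in> {b. bounded_borel b \<and> nu_inner h b = 0}"
          using h(3) form_dom_bounded_borel[OF eigenspaceD(1)] by (auto simp: orthogonal_to_def)
      qed
      ultimately have "real_fun.span (B (1 / M)) \<subseteq> {b. bounded_borel b \<and> nu_inner h b = 0}"
        by (intro real_fun.span_minimal)
      then have "nu_inner h h = 0" using h(1) B(2)[OF E] by blast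
      then have "energy h h = 0"
        using eigenspaceD(2)[OF h(1) eigenspaceD(1)[OF h(1)]] by simp
      then show False
        using h(2) H10_energy_zero_imp_zero[OF form_dom_H10[OF eigenspaceD(1)[OF h(1)]]] by simp
    qed
    then have xM: "x * M < 1" using M by (simp add: field_simps)
    \<comment> \<open>Cauchy-Schwarz in the energy against \<open>green f\<close> turns the upper
      bound \<open>M\<close> for the operator into a lower bound for the Rayleigh quotient of
      \<open>f\<close>, although \<open>f\<close> need not be in the form domain.\<close>
    have "(nu_inner f f)\<^sup>2 = (energy (green f) f)\<^sup>2" using energy_green[OF fb fH] by simp
    also have "\<dots> \<le> energy (green f) (green f) * energy f f"
      by (rule energy_Cauchy_Schwarz[OF green_H10[OF fb] fH])
    also have "\<dots> = nu_inner (green f) f * energy f f"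
      using energy_green[OF fb green_H10[OF fb]] by (simp add: nu_inner_commute)
    also have "\<dots> \<le> (M * nu_inner f f) * (x * nu_inner f f)"
      using green_form_le_sup[OF fC] fle M fpos energy_nonneg[OF fH] unfolding M_def[symmetric]
      by (intro mult_mono) auto
    also have "\<dots> = (x * M) * (nu_inner f f)\<^sup>2" by (simp add: power2_eq_square algebra_simps)
    also have "\<dots> < 1 * (nu_inner f f)\<^sup>2" using xM fpos by (intro mult_strict_right_mono) auto
    finally show False by simp
  qed
  then show ?thesis by (simp add: count)
qed

end

section \<open>Trapezoidal test functions on dyadic intervals\<close>

text \<open>Equal to 1 on the dyadic interval number \<open>j + 1\<close> of level \<open>n\<close>, zero outside the intervals
  \<open>j\<close>, \<open>j + 1\<close>, \<open>j + 2\<close>.\<close>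

definition dyadic_trapezoid :: "nat \<Rightarrow> nat \<Rightarrow> real \<Rightarrow> real" where
  "dyadic_trapezoid n j x =
     max 0 (min (2 ^ n * x) (real j + 1) - real j) - max 0 (min (2 ^ n * x) (real j + 3) - (real j + 2))"

definition dyadic_trapezoid_gradient :: "nat \<Rightarrow> nat \<Rightarrow> real \<Rightarrow> real" where
  "dyadic_trapezoid_gradient n j t =
     2 ^ n * indicator (dyadic_interval n j) t - 2 ^ n * indicator (dyadic_interval n (j + 2)) t"

lemma integral_indicator_Ioc:
  fixes p q x :: real
  assumes "0 \<le> p"
  shows "(LINT t:{0..x}|lborel. indicator {p<..q} t) = max 0 (min x q - p)"
proof -
  have "(\<lambda>t. indicator {0..x} t *\<^sub>R (indicator {p<..q} t :: real)) = indicator {p<..min x q}"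
    using assms by (auto simp: indicator_def fun_eq_iff min.bounded_iff)
  then show ?thesis
    by (cases "p \<le> min x q") (auto simp: set_lebesgue_integral_def)
qed

lemma emeasure_dyadic_interval_finite: "emeasure lborel (dyadic_interval n j) < \<infinity>"
  unfolding dyadic_interval_def by (intro emeasure_bounded_finite bounded_subset[OF bounded_closed_interval greaterThanAtMost_subseteq_atLeastAtMost_iff[THEN iffD2]]) auto

lemma integrable_indicator_dyadic: "set_integrable lborel A (\<lambda>t. c * indicator (dyadic_interval n j) t :: real)"
  if "A \<in> sets borel" for A :: "real set"
proof -
  have "integrable lborel (\<lambda>t. indicator A t *\<^sub>R (c * indicator (dyadic_interval n j) t))"
    using that emeasure_dyadic_interval_finite
    by (intro integrable_mult_indicator integrable_mult_right integrable_real_indicator)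
       (auto simp: dyadic_interval_def)
  then show ?thesis by (simp add: set_integrable_def)
qed

lemma dyadic_trapezoid_is_weak_gradient:
  "is_weak_gradient (dyadic_trapezoid n j) (dyadic_trapezoid_gradient n j)"
proof -
  have "square_integrable (dyadic_trapezoid_gradient n j)"
  proof (rule square_integrable_bounded)
    show "dyadic_trapezoid_gradient n j \<in> borel_measurable borel"
      unfolding dyadic_trapezoid_gradient_def dyadic_interval_def by measurable
    show "\<bar>dyadic_trapezoid_gradient n j x\<bar> \<le> 2 ^ n" for x
      by (simp add: dyadic_trapezoid_gradient_def indicator_def)
  qed
  moreover have "(LINT t:{0..x}|lborel. dyadic_trapezoid_gradient n j t) = dyadic_trapezoid n j x" for x
  proof -
    have *: "(LINT t:{0..x}|lborel. 2 ^ n * indicator (dyadic_interval n k) t)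
       = max 0 (min (2 ^ n * x) (real k + 1) - real k)" for k
    proof -
      have "(LINT t:{0..x}|lborel. 2 ^ n * indicator (dyadic_interval n k) t)
        = 2 ^ n * max 0 (min x (real (k + 1) / 2 ^ n) - real k / 2 ^ n)"
        unfolding set_integral_mult_right dyadic_interval_def
        by (subst integral_indicator_Ioc) auto
      also have "\<dots> = max 0 (2 ^ n * (min x (real (k + 1) / 2 ^ n) - real k / 2 ^ n))"
        by (simp add: max_mult_distrib_left)
      also have "2 ^ n * (min x (real (k + 1) / 2 ^ n) - real k / 2 ^ n) = min (2 ^ n * x) (real k + 1) - real k"
        by (simp add: right_diff_distrib min_mult_distrib_left)
      finally show ?thesis .
    qed
    have "(LINT t:{0..x}|lborel. dyadic_trapezoid_gradient n j t)
      = (LINT t:{0..x}|lborel. 2 ^ n * indicator (dyadic_interval n j) t)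
        - (LINT t:{0..x}|lborel. 2 ^ n * indicator (dyadic_interval n (j + 2)) t)"
      unfolding dyadic_trapezoid_gradient_def
      by (intro set_integral_diff integrable_indicator_dyadic) auto
    then show ?thesis unfolding * by (simp add: dyadic_trapezoid_def algebra_simps)
  qed
  ultimately show ?thesis by (simp add: is_weak_gradient_iff)
qed

lemma dyadic_trapezoid_support: "dyadic_trapezoid n j x \<noteq> 0 \<Longrightarrow> real j < 2 ^ n * x \<and> 2 ^ n * x < real j + 3"
  unfolding dyadic_trapezoid_def by (auto simp: max_def min_def split: if_splits)

lemma dyadic_interval_iff: "t \<in> dyadic_interval n j \<longleftrightarrow> real j < 2 ^ n * t \<and> 2 ^ n * t \<le> real j + 1"
  by (auto simp: dyadic_interval_def field_simps)

lemma dyadic_trapezoid_gradient_support: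
  "dyadic_trapezoid_gradient n j t \<noteq> 0 \<Longrightarrow> real j < 2 ^ n * t \<and> 2 ^ n * t \<le> real j + 3"
  unfolding dyadic_trapezoid_gradient_def
  by (cases "t \<in> dyadic_interval n j"; cases "t \<in> dyadic_interval n (j + 2)")
     (auto simp: dyadic_interval_iff)

lemma dyadic_trapezoid_H10:
  assumes "j + 2 < 2 ^ n"
  shows "dyadic_trapezoid n j \<in> H10"
proof -
  have "real (j + 3) \<le> real (2 ^ n)" using assms by (intro of_nat_mono) simp
  then have j: "real j + 3 \<le> 2 ^ n" by simp
  have out: "dyadic_trapezoid n j x = 0" if "x \<le> 0 \<or> 1 \<le> x" for x
  proof (rule ccontr)
    assume "dyadic_trapezoid n j x \<noteq> 0"
    then have jx: "real j < 2 ^ n * x" "2 ^ n * x < real j + 3" using dyadic_trapezoid_support by auto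
    have x: "0 < 2 ^ n * x" using jx(1) by (rule le_less_trans[rotated]) simp
    have "2 ^ n * x < 2 ^ n * 1" using jx(2) j by linarith
    then have "0 < x" "x < 1"
      using mult_less_cancel_left_pos[of "2 ^ n" x 1] x by (auto simp: zero_less_mult_iff)
    then show False using that by simp
  qed
  then show ?thesis unfolding H10_def using dyadic_trapezoid_is_weak_gradient by auto
qed

text \<open>The functions and their gradients live on three consecutive intervals from
  \<open>j\<close> and from \<open>k\<close> on; as the intervals are open on the left, there is no
  overlap even for \<open>k = j + 3\<close>. Hence one residue class modulo 3 is a disjoint
  family.\<close>

lemma energy_dyadic_trapezoid_orthogonal:
  assumes "j + 3 \<le> k"
  shows "energy (dyadic_trapezoid n j) (dyadic_trapezoid n k) = 0"
    and "dyadic_trapezoid n j x * dyadic_trapezoid n k x = 0"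
proof -
  have k: "real j + 3 \<le> real k" using assms by linarith
  have *: "dyadic_trapezoid_gradient n j t * dyadic_trapezoid_gradient n k t = 0" for t
    using dyadic_trapezoid_gradient_support[of n j t] dyadic_trapezoid_gradient_support[of n k t] k by force
  show "energy (dyadic_trapezoid n j) (dyadic_trapezoid n k) = 0"
    unfolding energy_eq[OF dyadic_trapezoid_is_weak_gradient dyadic_trapezoid_is_weak_gradient] l2_inner_def
      set_lebesgue_integral_def
    by (simp only: *) simp
  show "dyadic_trapezoid n j x * dyadic_trapezoid n k x = 0"
    using dyadic_trapezoid_support[of n j x] dyadic_trapezoid_support[of n k x] k by force
qed

text \<open>Two ramps of slope \<open>2 ^ n\<close> and length \<open>1 / 2 ^ n\<close> contribute
  \<open>2 ^ n\<close> each. This is the origin of the threshold \<open>2 ^ (n + 1)\<close> for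
  \<open>x * charge n k\<close>.\<close>

lemma energy_dyadic_trapezoid_le:
  "energy (dyadic_trapezoid n j) (dyadic_trapezoid n j) \<le> 2 ^ (n + 1)"
proof -
  let ?g = "dyadic_trapezoid_gradient n j"
  have i: "integrable lborel (\<lambda>t. c * indicator (dyadic_interval n k) t)" for c :: real and k
    using emeasure_dyadic_interval_finite
    by (intro integrable_mult_right integrable_real_indicator) (auto simp: dyadic_interval_def)
  have m: "(LINT t|lborel. c * indicator (dyadic_interval n k) t) = c / 2 ^ n" for c :: real and k
    unfolding dyadic_interval_def by (simp add: divide_right_mono add_divide_distrib)
  have sq: "(?g t)\<^sup>2 = (2 ^ n)\<^sup>2 * indicator (dyadic_interval n j) t + (2 ^ n)\<^sup>2 * indicator (dyadic_interval n (j + 2)) t" for t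
    unfolding dyadic_trapezoid_gradient_def
    by (auto simp: indicator_def dyadic_interval_iff)
  have int: "integrable lborel (\<lambda>t. (?g t)\<^sup>2)"
    unfolding sq by (intro Bochner_Integration.integrable_add i)
  have "energy (dyadic_trapezoid n j) (dyadic_trapezoid n j) = (LINT t:{0..1}|lborel. (?g t)\<^sup>2)"
    unfolding energy_eq[OF dyadic_trapezoid_is_weak_gradient dyadic_trapezoid_is_weak_gradient] l2_inner_def
    by (simp add: power2_eq_square)
  also have "\<dots> \<le> (LINT t|lborel. (?g t)\<^sup>2)"
    unfolding set_lebesgue_integral_def
    using int by (intro integral_mono integrable_mult_indicator) (auto simp: indicator_def)
  also have "\<dots> = (2 ^ n)\<^sup>2 / 2 ^ n + (2 ^ n)\<^sup>2 / 2 ^ n"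
    unfolding sq by (subst Bochner_Integration.integral_add[OF i i]) (simp only: m)
  also have "\<dots> = 2 ^ (n + 1)" by (simp add: power2_eq_square)
  finally show ?thesis .
qed

lemma dyadic_trapezoid_eq_1:
  "x \<in> dyadic_interval n (Suc j) \<Longrightarrow> dyadic_trapezoid n j x = 1"
  unfolding dyadic_interval_iff dyadic_trapezoid_def by (auto simp: max_def min_def)

context unit_borel_measure
begin

lemma charge_le_nu_inner_dyadic_trapezoid:
  assumes "j + 2 < 2 ^ n"
  shows "charge n (Suc j) \<le> nu_inner (dyadic_trapezoid n j) (dyadic_trapezoid n j)"
proof -
  let ?f = "dyadic_trapezoid n j"
  have "charge n (Suc j) = (LINT x|\<nu>. indicator (dyadic_interval n (Suc j)) x)"
    by (simp add: charge_def sets_nu)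
  also have "\<dots> \<le> (LINT x|\<nu>. ?f x * ?f x)"
    using dyadic_trapezoid_eq_1
    by (intro integral_mono bounded_borel_integrable bounded_borel_mult
        H10_bounded_borel[OF dyadic_trapezoid_H10[OF assms]] integrable_real_indicator)
       (auto simp: sets_nu indicator_def emeasure_eq_measure bounded_borel_def)
  finally show ?thesis by (simp add: nu_inner_def)
qed

text \<open>The factor 3 counts the residue classes. The summand 2 accounts for the first and the
  last interval of the level, which lack a neighbour inside the unit interval and so cannot be the
  plateau of a trapezoid.\<close>

theorem count_large_charges_le:
  assumes x: "0 < x" and N: "eigenvalue_count \<nu> x = enat N"
  shows "card {k. k < 2 ^ n \<and> 2 ^ (n + 1) \<le> x * charge n k} \<le> 3 * N + 2"
proof -
  \<comment> \<open>The index \<open>j\<close> is that of the trapezoid; its plateau is the interval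
    with index \<open>Suc j\<close>.\<close>
  define J where "J = {j. j + 2 < 2 ^ n \<and> 2 ^ (n + 1) \<le> x * charge n (Suc j)}"
  have "J \<subseteq> {..<2 ^ n}" by (auto simp: J_def)
  then have finJ: "finite J" by (rule finite_subset) simp
  have residue_class: "card {j\<in>J. j mod 3 = r} \<le> N" for r
  proof -
    let ?I = "{j\<in>J. j mod 3 = r}"
    have far: "i + 3 \<le> j \<or> j + 3 \<le> i" if "i \<in> ?I" "j \<in> ?I" "i \<noteq> j" for i j
    proof -
      have eq: "i mod 3 = j mod 3" using that by simp
      then have "i div 3 \<noteq> j div 3" using \<open>i \<noteq> j\<close> by (metis div_mult_mod_eq)
      then show ?thesis
        using eq div_mult_mod_eq[of i 3] div_mult_mod_eq[of j 3] by linarith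
    qed
    have "enat (card ?I) \<le> eigenvalue_count \<nu> x"
    proof (rule eigenvalue_count_ge[OF x, of ?I "dyadic_trapezoid n"])
      show "finite ?I" using finJ by simp
      show "dyadic_trapezoid n i \<in> H10" if "i \<in> ?I" for i
        using that by (intro dyadic_trapezoid_H10) (auto simp: J_def)
      show "nu_inner (dyadic_trapezoid n i) (dyadic_trapezoid n j) = 0" if "i \<in> ?I" "j \<in> ?I" "i \<noteq> j" for i j
      proof -
        have *: "dyadic_trapezoid n i y * dyadic_trapezoid n j y = 0" for y
          using far[OF that] energy_dyadic_trapezoid_orthogonal(2) by (metis mult.commute)
        show ?thesis unfolding nu_inner_def by (simp only: *) simp
      qed
      show "energy (dyadic_trapezoid n i) (dyadic_trapezoid n j) = 0" if "i \<in> ?I" "j \<in> ?I" "i \<noteq> j" for i j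
        using far[OF that] energy_dyadic_trapezoid_orthogonal(1) by (metis energy_commute)
      fix i assume "i \<in> ?I"
      then have i: "i + 2 < 2 ^ n" "2 ^ (n + 1) \<le> x * charge n (Suc i)" by (auto simp: J_def)
      note c = charge_le_nu_inner_dyadic_trapezoid[OF i(1)]
      have "(0::real) < 2 ^ (n + 1)" by simp
      also note i(2)
      finally have "0 < charge n (Suc i)" using x by (simp add: zero_less_mult_iff)
      then show "0 < nu_inner (dyadic_trapezoid n i) (dyadic_trapezoid n i)" using c by linarith
      have "energy (dyadic_trapezoid n i) (dyadic_trapezoid n i) \<le> 2 ^ (n + 1)"
        by (rule energy_dyadic_trapezoid_le)
      also note i(2)
      also have "x * charge n (Suc i) \<le> x * nu_inner (dyadic_trapezoid n i) (dyadic_trapezoid n i)"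
        using c x by (intro mult_left_mono) auto
      finally show "energy (dyadic_trapezoid n i) (dyadic_trapezoid n i)
          \<le> x * nu_inner (dyadic_trapezoid n i) (dyadic_trapezoid n i)" .
    qed
    then show ?thesis by (simp add: N)
  qed
  have "card J = card (\<Union>r\<in>{..<3}. {j\<in>J. j mod 3 = r})" by (rule arg_cong[of _ _ card]) auto
  also have "\<dots> \<le> (\<Sum>r\<in>{..<3}. card {j\<in>J. j mod 3 = r})" by (rule card_UN_le) simp
  also have "\<dots> \<le> (\<Sum>r\<in>{..<3::nat}. N)"
    by (intro sum_mono residue_class)
  finally have J: "card J \<le> 3 * N" by simp
  have "{k. k < 2 ^ n \<and> 2 ^ (n + 1) \<le> x * charge n k} \<subseteq> Suc ` J \<union> {0, 2 ^ n - 1}"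
  proof
    fix k assume "k \<in> {k. k < 2 ^ n \<and> 2 ^ (n + 1) \<le> x * charge n k}"
    then have k: "k < 2 ^ n" "2 ^ (n + 1) \<le> x * charge n k" by auto
    show "k \<in> Suc ` J \<union> {0, 2 ^ n - 1}"
    proof (cases "k = 0 \<or> k = 2 ^ n - 1")
      case False
      then have "k - 1 \<in> J" "k = Suc (k - 1)" using k by (auto simp: J_def)
      then show ?thesis by blast
    qed auto
  qed
  then have "card {k. k < 2 ^ n \<and> 2 ^ (n + 1) \<le> x * charge n k} \<le> card (Suc ` J \<union> {0, 2 ^ n - 1})"
    using finJ by (intro card_mono) auto
  also have "\<dots> \<le> card (Suc ` J) + card {0, 2 ^ n - 1 :: nat}" by (rule card_Un_le)
  also have "\<dots> \<le> card J + 2"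
    by (intro add_mono card_image_le[OF finJ] card_insert_le_m1[THEN order_trans]) auto
  finally show ?thesis using J by simp
qed

lemma parabola_is_weak_gradient:
  "is_weak_gradient (\<lambda>x. if x \<in> {0..1} then x * (1 - x) else 0) (\<lambda>t. 1 - 2 * t)"
proof -
  have "continuous_on {0..1::real} (\<lambda>t. (1 - 2 * t)\<^sup>2)" by (intro continuous_intros)
  then have "set_integrable lborel {0..1::real} (\<lambda>t. (1 - 2 * t)\<^sup>2)"
    by (rule borel_integrable_atLeastAtMost')
  moreover have "(\<lambda>t::real. 1 - 2 * t) \<in> borel_measurable borel" by measurable
  moreover have "(LINT t:{0..x}|lborel. 1 - 2 * t) = x * (1 - x)" if "x \<in> {0..1}" for x :: real
  proof -
    have "(\<integral>t. (1 - 2 * t) * indicator {0..x} t \<partial>lborel) = (x - x\<^sup>2) - (0 - 0\<^sup>2)"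
      by (rule integral_FTC_Icc_real) (use that in \<open>auto intro!: derivative_eq_intros continuous_intros\<close>)
    then show ?thesis
      by (simp add: set_lebesgue_integral_def mult.commute power2_eq_square algebra_simps)
  qed
  ultimately show ?thesis by (simp add: is_weak_gradient_iff square_integrable_def)
qed

text \<open>Guards the logarithm, as \<open>log_card 0\<close> is minus infinity. A single test
  function that is positive on all of \<open>(0, 1)\<close> suffices, because it cannot vanish
  \<nu>-almost everywhere.\<close>

lemma eigenvalue_count_eventually_pos: "\<forall>\<^sub>F x in at_top. 1 \<le> eigenvalue_count \<nu> x"
proof -
  define f :: "real \<Rightarrow> real" where "f = (\<lambda>x. if x \<in> {0..1} then x * (1 - x) else 0)"
  have H: "f \<in> H10"
    unfolding H10_def using parabola_is_weak_gradient by (auto simp: f_def)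
  have i: "integrable \<nu> (\<lambda>x. f x * f x)"
    using H by (intro bounded_borel_integrable bounded_borel_mult H10_bounded_borel)
  have pos: "0 < nu_inner f f"
  proof (rule ccontr)
    assume "\<not> 0 < nu_inner f f"
    then have "(LINT x|\<nu>. f x * f x) = 0" using nu_inner_nonneg[of f] unfolding nu_inner_def by linarith
    then have "AE x in \<nu>. f x * f x = 0"
      using i by (subst (asm) integral_nonneg_eq_0_iff_AE) auto
    then have "AE x in \<nu>. x \<notin> {0<..<1}"
      by eventually_elim (auto simp: f_def split: if_splits)
    then have "emeasure \<nu> {0<..<1} = 0"
      by (subst (asm) AE_iff_measurable[of "{0<..<1}"]) (auto simp: sets_nu)
    then show False using nonzero by simp
  qed
  show ?thesis
    using eventually_ge_at_top[of "max 1 (energy f f / nu_inner f f)"]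
  proof eventually_elim
    case (elim x)
    have "enat (card {()}) \<le> eigenvalue_count \<nu> x"
    proof (rule eigenvalue_count_ge[where F = "\<lambda>_. f"])
      show "energy f f \<le> x * nu_inner f f" using elim pos by (simp add: field_simps)
    qed (use elim H pos in auto)
    then show ?case by (simp add: one_enat_def)
  qed
qed

lemma eigenvalue_count_le_heavy:
  assumes "0 < x"
  obtains N where "eigenvalue_count \<nu> x = enat N" "N \<le> card (heavy x)"
  using eigenvalue_count_bases[OF assms] by metis

end

subsection \<open>The $L^q$-spectrum and the Minkowski dimension\<close>

text \<open>Hoelder's inequality, saying that the logarithm of a power sum is convex in the
  exponent: normalise both sums to 1 and apply Young's inequality to each term.\<close>

lemma sum_powr_log_convex:
  fixes a :: "'k \<Rightarrow> real"
  assumes K: "finite K" "K \<noteq> {}" and a: "\<And>k. k \<in> K \<Longrightarrow> 0 < a k" and \<theta>: "0 \<le> \<theta>" "\<theta> \<le> 1"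
  shows "(\<Sum>k\<in>K. a k powr (\<theta> * s + (1 - \<theta>) * t))
     \<le> (\<Sum>k\<in>K. a k powr s) powr \<theta> * (\<Sum>k\<in>K. a k powr t) powr (1 - \<theta>)"
proof -
  define X where "X = (\<Sum>k\<in>K. a k powr s)"
  define Y where "Y = (\<Sum>k\<in>K. a k powr t)"
  have XY: "0 < X" "0 < Y"
    unfolding X_def Y_def by (intro sum_pos K; use a in force)+
  have "a k powr (\<theta> * s + (1 - \<theta>) * t)
      \<le> X powr \<theta> * Y powr (1 - \<theta>) * (\<theta> * (a k powr s / X) + (1 - \<theta>) * (a k powr t / Y))" if "k \<in> K" for k
  proof -
    have "a k powr (\<theta> * s + (1 - \<theta>) * t) = (a k powr s) powr \<theta> * (a k powr t) powr (1 - \<theta>)"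
      by (simp add: powr_add powr_powr mult.commute)
    also have "\<dots> = X powr \<theta> * Y powr (1 - \<theta>) * ((a k powr s / X) powr \<theta> * (a k powr t / Y) powr (1 - \<theta>))"
      using XY by (simp add: powr_divide)
    also have "\<dots> \<le> X powr \<theta> * Y powr (1 - \<theta>) * (\<theta> * (a k powr s / X) + (1 - \<theta>) * (a k powr t / Y))"
      using a[OF that] XY \<theta> by (intro mult_left_mono Youngs_inequality_0) auto
    finally show ?thesis .
  qed
  then have "(\<Sum>k\<in>K. a k powr (\<theta> * s + (1 - \<theta>) * t))
    \<le> (\<Sum>k\<in>K. X powr \<theta> * Y powr (1 - \<theta>) * (\<theta> * (a k powr s / X) + (1 - \<theta>) * (a k powr t / Y)))"
    by (rule sum_mono)
  also have "\<dots> = X powr \<theta> * Y powr (1 - \<theta>) * (\<theta> * (X / X) + (1 - \<theta>) * (Y / Y))"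
    by (simp add: sum_distrib_left[symmetric] sum.distrib sum_divide_distrib[symmetric] X_def Y_def)
  also have "\<dots> = X powr \<theta> * Y powr (1 - \<theta>)" using XY by simp
  finally show ?thesis by (simp add: X_def Y_def)
qed

lemma dyadic_interval_inj: "dyadic_interval n j = dyadic_interval n k \<Longrightarrow> j = k"
proof -
  assume eq: "dyadic_interval n j = dyadic_interval n k"
  have "real (m + 1) / 2 ^ n \<in> dyadic_interval n m" for m by (simp add: dyadic_interval_iff)
  then have "real (j + 1) / 2 ^ n \<in> dyadic_interval n k" "real (k + 1) / 2 ^ n \<in> dyadic_interval n j"
    using eq by blast+
  then show "j = k" by (simp add: dyadic_interval_iff)
qed

context unit_borel_measure
begin

abbreviation mass :: real where "mass \<equiv> measure \<nu> UNIV"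

lemma mass_pos: "0 < mass"
proof -
  have "0 < measure \<nu> {0<..<1}"
    using nonzero by (simp add: emeasure_eq_measure zero_less_measure_iff)
  also have "\<dots> \<le> mass" using bounded_measure[of "{0<..<1}"] by simp
  finally show ?thesis .
qed

definition charged :: "nat \<Rightarrow> nat set" where
  "charged n = {k. k < 2 ^ n \<and> 0 < charge n k}"

definition psum :: "nat \<Rightarrow> real \<Rightarrow> real" where
  "psum n q = (\<Sum>k\<in>charged n. charge n k powr q)"

lemma finite_charged [simp]: "finite (charged n)"
  by (rule finite_subset[of _ "{..<2 ^ n}"]) (auto simp: charged_def)

lemma charged_dyadics_eq: "charged_dyadics \<nu> n = dyadic_interval n ` charged n"
  by (auto simp: charged_dyadics_def charged_def charge_def emeasure_eq_measure)

lemma beta_n_eq: "beta_n \<nu> n q = ln (psum n q) / (real n * ln 2)"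
proof -
  have "(\<Sum>C\<in>charged_dyadics \<nu> n. measure \<nu> C powr q) = psum n q"
    unfolding charged_dyadics_eq psum_def charge_def
    by (subst sum.reindex) (auto simp: inj_on_def dest: dyadic_interval_inj)
  then show ?thesis by (simp add: beta_n_def ln_realpow)
qed

lemma sum_charge: "(\<Sum>k\<in>charged n. charge n k) = mass"
proof -
  have "(\<Sum>k\<in>charged n. charge n k) = (\<Sum>k<2 ^ n. charge n k)"
    by (rule sum.mono_neutral_left) (auto simp: charged_def charge_def zero_less_measure_iff)
  also have "\<dots> = measure \<nu> (\<Union>k\<in>{..<2 ^ n}. dyadic_interval n k)"
    unfolding charge_def
    by (rule finite_measure_finite_Union[symmetric])
       (auto simp: disjoint_family_on_def dyadic_interval_iff sets_nu)
  also have "\<dots> = mass"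
  proof (rule finite_measure_eq_AE)
    show "AE x in \<nu>. (x \<in> (\<Union>k\<in>{..<2 ^ n}. dyadic_interval n k)) = (x \<in> UNIV)"
      using AE_unit
    proof eventually_elim
      case (elim x)
      \<comment> \<open>The ceiling minus 1, and not the floor, because dyadic intervals are open on
        the left and closed on the right.\<close>
      define k where "k = nat (\<lceil>2 ^ n * x\<rceil> - 1)"
      have pos: "0 < 2 ^ n * x" using elim by simp
      then have c: "1 \<le> \<lceil>2 ^ n * x\<rceil>" by linarith
      then have k: "real k = of_int \<lceil>2 ^ n * x\<rceil> - 1" by (simp add: k_def)
      have "2 ^ n * x < 2 ^ n * 1" using elim by (intro mult_strict_left_mono) auto
      then have "real k < 2 ^ n" using k ceiling_correct[of "2 ^ n * x"] by linarith
      then have "k < 2 ^ n" by (metis of_nat_less_iff of_nat_numeral of_nat_power)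
      moreover have "x \<in> dyadic_interval n k"
        using k ceiling_correct[of "2 ^ n * x"] by (simp add: dyadic_interval_iff)
      ultimately show ?case by blast
    qed
  qed (auto simp: sets_nu)
  finally show ?thesis .
qed

lemma charged_nonempty: "charged n \<noteq> {}"
  using sum_charge[of n] mass_pos by auto

lemma charge_pos: "k \<in> charged n \<Longrightarrow> 0 < charge n k"
  by (simp add: charged_def)

lemma charge_le_mass: "charge n k \<le> mass"
  using bounded_measure[of "dyadic_interval n k"] by (simp add: charge_def)

lemma psum_pos: "0 < psum n q"
  unfolding psum_def using charged_nonempty charge_pos by (intro sum_pos) force+

lemma psum_1: "psum n 1 = mass"
  unfolding psum_def sum_charge[symmetric, of n] using charge_pos by (intro sum.cong) force+

lemma psum_eq_powr: "n \<noteq> 0 \<Longrightarrow> psum n q = 2 powr (real n * beta_n \<nu> n q)"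
  using psum_pos[of n q] by (simp add: beta_n_eq powr_def)

text \<open>After division by the total mass every charge is some \<open>p \<le> 1\<close>, for
  which \<open>p powr q\<close> lies above or below \<open>p\<close> according to
  \<open>q \<le> 1\<close> or \<open>q \<ge> 1\<close>, and the \<open>p\<close> sum to 1. The
  remaining factor \<open>mass powr q\<close> disappears in the limit over the levels.\<close>

lemma psum_mass_bounds:
  "q \<le> 1 \<Longrightarrow> mass powr q \<le> psum n q"
  "1 \<le> q \<Longrightarrow> psum n q \<le> mass powr q"
proof -
  have eq: "charge n k powr q = mass powr q * (charge n k / mass) powr q" if "k \<in> charged n" for k
    using charge_pos[OF that] mass_pos by (simp add: powr_divide)
  have tot: "(\<Sum>k\<in>charged n. mass powr q * (charge n k / mass)) = mass powr q"
    using mass_pos by (simp add: sum_distrib_left[symmetric] sum_divide_distrib[symmetric] sum_charge)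
  have frac: "0 < charge n k / mass" "charge n k / mass \<le> 1" if "k \<in> charged n" for k
    using charge_pos[OF that] mass_pos charge_le_mass by auto
  show "mass powr q \<le> psum n q" if "q \<le> 1"
  proof -
    have "(\<Sum>k\<in>charged n. mass powr q * (charge n k / mass)) \<le> psum n q"
      unfolding psum_def
    proof (rule sum_mono)
      fix k assume k: "k \<in> charged n"
      have "charge n k / mass = (charge n k / mass) powr 1"
        using less_imp_le[OF frac(1)[OF k]] by (simp only: powr_one)
      also have "\<dots> \<le> (charge n k / mass) powr q" using less_imp_le[OF frac(1)[OF k]] frac(2)[OF k] that by (intro powr_mono')
      finally show "mass powr q * (charge n k / mass) \<le> charge n k powr q"
        unfolding eq[OF k] by (intro mult_left_mono) auto
    qed
    then show ?thesis by (simp only: tot)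
  qed
  show "psum n q \<le> mass powr q" if "1 \<le> q"
  proof -
    have "psum n q \<le> (\<Sum>k\<in>charged n. mass powr q * (charge n k / mass))"
      unfolding psum_def
    proof (rule sum_mono)
      fix k assume k: "k \<in> charged n"
      have "(charge n k / mass) powr q \<le> (charge n k / mass) powr 1" using less_imp_le[OF frac(1)[OF k]] frac(2)[OF k] that by (intro powr_mono')
      also have "\<dots> = charge n k / mass"
        using less_imp_le[OF frac(1)[OF k]] by (simp only: powr_one)
      finally show "charge n k powr q \<le> mass powr q * (charge n k / mass)"
        unfolding eq[OF k] by (intro mult_left_mono) auto
    qed
    then show ?thesis by (simp only: tot)
  qed
qed

lemma tendsto_const_over_level: "(\<lambda>n. c / (real n * ln 2)) \<longlonglongrightarrow> 0"
proof -
  have "(\<lambda>n. (c / ln 2) * inverse (real n)) \<longlonglongrightarrow> (c / ln 2) * 0"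
    by (intro tendsto_intros lim_inverse_n)
  then show ?thesis by (simp add: field_simps)
qed

lemma limsup_const_over_level: "limsup (\<lambda>n. ereal (c / (real n * ln 2))) = 0"
  using tendsto_const_over_level[of c]
  by (intro lim_imp_Limsup) (auto simp: zero_ereal_def)

lemma beta_1: "beta \<nu> 1 = 0"
  unfolding beta_def beta_n_eq psum_1 by (rule limsup_const_over_level)

lemma beta_n_compare:
  assumes "a \<le> psum n q" "psum n q \<le> b" "0 < a"
  shows "ln a / (real n * ln 2) \<le> beta_n \<nu> n q" "beta_n \<nu> n q \<le> ln b / (real n * ln 2)"
  unfolding beta_n_eq using assms by (auto intro!: divide_right_mono)

lemma beta_nonneg:
  assumes "q \<le> 1"
  shows "0 \<le> beta \<nu> q"
proof -
  have "ln (mass powr q) / (real n * ln 2) \<le> beta_n \<nu> n q" for n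
    using psum_mass_bounds(1)[OF assms] mass_pos by (intro beta_n_compare(1)[of _ n q "psum n q"]) auto
  then have "limsup (\<lambda>n. ereal (ln (mass powr q) / (real n * ln 2))) \<le> beta \<nu> q"
    unfolding beta_def by (intro Limsup_mono always_eventually) auto
  then show ?thesis by (simp add: limsup_const_over_level)
qed

lemma beta_nonpos:
  assumes "1 \<le> q"
  shows "beta \<nu> q \<le> 0"
proof -
  have "beta_n \<nu> n q \<le> ln (mass powr q) / (real n * ln 2)" for n
    using psum_mass_bounds(2)[OF assms] psum_pos by (intro beta_n_compare(2)[of "psum n q"]) auto
  then have "beta \<nu> q \<le> limsup (\<lambda>n. ereal (ln (mass powr q) / (real n * ln 2)))"
    unfolding beta_def by (intro Limsup_mono always_eventually) auto
  then show ?thesis by (simp add: limsup_const_over_level)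
qed

lemma beta_n_convex:
  assumes "0 \<le> \<theta>" "\<theta> \<le> 1"
  shows "beta_n \<nu> n (\<theta> * s + (1 - \<theta>) * t) \<le> \<theta> * beta_n \<nu> n s + (1 - \<theta>) * beta_n \<nu> n t"
proof -
  have "psum n (\<theta> * s + (1 - \<theta>) * t) \<le> psum n s powr \<theta> * psum n t powr (1 - \<theta>)"
    unfolding psum_def using charged_nonempty charge_pos assms by (intro sum_powr_log_convex) auto
  then have "ln (psum n (\<theta> * s + (1 - \<theta>) * t)) \<le> ln (psum n s powr \<theta> * psum n t powr (1 - \<theta>))"
    using psum_pos by (intro ln_mono) auto
  also have "\<dots> = \<theta> * ln (psum n s) + (1 - \<theta>) * ln (psum n t)"
    using psum_pos[of n s] psum_pos[of n t] by (simp add: ln_mult ln_powr)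
  finally have "ln (psum n (\<theta> * s + (1 - \<theta>) * t)) / (real n * ln 2)
      \<le> (\<theta> * ln (psum n s) + (1 - \<theta>) * ln (psum n t)) / (real n * ln 2)"
    by (rule divide_right_mono) simp
  then show ?thesis by (simp add: beta_n_eq add_divide_distrib)
qed

lemma beta_convex:
  assumes "0 \<le> \<theta>" "\<theta> \<le> 1"
  shows "beta \<nu> (\<theta> * s + (1 - \<theta>) * t) \<le> ereal \<theta> * beta \<nu> s + ereal (1 - \<theta>) * beta \<nu> t"
proof -
  have "beta \<nu> (\<theta> * s + (1 - \<theta>) * t)
      \<le> limsup (\<lambda>n. ereal \<theta> * ereal (beta_n \<nu> n s) + ereal (1 - \<theta>) * ereal (beta_n \<nu> n t))"
    unfolding beta_def using beta_n_convex[OF assms] by (intro Limsup_mono always_eventually) auto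
  also have "\<dots> \<le> limsup (\<lambda>n. ereal \<theta> * ereal (beta_n \<nu> n s)) + limsup (\<lambda>n. ereal (1 - \<theta>) * ereal (beta_n \<nu> n t))"
    by (rule ereal_limsup_add_mono)
  also have "\<dots> = ereal \<theta> * beta \<nu> s + ereal (1 - \<theta>) * beta \<nu> t"
    unfolding beta_def using assms by (simp add: Limsup_ereal_mult_left del: times_ereal.simps)
  finally show ?thesis .
qed

lemma eventually_psum_less:
  assumes "beta \<nu> q < ereal r"
  shows "\<forall>\<^sub>F n in sequentially. psum n q < 2 powr (real n * r)"
  using Limsup_lessD[OF assms[unfolded beta_def]] eventually_gt_at_top[of 0]
proof eventually_elim
  case (elim n)
  then show ?case by (subst psum_eq_powr) auto
qed

text \<open>A limsup yields lower bounds only at infinitely many levels. This is enough for the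
  upper spectral dimension, which is itself a limsup.\<close>

lemma frequently_psum_greater:
  assumes "ereal r < beta \<nu> q"
  shows "\<exists>\<^sub>F n in sequentially. 2 powr (real n * r) < psum n q"
proof (rule ccontr)
  assume "\<not> (\<exists>\<^sub>F n in sequentially. 2 powr (real n * r) < psum n q)"
  then have "\<forall>\<^sub>F n in sequentially. psum n q \<le> 2 powr (real n * r)"
    by (simp add: not_frequently not_less)
  then have "\<forall>\<^sub>F n in sequentially. ereal (beta_n \<nu> n q) \<le> ereal r"
    using eventually_gt_at_top[of 0]
  proof eventually_elim
    case (elim n)
    then show ?case by (subst (asm) psum_eq_powr) auto
  qed
  then have "beta \<nu> q \<le> ereal r" unfolding beta_def by (rule Limsup_bounded)
  then show False using assms by simp
qed

section \<open>Coverings of the support and its Minkowski dimension\<close>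

lemma support_subset_unit: "topological_support \<nu> \<subseteq> {0..1}"
proof
  fix x assume x: "x \<in> topological_support \<nu>"
  show "x \<in> {0..1}"
  proof (rule ccontr)
    assume "x \<notin> {0..1}"
    then have "0 < emeasure \<nu> (- {0..1})"
      using x unfolding topological_support_def by (auto simp: open_Compl)
    also have "\<dots> \<le> emeasure \<nu> (- {0<..<1})" by (rule emeasure_mono) (auto simp: sets_nu)
    finally show False by (simp add: null_outside)
  qed
qed

lemma covering_number_le: "finite F \<Longrightarrow> A \<subseteq> (\<Union>x\<in>F. cball x e) \<Longrightarrow> covering_number e A \<le> enat (card F)"
  unfolding covering_number_def by (rule INF_lower) simp

lemma unit_interval_cover:
  assumes "0 < e"
  obtains F where "finite F" "{0..1::real} \<subseteq> (\<Union>x\<in>F. cball x e)" "real (card F) \<le> 1 / e + 1"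
proof
  define m where "m = nat \<lfloor>1 / e\<rfloor>"
  have m: "real m \<le> 1 / e" "1 / e < real m + 1" using assms by (auto simp: m_def)
  let ?F = "(\<lambda>i. real i * e) ` {..m}"
  show "finite ?F" by simp
  have "card ?F \<le> card {..m}" by (rule card_image_le) simp
  then show "real (card ?F) \<le> 1 / e + 1" using m by simp
  show "{0..1} \<subseteq> (\<Union>x\<in>?F. cball x e)"
  proof
    fix x :: real assume x: "x \<in> {0..1}"
    define i where "i = nat \<lfloor>x / e\<rfloor>"
    have i: "real i \<le> x / e" "x / e < real i + 1" using x assms by (auto simp: i_def)
    have "x / e \<le> 1 / e" using x assms by (intro divide_right_mono) auto
    then have "i \<le> m" unfolding i_def m_def by (intro nat_mono floor_mono)
    moreover have "real i * e \<le> x" "x < real i * e + e" using i assms by (simp_all add: field_simps)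
    then have "dist (real i * e) x \<le> e" by (simp add: dist_real_def)
    ultimately show "x \<in> (\<Union>x\<in>?F. cball x e)" by auto
  qed
qed

text \<open>Extended naturals are well-ordered, so the infimum is attained as soon as one finite
  cover exists; a cover of the unit interval is one.\<close>

lemma covering_number_support:
  assumes "0 < e"
  obtains F where "finite F" "topological_support \<nu> \<subseteq> (\<Union>x\<in>F. cball x e)"
    "covering_number e (topological_support \<nu>) = enat (card F)"
proof -
  let ?S = "topological_support \<nu>"
  let ?A = "(\<lambda>F. enat (card F)) ` {F. finite F \<and> ?S \<subseteq> (\<Union>x\<in>F. cball x e)}"
  obtain F0 where F0: "finite F0" "{0..1::real} \<subseteq> (\<Union>x\<in>F0. cball x e)"
    by (rule unit_interval_cover[OF assms])
  have "?S \<subseteq> (\<Union>x\<in>F0. cball x e)" using support_subset_unit F0(2) by (rule subset_trans)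
  then have "enat (card F0) \<in> ?A" using F0(1) by (intro imageI) simp
  then have "Inf ?A \<in> ?A" by (rule wellorder_InfI)
  then obtain F where "finite F" "?S \<subseteq> (\<Union>x\<in>F. cball x e)" "Inf ?A = enat (card F)"
    by auto
  then show ?thesis using that unfolding covering_number_def by simp
qed


lemma psum_0: "psum n 0 = real (card (charged n))"
proof -
  have "psum n 0 = (\<Sum>k\<in>charged n. 1)"
    unfolding psum_def using charge_pos by (intro sum.cong) force+
  then show ?thesis by simp
qed

lemma charged_meets_support:
  assumes "k \<in> charged n"
  obtains y where "y \<in> dyadic_interval n k" "y \<in> topological_support \<nu>"
proof -
  have "\<exists>y. y \<in> dyadic_interval n k \<and> y \<in> topological_support \<nu>"
  proof (rule ccontr)
    assume "\<not> ?thesis"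
    then have "AE y in \<nu>. y \<notin> dyadic_interval n k"
      using AE_topological_support by (auto elim: eventually_mono)
    then have "emeasure \<nu> (dyadic_interval n k) = 0"
      by (subst (asm) AE_iff_measurable[of "dyadic_interval n k"]) (auto simp: sets_nu)
    then show False using charge_pos[OF assms] by (simp add: charge_def measure_def)
  qed
  then show ?thesis using that by blast
qed

text \<open>Every charged interval contains a point of the support and so meets one of the balls. A
  ball has length \<open>2 / 2 ^ n\<close>; with \<open>u = 2 ^ n * z\<close> for its centre
  \<open>z\<close>, an index \<open>k\<close> that it meets satisfies
  \<open>u - 2 \<le> k < u + 1\<close>, which leaves three integers.\<close>

lemma card_charged_le_covering:
  assumes F: "finite F" "topological_support \<nu> \<subseteq> (\<Union>x\<in>F. cball x (1 / 2 ^ n))"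
  shows "card (charged n) \<le> 3 * card F"
proof -
  define J where "J = (\<lambda>z::real. nat ` {\<lceil>2 ^ n * z\<rceil> - 2..\<lceil>2 ^ n * z\<rceil>})"
  have "charged n \<subseteq> (\<Union>z\<in>F. J z)"
  proof
    fix k assume "k \<in> charged n"
    then obtain y where y: "y \<in> dyadic_interval n k" "y \<in> topological_support \<nu>"
      by (rule charged_meets_support)
    then obtain z where z: "z \<in> F" "dist z y \<le> 1 / 2 ^ n" using F(2) by auto
    have "\<bar>2 ^ n * z - 2 ^ n * y\<bar> = 2 ^ n * \<bar>z - y\<bar>"
      by (simp add: abs_mult flip: right_diff_distrib)
    also have "\<dots> \<le> 1" using z(2) by (simp add: dist_real_def field_simps)
    finally have "\<bar>2 ^ n * z - 2 ^ n * y\<bar> \<le> 1" .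
    moreover have "real k < 2 ^ n * y" "2 ^ n * y \<le> real k + 1" using y(1) by (auto simp: dyadic_interval_iff)
    ultimately have "real k < 2 ^ n * z + 1" "2 ^ n * z \<le> real k + 2" by linarith+
    then have "int k \<le> \<lceil>2 ^ n * z\<rceil>" "\<lceil>2 ^ n * z\<rceil> - 2 \<le> int k" by linarith+
    then have "int k \<in> {\<lceil>2 ^ n * z\<rceil> - 2..\<lceil>2 ^ n * z\<rceil>}" by simp
    then have "nat (int k) \<in> J z" unfolding J_def by (rule imageI)
    then show "k \<in> (\<Union>z\<in>F. J z)" using z(1) by auto
  qed
  moreover have J: "finite (J z)" "card (J z) \<le> 3" for z
    unfolding J_def using card_image_le[of "{\<lceil>2 ^ n * z\<rceil> - 2..\<lceil>2 ^ n * z\<rceil>}" nat] by simp_all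
  ultimately have "card (charged n) \<le> card (\<Union>z\<in>F. J z)" using F(1) by (intro card_mono) auto
  also have "\<dots> \<le> (\<Sum>z\<in>F. card (J z))" by (rule card_UN_le[OF F(1)])
  also have "\<dots> \<le> (\<Sum>z\<in>F. 3)" by (intro sum_mono J)
  finally show ?thesis by simp
qed

text \<open>Restricting the radius to \<open>1 / 2 ^ n\<close> can only lower the limsup, and the
  factor 3 of the covering estimate adds a term of order \<open>1 / n\<close>.\<close>

lemma beta_0_le_delta_star: "beta \<nu> 0 \<le> delta_star \<nu>"
proof (rule dense_ge)
  fix r assume r: "delta_star \<nu> < r"
  define g where "g = (\<lambda>e. log_card (covering_number e (topological_support \<nu>)) / ereal (ln (1 / e)))"
  have "filterlim (\<lambda>n. 1 / 2 ^ n :: real) (at_right 0) sequentially"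
    unfolding filterlim_at
    using LIMSEQ_power_zero[of "1 / 2 :: real"] by (auto simp: power_divide)
  moreover have "eventually (\<lambda>e. g e < r) (at_right 0)"
    using r unfolding delta_star_def upper_minkowski_dim_def g_def by (rule Limsup_lessD)
  ultimately have "\<forall>\<^sub>F n in sequentially. g (1 / 2 ^ n) < r"
    unfolding filterlim_iff by blast
  then have "\<forall>\<^sub>F n in sequentially. ereal (beta_n \<nu> n 0) \<le> ereal (ln 3 / (real n * ln 2)) + r"
    using eventually_gt_at_top[of 0]
  proof eventually_elim
    case (elim n)
    have "(0::real) < 1 / 2 ^ n" by simp
    from covering_number_support[OF this] obtain F where F: "finite F"
      "topological_support \<nu> \<subseteq> (\<Union>x\<in>F. cball x (1 / 2 ^ n))"
      "covering_number (1 / 2 ^ n) (topological_support \<nu>) = enat (card F)" .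
    have le: "card (charged n) \<le> 3 * card F" by (rule card_charged_le_covering[OF F(1,2)])
    have "0 < card (charged n)" using charged_nonempty by (simp add: card_gt_0_iff)
    then have pos: "0 < card F" using le by simp
    have "ln (psum n 0) \<le> ln (3 * real (card F))"
      unfolding psum_0 using le \<open>0 < card (charged n)\<close> by (intro ln_mono) (auto simp flip: of_nat_mult)
    also have "\<dots> = ln 3 + ln (real (card F))" using pos by (simp add: ln_mult)
    finally have "beta_n \<nu> n 0 \<le> (ln 3 + ln (real (card F))) / (real n * ln 2)"
      unfolding beta_n_eq by (rule divide_right_mono) simp
    moreover have "g (1 / 2 ^ n) = ereal (ln (real (card F)) / (real n * ln 2))"
      using pos elim by (simp add: g_def F(3) log_card_def ln_realpow)
    ultimately have "ereal (beta_n \<nu> n 0) \<le> ereal (ln 3 / (real n * ln 2)) + g (1 / 2 ^ n)"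
      by (simp add: add_divide_distrib)
    also have "\<dots> \<le> ereal (ln 3 / (real n * ln 2)) + r" using elim by (intro add_left_mono) simp
    finally show ?case .
  qed
  then have "beta \<nu> 0 \<le> limsup (\<lambda>n. ereal (ln 3 / (real n * ln 2)) + r)"
    unfolding beta_def by (rule Limsup_mono)
  also have "\<dots> \<le> limsup (\<lambda>n. ereal (ln 3 / (real n * ln 2))) + limsup (\<lambda>n. r)"
    by (rule ereal_limsup_add_mono)
  also have "\<dots> = r" by (simp add: limsup_const_over_level Limsup_const)
  finally show "beta \<nu> 0 \<le> r" .
qed

lemma delta_star_le_1: "delta_star \<nu> \<le> 1"
proof -
  have "filterlim (\<lambda>e::real. ln (1 / e)) at_top (at_right 0)"
    unfolding divide_inverse mult_1
    by (rule filterlim_compose[OF ln_at_top filterlim_inverse_at_top_right])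
  then have lim: "((\<lambda>e::real. 1 + ln 2 / ln (1 / e)) \<longlongrightarrow> 1 + 0) (at_right 0)"
    by (intro tendsto_add tendsto_const real_tendsto_divide_at_top[OF tendsto_const])
  have "delta_star \<nu> \<le> Limsup (at_right 0) (\<lambda>e. ereal (1 + ln 2 / ln (1 / e)))"
    unfolding delta_star_def upper_minkowski_dim_def
  proof (rule Limsup_mono)
    have "eventually (\<lambda>e::real. e \<in> {0<..<1}) (at_right 0)" by (rule eventually_at_right_real) simp
    then show "\<forall>\<^sub>F e in at_right 0. log_card (covering_number e (topological_support \<nu>)) / ereal (ln (1 / e))
        \<le> ereal (1 + ln 2 / ln (1 / e))"
    proof eventually_elim
      case (elim e)
      then have e: "0 < e" "e < 1" by auto
      obtain F where F: "finite F" "{0..1::real} \<subseteq> (\<Union>x\<in>F. cball x e)" "real (card F) \<le> 1 / e + 1"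
        by (rule unit_interval_cover[OF e(1)])
      obtain G where G: "finite G" "topological_support \<nu> \<subseteq> (\<Union>x\<in>G. cball x e)"
        "covering_number e (topological_support \<nu>) = enat (card G)"
        by (rule covering_number_support[OF e(1)])
      have "enat (card G) \<le> enat (card F)"
        unfolding G(3)[symmetric] using F support_subset_unit by (intro covering_number_le) auto
      then have "real (card G) \<le> 1 / e + 1" using F(3) by simp
      also have "\<dots> \<le> 2 * (1 / e)" using e by (simp add: field_simps)
      finally have le: "real (card G) \<le> 2 * (1 / e)" .
      have l: "0 < ln (1 / e)" using e by simp
      show ?case
      proof (cases "card G = 0")
        case True
        then show ?thesis using l e by (simp add: G(3) log_card_def)
      next
        case False
        then have "ln (real (card G)) \<le> ln (2 * (1 / e))" using le by (intro ln_mono) auto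
        also have "\<dots> = ln 2 + ln (1 / e)" using e by (subst ln_mult) auto
        finally have "ln (real (card G)) / ln (1 / e) \<le> (ln 2 + ln (1 / e)) / ln (1 / e)"
          using l by (intro divide_right_mono) auto
        also have "\<dots> = 1 + ln 2 / ln (1 / e)" using l by (simp add: field_simps)
        finally show ?thesis using False l by (simp add: G(3) log_card_def)
      qed
    qed
  qed
  also have "\<dots> = ereal 1" using lim by (intro lim_imp_Limsup) auto
  finally show ?thesis by (simp add: one_ereal_def)
qed

section \<open>The real-valued spectrum and its slopes at 1\<close>

definition lq :: "real \<Rightarrow> real" where
  "lq q = real_of_ereal (beta \<nu> q)"

text \<open>On \<open>[0, 1]\<close> the spectrum lies between 0 and its chord, whose left end is at
  most the Minkowski dimension. Beyond 1, convexity across the point 1, where the value is 0,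
  excludes minus infinity.\<close>

lemma beta_eq_lq:
  assumes "0 \<le> q"
  shows "beta \<nu> q = ereal (lq q)"
proof -
  have "beta \<nu> 0 \<le> 1" using beta_0_le_delta_star delta_star_le_1 by (rule order_trans)
  moreover have "0 \<le> beta \<nu> 0" by (rule beta_nonneg) simp
  ultimately obtain b0 where b0: "beta \<nu> 0 = ereal b0"
    by (cases "beta \<nu> 0") (auto simp: one_ereal_def)
  have "\<bar>beta \<nu> q\<bar> \<noteq> \<infinity>"
  proof (cases "q \<le> 1")
    case True
    have "beta \<nu> q \<le> ereal (1 - q) * beta \<nu> 0 + ereal (1 - (1 - q)) * beta \<nu> 1"
      using beta_convex[of "1 - q" 0 1] assms True by simp
    then show ?thesis using beta_nonneg[OF True] by (cases "beta \<nu> q") (auto simp: b0 beta_1)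
  next
    case False
    have "beta \<nu> 1 \<le> ereal (1 - 1 / q) * beta \<nu> 0 + ereal (1 - (1 - 1 / q)) * beta \<nu> q"
      using beta_convex[of "1 - 1 / q" 0 q] False by simp
    then show ?thesis using beta_nonpos[of q] False by (cases "beta \<nu> q") (auto simp: b0 beta_1)
  qed
  then show ?thesis by (simp add: lq_def ereal_real')
qed

lemma lq_convex:
  assumes "0 \<le> s" "0 \<le> t" "0 \<le> \<theta>" "\<theta> \<le> 1"
  shows "lq (\<theta> * s + (1 - \<theta>) * t) \<le> \<theta> * lq s + (1 - \<theta>) * lq t"
proof -
  have "0 \<le> \<theta> * s + (1 - \<theta>) * t" using assms by simp
  then show ?thesis using beta_convex[OF assms(3,4), of s t] assms by (simp add: beta_eq_lq)
qed

lemma lq_1: "lq 1 = 0"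
  by (simp add: lq_def beta_1)

lemma lq_nonneg: "0 \<le> q \<Longrightarrow> q \<le> 1 \<Longrightarrow> 0 \<le> lq q"
  using beta_nonneg[of q] by (simp add: beta_eq_lq)

definition slope :: "real \<Rightarrow> real" where
  "slope q = lq q / (1 - q)"

text \<open>\<open>slope q\<close> is minus the slope of the chord of the convex function
  \<open>lq\<close> between \<open>q\<close> and 1. The three cases are the positions of 1 relative
  to \<open>s\<close> and \<open>t\<close>; each is convexity at the middle one of the three
  points.\<close>

lemma slope_antimono:
  assumes "0 \<le> s" "s < t" "s \<noteq> 1" "t \<noteq> 1"
  shows "slope t \<le> slope s"
proof -
  consider "t < 1" | "1 < s" | "s < 1" "1 < t" using assms by linarith
  then show ?thesis
  proof cases
    case 1
    define \<theta> where "\<theta> = (1 - t) / (1 - s)"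
    have th: "0 \<le> \<theta>" "\<theta> \<le> 1" "\<theta> * (1 - s) = 1 - t" using 1 assms by (auto simp: \<theta>_def)
    have "\<theta> * s + (1 - \<theta>) * 1 = t" using th(3) by (simp add: algebra_simps)
    then have "lq t \<le> \<theta> * lq s" using lq_convex[of s 1 \<theta>] assms th by (simp add: lq_1)
    then have "lq t / (1 - t) \<le> \<theta> * lq s / (1 - t)" using 1 by (intro divide_right_mono) auto
    also have "\<dots> = lq s / (1 - s)" using 1 assms by (simp add: \<theta>_def)
    finally show ?thesis by (simp add: slope_def)
  next
    case 2
    define \<theta> where "\<theta> = (s - 1) / (t - 1)"
    have th: "0 \<le> \<theta>" "\<theta> \<le> 1" "\<theta> * (t - 1) = s - 1" using 2 assms by (auto simp: \<theta>_def)
    have eq: "\<theta> * t + (1 - \<theta>) * 1 = s" using th(3) by (simp add: algebra_simps)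
    have "lq (\<theta> * t + (1 - \<theta>) * 1) \<le> \<theta> * lq t + (1 - \<theta>) * lq 1"
      using assms th(1,2) by (intro lq_convex) auto
    then have "lq s \<le> \<theta> * lq t" unfolding eq lq_1 by simp
    then have "\<theta> * lq t / (1 - s) \<le> lq s / (1 - s)" using 2 by (intro divide_right_mono_neg) auto
    moreover have "\<theta> = (1 - s) / (1 - t)"
      unfolding \<theta>_def using minus_divide_divide[of "1 - s" "1 - t"] by simp
    then have "\<theta> * lq t / (1 - s) = lq t / (1 - t)" using 2 by simp
    ultimately show ?thesis by (simp add: slope_def)
  next
    case 3
    define \<theta> where "\<theta> = (t - 1) / (t - s)"
    have th: "0 \<le> \<theta>" "\<theta> \<le> 1" "\<theta> * (t - s) = t - 1" using 3 assms by (auto simp: \<theta>_def)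
    have "\<theta> * s + (1 - \<theta>) * t = 1" using th(3) by (simp add: algebra_simps)
    then have "0 \<le> \<theta> * lq s + (1 - \<theta>) * lq t"
      using lq_convex[of s t \<theta>] assms th by (simp add: lq_1)
    then have "0 \<le> (t - s) * (\<theta> * lq s + (1 - \<theta>) * lq t)" using assms by simp
    also have "\<dots> = (\<theta> * (t - s)) * lq s + ((t - s) - \<theta> * (t - s)) * lq t" by (simp add: algebra_simps)
    also have "\<dots> = (t - 1) * lq s + (1 - s) * lq t" unfolding th(3) by simp
    finally have "0 \<le> ((t - 1) * lq s + (1 - s) * lq t) / ((t - 1) * (1 - s))"
      using 3 by (intro divide_nonneg_pos mult_pos_pos) auto
    also have "\<dots> = lq s / (1 - s) + lq t / (t - 1)"
      using 3 by (simp add: add_divide_distrib)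
    also have "lq t / (t - 1) = - (lq t / (1 - t))"
      by (metis minus_diff_eq minus_divide_right)
    finally show ?thesis by (simp add: slope_def)
  qed
qed

text \<open>By monotonicity of \<open>slope\<close> the one-sided limits at 1 are this infimum and
  the supremum below. Both are finite: \<open>slope 2\<close> bounds the first set from below and
  \<open>slope 0\<close> the second from above.\<close>

definition slope_left :: real where "slope_left = Inf (slope ` {0..<1})"
definition slope_right :: real where "slope_right = Sup (slope ` {1<..})"

lemma slope_left_le: "0 \<le> q \<Longrightarrow> q < 1 \<Longrightarrow> slope_left \<le> slope q"
  unfolding slope_left_def
  by (rule cInf_lower) (auto intro!: bdd_belowI[of _ "slope 2"] slope_antimono)

lemma slope_le_right: "1 < q \<Longrightarrow> slope q \<le> slope_right"
  unfolding slope_right_def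
  by (rule cSup_upper) (auto intro!: bdd_aboveI[of _ "slope 0"] slope_antimono)

lemma slope_left_lessE:
  assumes "slope_left < r"
  obtains q where "0 \<le> q" "q < 1" "slope q < r"
  using cInf_lessD[of "slope ` {0..<1}" r] assms unfolding slope_left_def by auto

lemma less_slope_rightE:
  assumes "r < slope_right"
  obtains q where "1 < q" "r < slope q"
proof -
  have "slope ` {1<..} \<noteq> {}" by (simp add: greaterThan_non_empty)
  then show ?thesis using less_cSupD[of "slope ` {1<..}" r] assms that unfolding slope_right_def by auto
qed

text \<open>\<open>Lim\<close> is a definite description, so convergence has to be proved before its
  value means anything; monotonicity of \<open>slope\<close> supplies it.\<close>

lemma delta_upper_eq: "delta_upper \<nu> = ereal slope_left"
  unfolding delta_upper_def
proof (rule tendsto_Lim)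
  have ev: "eventually (\<lambda>t::real. t \<in> {0<..<1}) (at_left 1)" by (rule eventually_at_left_real) simp
  have "(slope \<longlongrightarrow> slope_left) (at_left 1)"
  proof (rule order_tendstoI)
    fix a assume "a < slope_left"
    with ev show "\<forall>\<^sub>F t in at_left 1. a < slope t"
      by (auto elim!: eventually_mono intro: less_le_trans[OF _ slope_left_le])
  next
    fix a assume "slope_left < a"
    then obtain q where q: "0 \<le> q" "q < 1" "slope q < a" by (rule slope_left_lessE)
    have "eventually (\<lambda>t::real. t \<in> {q<..<1}) (at_left 1)" using q by (intro eventually_at_left_real)
    then show "\<forall>\<^sub>F t in at_left 1. slope t < a"
    proof eventually_elim
      case (elim t)
      then have "slope t \<le> slope q" using q by (intro slope_antimono) auto
      then show ?case using q(3) by simp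
    qed
  qed
  then have "((\<lambda>t. ereal (slope t)) \<longlongrightarrow> ereal slope_left) (at_left 1)" by (rule tendsto_ereal)
  moreover have "\<forall>\<^sub>F t in at_left 1. ereal (slope t) = beta \<nu> t / ereal (1 - t)"
    using ev by eventually_elim (simp add: beta_eq_lq slope_def)
  ultimately show "((\<lambda>t. beta \<nu> t / ereal (1 - t)) \<longlongrightarrow> ereal slope_left) (at_left 1)"
    by (rule Lim_transform_eventually)
qed simp

lemma delta_lower_eq: "delta_lower \<nu> = ereal slope_right"
  unfolding delta_lower_def
proof (rule tendsto_Lim)
  have ev: "eventually (\<lambda>t::real. t \<in> {1<..<2}) (at_right 1)" by (rule eventually_at_right_real) simp
  have "(slope \<longlongrightarrow> slope_right) (at_right 1)"
  proof (rule order_tendstoI)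
    fix a assume "slope_right < a"
    with ev show "\<forall>\<^sub>F t in at_right 1. slope t < a"
      by (auto elim!: eventually_mono intro: le_less_trans[OF slope_le_right])
  next
    fix a assume "a < slope_right"
    then obtain q where q: "1 < q" "a < slope q" by (rule less_slope_rightE)
    have "eventually (\<lambda>t::real. t \<in> {1<..<q}) (at_right 1)" using q by (intro eventually_at_right_real)
    then show "\<forall>\<^sub>F t in at_right 1. a < slope t"
    proof eventually_elim
      case (elim t)
      then have "slope q \<le> slope t" using q by (intro slope_antimono) auto
      then show ?case using q(2) by simp
    qed
  qed
  then have "((\<lambda>t. ereal (slope t)) \<longlongrightarrow> ereal slope_right) (at_right 1)" by (rule tendsto_ereal)
  moreover have "\<forall>\<^sub>F t in at_right 1. ereal (slope t) = beta \<nu> t / ereal (1 - t)"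
    using ev by eventually_elim (simp add: beta_eq_lq slope_def)
  ultimately show "((\<lambda>t. beta \<nu> t / ereal (1 - t)) \<longlongrightarrow> ereal slope_right) (at_right 1)"
    by (rule Lim_transform_eventually)
qed simp

end

subsection \<open>Spectral dimensions\<close>

lemma two_powr_mult_eq_power: "2 powr (real n * a) = (2 powr a) ^ n"
  unfolding mult.commute[of "real n" a] powr_powr[symmetric] by (rule powr_realpow) simp

lemma tendsto_two_powr_neg:
  assumes "a < 0"
  shows "(\<lambda>n. 2 powr (real n * a)) \<longlonglongrightarrow> 0"
proof -
  have "norm (2 powr a) < 1" using assms by (simp add: powr_less_one)
  then show ?thesis unfolding two_powr_mult_eq_power by (rule LIMSEQ_power_zero)
qed

lemma eventually_two_powr_less:
  assumes "a < b" "0 < c"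
  shows "\<forall>\<^sub>F n in sequentially. C * 2 powr (real n * a) < c * 2 powr (real n * b)"
proof -
  have "(\<lambda>n. C * 2 powr (real n * (a - b))) \<longlonglongrightarrow> C * 0"
    by (intro tendsto_intros tendsto_two_powr_neg) (use assms in simp)
  then have "\<forall>\<^sub>F n in sequentially. C * 2 powr (real n * (a - b)) < c"
    using assms(2) by (intro order_tendstoD(2)) auto
  then show ?thesis
  proof eventually_elim
    case (elim n)
    have "C * 2 powr (real n * a) = C * 2 powr (real n * (a - b)) * 2 powr (real n * b)"
      by (simp add: mult.assoc algebra_simps flip: powr_add)
    also have "\<dots> < c * 2 powr (real n * b)" using elim by (intro mult_strict_right_mono) auto
    finally show ?case .
  qed
qed

lemma sum_union_le:
  fixes f :: "'a \<Rightarrow> real"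
  assumes "finite A" "finite B" "\<And>x. 0 \<le> f x"
  shows "sum f (A \<union> B) \<le> sum f A + sum f B"
proof -
  have "sum f (A \<union> B) + sum f (A \<inter> B) = sum f A + sum f B" by (rule sum.union_inter) fact+
  moreover have "0 \<le> sum f (A \<inter> B)" by (rule sum_nonneg) (rule assms(3))
  ultimately show ?thesis by linarith
qed

context unit_borel_measure
begin

definition eigencount :: "real \<Rightarrow> nat" where
  "eigencount x = the_enat (eigenvalue_count \<nu> x)"

lemma eigencount:
  assumes "0 < x"
  shows "eigenvalue_count \<nu> x = enat (eigencount x)" "eigencount x \<le> card (heavy x)"
proof -
  obtain N where "eigenvalue_count \<nu> x = enat N" "N \<le> card (heavy x)"
    by (rule eigenvalue_count_le_heavy[OF assms])
  then show "eigenvalue_count \<nu> x = enat (eigencount x)" "eigencount x \<le> card (heavy x)"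
    by (simp_all add: eigencount_def)
qed

lemma eventually_log_eigencount:
  "\<forall>\<^sub>F x in at_top. 1 < x \<and> 1 \<le> eigencount x \<and>
     log_card (eigenvalue_count \<nu> x) / ereal (ln x) = ereal (ln (real (eigencount x)) / ln x)"
  using eigenvalue_count_eventually_pos eventually_gt_at_top[of 1]
proof eventually_elim
  case (elim x)
  then have eq: "eigenvalue_count \<nu> x = enat (eigencount x)" using eigencount(1) by simp
  then have "1 \<le> eigencount x" using elim by (simp add: one_enat_def)
  then show ?case using elim eq by (auto simp: log_card_def)
qed

lemma upper_spectral_dim_le:
  assumes C: "0 < C" and le: "\<And>x. 1 < x \<Longrightarrow> real (eigencount x) \<le> C * x powr q"
  shows "upper_spectral_dim \<nu> \<le> ereal q"
proof -
  have "upper_spectral_dim \<nu> \<le> Limsup at_top (\<lambda>x. ereal (ln C / ln x + q))"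
    unfolding upper_spectral_dim_def
  proof (rule Limsup_mono)
    show "\<forall>\<^sub>F x in at_top. log_card (eigenvalue_count \<nu> x) / ereal (ln x) \<le> ereal (ln C / ln x + q)"
      using eventually_log_eigencount
    proof eventually_elim
      case (elim x)
      then have x: "1 < x" and N: "1 \<le> eigencount x" by auto
      have "ln (real (eigencount x)) \<le> ln (C * x powr q)" using le[OF x] N by (intro ln_mono) auto
      also have "\<dots> = ln C + q * ln x" using C x by (simp add: ln_mult ln_powr)
      finally have "ln (real (eigencount x)) / ln x \<le> (ln C + q * ln x) / ln x"
        using x by (intro divide_right_mono) auto
      also have "\<dots> = ln C / ln x + q" using x by (simp add: add_divide_distrib)
      finally show ?case using elim by simp
    qed
  qed
  also have "\<dots> = ereal (0 + q)"
    by (intro lim_imp_Limsup tendsto_ereal tendsto_add tendsto_const real_tendsto_divide_at_top[OF tendsto_const] ln_at_top) simp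
  finally show ?thesis by simp
qed

lemma powr_le_imp_log_ratio:
  assumes "1 < x" "1 \<le> N" "x powr s \<le> real N"
  shows "s \<le> ln (real N) / ln x"
proof -
  have "ln (x powr s) \<le> ln (real N)" using assms by (intro ln_mono) auto
  then show ?thesis using assms by (simp add: ln_powr field_simps)
qed

lemma lower_spectral_dim_ge:
  assumes "\<forall>\<^sub>F x in at_top. x powr s \<le> real (eigencount x)"
  shows "ereal s \<le> lower_spectral_dim \<nu>"
  unfolding lower_spectral_dim_def
proof (rule Liminf_bounded)
  show "\<forall>\<^sub>F x in at_top. ereal s \<le> log_card (eigenvalue_count \<nu> x) / ereal (ln x)"
    using eventually_log_eigencount assms
    by eventually_elim (use powr_le_imp_log_ratio in auto)
qed

text \<open>One sequence tending to infinity and infinitely many of its members are enough for a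
  limsup; this fits the lower bounds on \<open>psum\<close>, which hold only frequently.\<close>

lemma upper_spectral_dim_ge:
  assumes x: "filterlim x at_top sequentially"
    and le: "\<exists>\<^sub>F n in sequentially. x n powr s \<le> real (eigencount (x n))"
  shows "ereal s \<le> upper_spectral_dim \<nu>"
proof (rule ccontr)
  assume "\<not> ?thesis"
  then have "Limsup at_top (\<lambda>x. log_card (eigenvalue_count \<nu> x) / ereal (ln x)) < ereal s"
    by (simp add: upper_spectral_dim_def)
  then have "\<forall>\<^sub>F x in at_top. log_card (eigenvalue_count \<nu> x) / ereal (ln x) < ereal s"
    by (rule Limsup_lessD)
  then have "\<forall>\<^sub>F x in at_top. \<not> x powr s \<le> real (eigencount x)"
    using eventually_log_eigencount
  proof eventually_elim
    case (elim x)
    then show ?case using powr_le_imp_log_ratio[of x "eigencount x" s] by auto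
  qed
  then have "\<forall>\<^sub>F n in sequentially. \<not> x n powr s \<le> real (eigencount (x n))"
    using x unfolding filterlim_iff by blast
  then show False using le by (simp add: frequently_def)
qed

lemma lower_spectral_dim_nonneg: "0 \<le> lower_spectral_dim \<nu>"
proof -
  have "\<forall>\<^sub>F x in at_top. x powr 0 \<le> real (eigencount x)"
    using eventually_log_eigencount by eventually_elim auto
  then show ?thesis using lower_spectral_dim_ge[of 0] by (simp add: zero_ereal_def)
qed

text \<open>Each heavy interval contributes at least 1 to the sum of the \<open>q\<close>-th powers
  of \<open>2 * x * charge n k / 2 ^ n\<close>. Level \<open>n\<close> contributes at most a
  constant times \<open>(2 * x) powr q * \<rho> ^ n\<close>, and \<open>r < q\<close> is what makes
  the sum over all levels a convergent geometric series.\<close>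

lemma card_heavy_le:
  assumes q: "0 < q" and r: "r < q" and lim: "\<forall>\<^sub>F n in sequentially. psum n q < 2 powr (real n * r)"
  obtains C where "0 < C" "\<And>x. 0 < x \<Longrightarrow> real (card (heavy x)) \<le> C * x powr q"
proof -
  obtain n0 where n0: "\<And>n. n0 \<le> n \<Longrightarrow> psum n q < 2 powr (real n * r)"
    using lim by (auto simp: eventually_sequentially)
  \<comment> \<open>The sum handles the finitely many levels below \<open>n0\<close>, the 1 those
    from \<open>n0\<close> on.\<close>
  define K where "K = 1 + (\<Sum>n<n0. psum n q / 2 powr (real n * r))"
  have K: "psum n q \<le> K * 2 powr (real n * r)" for n
  proof (cases "n < n0")
    case True
    have "psum n q / 2 powr (real n * r) \<le> (\<Sum>n<n0. psum n q / 2 powr (real n * r))"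
      using True psum_pos[THEN less_imp_le] by (intro member_le_sum) auto
    then have "psum n q / 2 powr (real n * r) \<le> K" by (simp add: K_def)
    then show ?thesis by (simp add: divide_le_eq)
  next
    case False
    have "1 \<le> K" unfolding K_def using psum_pos[THEN less_imp_le] by (simp add: sum_nonneg)
    then have "1 * 2 powr (real n * r) \<le> K * 2 powr (real n * r)" by (intro mult_right_mono) auto
    then show ?thesis using n0[of n] False by linarith
  qed
  have K1: "0 < K" unfolding K_def using psum_pos[THEN less_imp_le] by (intro add_pos_nonneg sum_nonneg) auto
  define \<rho> where "\<rho> = 2 powr (r - q)"
  have \<rho>: "0 < \<rho>" "\<rho> < 1" using r by (auto simp: \<rho>_def powr_less_one)
  define C where "C = 2 powr q * (K / (1 - \<rho>))"
  have "real (card (heavy x)) \<le> C * x powr q" if x: "0 < x" for x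
  proof -
    obtain N where N: "\<And>n k. (n, k) \<in> heavy x \<Longrightarrow> n < N" using heavy_level_bounded[OF x] by blast
    let ?f = "\<lambda>n k. (2 * x * charge n k / 2 ^ n) powr q"
    have sub: "heavy x \<subseteq> Sigma {..<N} charged"
    proof
      fix p assume p: "p \<in> heavy x"
      obtain n k where nk: "p = (n, k)" by force
      have h: "1 / 2 < x * charge n k / 2 ^ n" "k < 2 ^ n" using p by (auto simp: nk heavy_def)
      have "0 < x * charge n k / 2 ^ n" using h(1) by linarith
      then have "k \<in> charged n" using x h(2) by (simp add: charged_def zero_less_mult_iff zero_less_divide_iff)
      then show "p \<in> Sigma {..<N} charged" using N[of n k] p by (simp add: nk)
    qed
    have "real (card (heavy x)) = (\<Sum>(n, k)\<in>heavy x. 1)" by (simp add: case_prod_beta)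
    also have "\<dots> \<le> (\<Sum>(n, k)\<in>heavy x. ?f n k)"
    proof (rule sum_mono, clarify)
      fix n k assume "(n, k) \<in> heavy x"
      then have "1 \<le> 2 * x * charge n k / 2 ^ n" by (simp add: heavy_def)
      then show "1 \<le> ?f n k" using q by (intro ge_one_powr_ge_zero) auto
    qed
    also have "\<dots> \<le> (\<Sum>(n, k)\<in>Sigma {..<N} charged. ?f n k)"
      using sub by (intro sum_mono2) auto
    also have "\<dots> = (\<Sum>n<N. \<Sum>k\<in>charged n. ?f n k)"
      by (rule sum.Sigma[symmetric]) auto
    also have "\<dots> = (\<Sum>n<N. (2 * x) powr q * 2 powr (- (real n * q)) * psum n q)"
    proof (rule sum.cong[OF refl])
      fix n
      have "?f n k = (2 * x) powr q * 2 powr (- (real n * q)) * charge n k powr q" if "k \<in> charged n" for k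
      proof -
        have "?f n k = (2 * x) powr q * charge n k powr q / (2 ^ n) powr q"
          using x charge_pos[OF that] by (simp add: powr_divide powr_mult)
        also have "(2 ^ n :: real) powr q = 2 powr (real n * q)"
          by (subst powr_realpow[symmetric]) (simp_all add: powr_powr)
        finally show ?thesis by (simp add: powr_minus field_simps)
      qed
      then show "(\<Sum>k\<in>charged n. ?f n k) = (2 * x) powr q * 2 powr (- (real n * q)) * psum n q"
        unfolding psum_def sum_distrib_left by (rule sum.cong[OF refl])
    qed
    also have "\<dots> \<le> (\<Sum>n<N. (2 * x) powr q * (K * \<rho> ^ n))"
    proof (rule sum_mono)
      fix n
      have "2 powr (- (real n * q)) * psum n q \<le> 2 powr (- (real n * q)) * (K * 2 powr (real n * r))"
        by (rule mult_left_mono[OF K]) simp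
      also have "\<dots> = K * (2 powr (- (real n * q)) * 2 powr (real n * r))" by simp
      also have "2 powr (- (real n * q)) * 2 powr (real n * r) = \<rho> ^ n"
      proof -
        have "- (real n * q) + real n * r = real n * (r - q)" by (simp add: algebra_simps)
        then show ?thesis unfolding \<rho>_def powr_add[symmetric] by (simp only: two_powr_mult_eq_power)
      qed
      finally show "(2 * x) powr q * 2 powr (- (real n * q)) * psum n q \<le> (2 * x) powr q * (K * \<rho> ^ n)"
        unfolding mult.assoc by (rule mult_left_mono) simp
    qed
    also have "\<dots> = (2 * x) powr q * K * (\<Sum>n<N. \<rho> ^ n)" by (simp add: sum_distrib_left mult.assoc)
    also have "\<dots> \<le> (2 * x) powr q * K * (1 / (1 - \<rho>))"
    proof (rule mult_left_mono)
      have "(\<Sum>n<N. \<rho> ^ n) = (1 - \<rho> ^ N) / (1 - \<rho>)"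
        using \<rho> by (simp add: sum_gp_strict)
      also have "\<dots> \<le> 1 / (1 - \<rho>)" using \<rho> by (intro divide_right_mono) auto
      finally show "(\<Sum>n<N. \<rho> ^ n) \<le> 1 / (1 - \<rho>)" .
    qed (use K1 in simp)
    also have "\<dots> = C * x powr q" using x by (simp add: C_def powr_mult)
    finally show ?thesis .
  qed
  moreover have "0 < C" using K1 \<rho> by (simp add: C_def)
  ultimately show ?thesis using that by blast
qed

theorem upper_spectral_dim_le_of_lq_less:
  assumes "0 < q" "lq q < q"
  shows "upper_spectral_dim \<nu> \<le> ereal q"
proof -
  define r where "r = (lq q + q) / 2"
  have "beta \<nu> q < ereal r" using assms by (simp add: beta_eq_lq r_def)
  then have lim: "\<forall>\<^sub>F n in sequentially. psum n q < 2 powr (real n * r)" by (rule eventually_psum_less)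
  have "r < q" using assms by (simp add: r_def)
  from card_heavy_le[OF assms(1) this lim] obtain C where C: "0 < C"
    "\<And>x. 0 < x \<Longrightarrow> real (card (heavy x)) \<le> C * x powr q" by blast
  have "real (eigencount x) \<le> C * x powr q" if "1 < x" for x
    using eigencount(2)[of x] C(2)[of x] that by linarith
  then show ?thesis by (rule upper_spectral_dim_le[OF C(1)])
qed

section \<open>Intervals of large charge and lower bounds\<close>

definition large :: "real \<Rightarrow> nat \<Rightarrow> nat set" where
  "large \<alpha> n = {k\<in>charged n. 2 powr (- (real n * \<alpha>)) \<le> charge n k}"

text \<open>The exponent of \<open>x\<close> is chosen so that the product with a charge of at least
  \<open>2 powr (- (real n * \<alpha>))\<close> reaches \<open>2 ^ (n + 1)\<close>, the energy of a
  trapezoid.\<close>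

lemma card_large_le_eigencount:
  assumes "2 powr (real n * (1 + \<alpha>) + 1) \<le> x"
  shows "real (card (large \<alpha> n)) \<le> 3 * real (eigencount x) + 2"
proof -
  have "(0::real) < 2 powr (real n * (1 + \<alpha>) + 1)" by simp
  then have x: "0 < x" using assms by linarith
  have "large \<alpha> n \<subseteq> {k. k < 2 ^ n \<and> 2 ^ (n + 1) \<le> x * charge n k}"
  proof
    fix k assume k: "k \<in> large \<alpha> n"
    have "(2::real) ^ (n + 1) = 2 powr real (n + 1)" by (rule powr_realpow[symmetric]) simp
    also have "real (n + 1) = (real n * (1 + \<alpha>) + 1) + - (real n * \<alpha>)" by (simp add: algebra_simps)
    also have "2 powr ((real n * (1 + \<alpha>) + 1) + - (real n * \<alpha>))
        = 2 powr (real n * (1 + \<alpha>) + 1) * 2 powr (- (real n * \<alpha>))" by (rule powr_add)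
    also have "\<dots> \<le> x * charge n k"
      using k assms x by (intro mult_mono) (auto simp: large_def)
    finally show "k \<in> {k. k < 2 ^ n \<and> 2 ^ (n + 1) \<le> x * charge n k}"
      using k by (simp add: large_def charged_def)
  qed
  then have "card (large \<alpha> n) \<le> card {k. k < 2 ^ n \<and> 2 ^ (n + 1) \<le> x * charge n k}"
    by (rule card_mono[rotated]) (rule finite_subset[of _ "{..<2 ^ n}"], auto)
  also have "\<dots> \<le> 3 * eigencount x + 2" by (rule count_large_charges_le[OF x eigencount(1)[OF x]])
  finally show ?thesis by linarith
qed

lemma finite_large [simp]: "finite (large \<alpha> n)"
  by (rule finite_subset[OF _ finite_charged]) (auto simp: large_def)

text \<open>A Chebyshev estimate: write the power as
  \<open>charge n k powr (q - t) * charge n k powr t\<close> and bound the first factor by the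
  threshold. It is applied with \<open>q = 1\<close> and \<open>t < 1\<close> for the lower
  dimension, and with \<open>t = 0\<close> in the case of equality.\<close>

lemma sum_small_charges_le:
  assumes "t \<le> q"
  shows "(\<Sum>k\<in>charged n - large \<alpha> n. charge n k powr q) \<le> 2 powr (- (real n * (\<alpha> * (q - t)))) * psum n t"
proof -
  have "(\<Sum>k\<in>charged n - large \<alpha> n. charge n k powr q)
      \<le> (\<Sum>k\<in>charged n - large \<alpha> n. 2 powr (- (real n * (\<alpha> * (q - t)))) * charge n k powr t)"
  proof (rule sum_mono)
    fix k assume k: "k \<in> charged n - large \<alpha> n"
    then have c: "0 < charge n k" "charge n k \<le> 2 powr (- (real n * \<alpha>))"
      by (auto simp: large_def charged_def)
    have "charge n k powr q = charge n k powr (q - t) * charge n k powr t"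
      by (simp flip: powr_add)
    also have "\<dots> \<le> (2 powr (- (real n * \<alpha>))) powr (q - t) * charge n k powr t"
      using c assms by (intro mult_right_mono powr_mono2) auto
    also have "(2 powr (- (real n * \<alpha>))) powr (q - t) = 2 powr (- (real n * (\<alpha> * (q - t))))"
      by (simp only: powr_powr mult_minus_left mult.assoc)
    finally show "charge n k powr q \<le> 2 powr (- (real n * (\<alpha> * (q - t)))) * charge n k powr t" .
  qed
  also have "\<dots> \<le> (\<Sum>k\<in>charged n. 2 powr (- (real n * (\<alpha> * (q - t)))) * charge n k powr t)"
    by (rule sum_mono2) auto
  also have "\<dots> = 2 powr (- (real n * (\<alpha> * (q - t)))) * psum n t"
    by (simp add: psum_def sum_distrib_left)
  finally show ?thesis .
qed

text \<open>The same estimate from the other side: the exponent \<open>1 - t\<close> is nonpositive,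
  so a lower bound on the charge bounds the first factor from above.\<close>

lemma sum_concentrated_charges_le:
  assumes "1 \<le> t"
  shows "(\<Sum>k\<in>{k\<in>charged n. 2 powr (- (real n * \<gamma>)) < charge n k}. charge n k)
     \<le> 2 powr (- (real n * (\<gamma> * (1 - t)))) * psum n t"
proof -
  let ?K = "{k\<in>charged n. 2 powr (- (real n * \<gamma>)) < charge n k}"
  have "(\<Sum>k\<in>?K. charge n k) \<le> (\<Sum>k\<in>?K. 2 powr (- (real n * (\<gamma> * (1 - t)))) * charge n k powr t)"
  proof (rule sum_mono)
    fix k assume k: "k \<in> ?K"
    then have c: "0 < charge n k" "2 powr (- (real n * \<gamma>)) \<le> charge n k" by (auto simp: charged_def)
    have "charge n k = charge n k powr (1 - t) * charge n k powr t"
      using c(1) by (simp flip: powr_add)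
    also have "\<dots> \<le> (2 powr (- (real n * \<gamma>))) powr (1 - t) * charge n k powr t"
      using c assms by (intro mult_right_mono powr_mono2') auto
    also have "(2 powr (- (real n * \<gamma>))) powr (1 - t) = 2 powr (- (real n * (\<gamma> * (1 - t))))"
      by (simp only: powr_powr mult_minus_left mult.assoc)
    finally show "charge n k \<le> 2 powr (- (real n * (\<gamma> * (1 - t)))) * charge n k powr t" .
  qed
  also have "\<dots> \<le> (\<Sum>k\<in>charged n. 2 powr (- (real n * (\<gamma> * (1 - t)))) * charge n k powr t)"
    by (rule sum_mono2) auto
  also have "\<dots> = 2 powr (- (real n * (\<gamma> * (1 - t)))) * psum n t"
    by (simp add: psum_def sum_distrib_left)
  finally show ?thesis .
qed

text \<open>An exponent \<open>t1 < 1\<close> shows that charges below 2^(-\<alpha> n) carry at most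
  a quarter of the mass, an exponent \<open>t2 > 1\<close> shows the same for charges above
  2^(-\<gamma> n). The remaining intervals carry at least half of the mass with at most 2^(-\<gamma>
  n) each.\<close>

lemma eventually_card_large_ge:
  assumes \<alpha>: "slope_left < \<alpha>" and \<gamma>: "\<gamma> < slope_right"
  shows "\<forall>\<^sub>F n in sequentially. mass / 2 * 2 powr (real n * \<gamma>) \<le> real (card (large \<alpha> n))"
proof -
  obtain t1 where t1: "0 \<le> t1" "t1 < 1" "slope t1 < \<alpha>" using \<alpha> by (rule slope_left_lessE)
  obtain t2 where t2: "1 < t2" "\<gamma> < slope t2" using \<gamma> by (rule less_slope_rightE)
  have "lq t1 < \<alpha> * (1 - t1)" using t1 by (simp add: slope_def field_simps)
  then obtain r1 where r1: "lq t1 < r1" "r1 < \<alpha> * (1 - t1)" using dense by blast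
  have "lq t2 = slope t2 * (1 - t2)" using t2 by (simp add: slope_def)
  also have "\<dots> < \<gamma> * (1 - t2)" using t2 by (intro mult_strict_right_mono_neg) auto
  finally obtain r2 where r2: "lq t2 < r2" "r2 < \<gamma> * (1 - t2)" using dense by blast
  have "\<forall>\<^sub>F n in sequentially. psum n t1 < 2 powr (real n * r1)"
    using r1 t1 by (intro eventually_psum_less) (simp add: beta_eq_lq)
  moreover have "\<forall>\<^sub>F n in sequentially. psum n t2 < 2 powr (real n * r2)"
    using r2 t2 by (intro eventually_psum_less) (simp add: beta_eq_lq)
  moreover have "\<forall>\<^sub>F n in sequentially. 1 * 2 powr (real n * r1) < mass / 4 * 2 powr (real n * (\<alpha> * (1 - t1)))"
    using r1 mass_pos by (intro eventually_two_powr_less) auto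
  moreover have "\<forall>\<^sub>F n in sequentially. 1 * 2 powr (real n * r2) < mass / 4 * 2 powr (real n * (\<gamma> * (1 - t2)))"
    using r2 mass_pos by (intro eventually_two_powr_less) auto
  ultimately show ?thesis
  proof eventually_elim
    case (elim n)
    let ?S = "charged n - large \<alpha> n" and ?B = "{k\<in>charged n. 2 powr (- (real n * \<gamma>)) < charge n k}"
    let ?M = "{k\<in>large \<alpha> n. charge n k \<le> 2 powr (- (real n * \<gamma>))}"
    have scale: "2 powr (- (real n * b)) * p \<le> mass / 4"
      if "p < 2 powr (real n * a)" "1 * 2 powr (real n * a) < mass / 4 * 2 powr (real n * b)" for p a b
    proof -
      have "2 powr (- (real n * b)) * p \<le> 2 powr (- (real n * b)) * (mass / 4 * 2 powr (real n * b))"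
        using that by (intro mult_left_mono) auto
      also have "\<dots> = mass / 4" by (simp add: powr_minus)
      finally show ?thesis .
    qed
    have "(\<Sum>k\<in>?S. charge n k powr 1) \<le> 2 powr (- (real n * (\<alpha> * (1 - t1)))) * psum n t1"
      using t1 by (intro sum_small_charges_le) simp
    also have "\<dots> \<le> mass / 4" by (rule scale) (rule elim)+
    also have "(\<Sum>k\<in>?S. charge n k powr 1) = (\<Sum>k\<in>?S. charge n k)"
      using charge_pos by (intro sum.cong) force+
    finally have S: "(\<Sum>k\<in>?S. charge n k) \<le> mass / 4" .
    have "(\<Sum>k\<in>?B. charge n k) \<le> 2 powr (- (real n * (\<gamma> * (1 - t2)))) * psum n t2"
      using t2 by (intro sum_concentrated_charges_le) simp
    also have "\<dots> \<le> mass / 4" by (rule scale) (rule elim)+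
    finally have B: "(\<Sum>k\<in>?B. charge n k) \<le> mass / 4" .
    have "mass = (\<Sum>k\<in>charged n. charge n k)" by (simp add: sum_charge)
    also have "\<dots> \<le> (\<Sum>k\<in>?M \<union> (?S \<union> ?B). charge n k)"
      by (intro sum_mono2) (auto simp: large_def charged_def)
    also have "\<dots> \<le> (\<Sum>k\<in>?M. charge n k) + (\<Sum>k\<in>?S \<union> ?B. charge n k)"
      by (rule sum_union_le) (auto simp: charge_def)
    also have "(\<Sum>k\<in>?S \<union> ?B. charge n k) \<le> (\<Sum>k\<in>?S. charge n k) + (\<Sum>k\<in>?B. charge n k)"
      by (rule sum_union_le) (auto simp: charge_def)
    finally have "mass / 2 \<le> (\<Sum>k\<in>?M. charge n k)" using S B by linarith
    also have "\<dots> \<le> (\<Sum>k\<in>?M. 2 powr (- (real n * \<gamma>)))" by (rule sum_mono) simp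
    also have "\<dots> = real (card ?M) * 2 powr (- (real n * \<gamma>))" by simp
    also have "\<dots> \<le> real (card (large \<alpha> n)) * 2 powr (- (real n * \<gamma>))"
      by (intro mult_right_mono of_nat_mono card_mono) auto
    finally show ?case by (simp add: powr_minus field_simps)
  qed
qed


lemma slope_left_nonneg: "0 \<le> slope_left"
proof (rule ccontr)
  assume "\<not> 0 \<le> slope_left"
  then obtain q where "0 \<le> q" "q < 1" "slope q < 0" by (meson not_le slope_left_lessE)
  then show False using lq_nonneg[of q] by (simp add: slope_def divide_less_0_iff)
qed

text \<open>The count of large charges is available at every late level, so every large
  \<open>x\<close> can be compared with the level just below it. The loss from rounding is a
  constant factor, and like the constants 3 and 2 it is absorbed by the strict inequality between
  \<open>s * (1 + \<alpha>)\<close> and \<gamma>.\<close>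

theorem lower_spectral_dim_ge_of_slopes:
  assumes \<alpha>: "slope_left < \<alpha>" and \<gamma>: "\<gamma> < slope_right" and s: "0 \<le> s" "s * (1 + \<alpha>) < \<gamma>"
  shows "ereal s \<le> lower_spectral_dim \<nu>"
proof -
  have \<alpha>0: "0 < \<alpha>" using \<alpha> slope_left_nonneg by linarith
  have "0 \<le> s * (1 + \<alpha>)" using s \<alpha>0 by simp
  then have \<gamma>0: "0 < \<gamma>" using s by linarith
  have "\<forall>\<^sub>F n in sequentially. 3 * 2 powr (s * (2 + \<alpha>)) * 2 powr (real n * (s * (1 + \<alpha>))) < mass / 4 * 2 powr (real n * \<gamma>)"
    using s mass_pos by (intro eventually_two_powr_less) auto
  moreover have "\<forall>\<^sub>F n in sequentially. 2 * 2 powr (real n * 0) < mass / 4 * 2 powr (real n * \<gamma>)"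
    using \<gamma>0 mass_pos by (intro eventually_two_powr_less) auto
  ultimately have "\<forall>\<^sub>F n in sequentially. 3 * 2 powr (((real n + 1) * (1 + \<alpha>) + 1) * s) + 2 \<le> real (card (large \<alpha> n))"
    using eventually_card_large_ge[OF \<alpha> \<gamma>]
  proof eventually_elim
    case (elim n)
    have "((real n + 1) * (1 + \<alpha>) + 1) * s = s * (2 + \<alpha>) + real n * (s * (1 + \<alpha>))"
      by (simp add: algebra_simps)
    then have "2 powr (((real n + 1) * (1 + \<alpha>) + 1) * s) = 2 powr (s * (2 + \<alpha>)) * 2 powr (real n * (s * (1 + \<alpha>)))"
      by (simp only: powr_add)
    then show ?case using elim by simp
  qed
  then obtain n0 where n0: "\<And>n. n0 \<le> n \<Longrightarrow>
      3 * 2 powr (((real n + 1) * (1 + \<alpha>) + 1) * s) + 2 \<le> real (card (large \<alpha> n))"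
    by (auto simp: eventually_sequentially)
  have "\<forall>\<^sub>F x in at_top. x powr s \<le> real (eigencount x)"
    using eventually_ge_at_top[of "2 powr (real n0 * (1 + \<alpha>) + 1)"]
  proof eventually_elim
    case (elim x)
    have "0 < 2 powr (real n0 * (1 + \<alpha>) + 1)" by simp
    then have x: "0 < x" using elim by linarith
    \<comment> \<open>The real level at which \<open>x\<close> is exactly the threshold
      \<open>2 powr (y * (1 + \<alpha>) + 1)\<close>; the level used is its integer part.\<close>
    define y where "y = (log 2 x - 1) / (1 + \<alpha>)"
    have y: "x = 2 powr (y * (1 + \<alpha>) + 1)" using \<alpha>0 x by (simp add: y_def)
    have "real n0 * (1 + \<alpha>) + 1 \<le> y * (1 + \<alpha>) + 1" using elim by (simp add: y)
    then have yn0: "real n0 \<le> y" using \<alpha>0 by simp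
    define n where "n = nat \<lfloor>y\<rfloor>"
    have n: "real n \<le> y" "y \<le> real n + 1" "n0 \<le> n"
      using yn0 by (auto simp: n_def le_nat_floor)
    have "x powr s = 2 powr ((y * (1 + \<alpha>) + 1) * s)" unfolding y powr_powr ..
    also have "\<dots> \<le> 2 powr (((real n + 1) * (1 + \<alpha>) + 1) * s)"
      using n(2) \<alpha>0 s(1) by (intro powr_mono mult_right_mono add_mono) auto
    finally have xs: "x powr s \<le> 2 powr (((real n + 1) * (1 + \<alpha>) + 1) * s)" .
    have "2 powr (real n * (1 + \<alpha>) + 1) \<le> x"
      unfolding y using n(1) \<alpha>0 by (intro powr_mono add_mono mult_right_mono) auto
    then have "real (card (large \<alpha> n)) \<le> 3 * real (eigencount x) + 2" by (rule card_large_le_eigencount)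
    then show ?case using n0[OF n(3)] xs by linarith
  qed
  then show ?thesis by (rule lower_spectral_dim_ge)
qed

text \<open>The left slope \<open>d\<close> keeps \<open>lq q\<close> at or above
  \<open>d * (1 - q)\<close> for every \<open>q\<close> in \<open>[0, 1)\<close>, so infinitely
  often \<open>psum n q\<close> is nearly 2^(n d (1 - q)). Charges below 2^(-\<alpha> n) with
  \<alpha> > d contribute little, since there are at most about 2^(n d) of them; each other charge
  contributes at most a constant, so many must be large. With small \<open>q\<close> and \<alpha>
  close to \<open>d\<close> the exponent approaches d / (1 + d).\<close>

theorem upper_spectral_dim_ge_of_linear:
  assumes d: "0 < d" "slope_left = d" "lq 0 \<le> d" and s: "0 \<le> s" "s * (1 + d) < d"
  shows "ereal s \<le> upper_spectral_dim \<nu>"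
proof -
  \<comment> \<open>Halfway between \<open>s * (1 + d)\<close> and \<open>d\<close>. The exponent
    \<open>q\<close> is then fixed by \<open>d * (1 - q) = e0\<close>, and \<alpha> exceeds
    \<open>d\<close> by so little that \<open>s * (1 + \<alpha>) < e0\<close> persists.\<close>
  define e0 where "e0 = (d + s * (1 + d)) / 2"
  define q where "q = 1 - e0 / d"
  define \<alpha> where "\<alpha> = d + (e0 - s * (1 + d)) / (s + 1)"
  have e0: "s * (1 + d) < e0" "e0 < d" using s by (auto simp: e0_def)
  have "0 \<le> s * (1 + d)" using d(1) s(1) by simp
  then have e0_pos: "0 < e0" using e0 by linarith
  have q: "0 < q" "q < 1" "d * (1 - q) = e0" using e0 e0_pos d by (auto simp: q_def)
  have \<alpha>: "d < \<alpha>" using e0 s by (simp add: \<alpha>_def)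
  define \<epsilon> where "\<epsilon> = (e0 - s * (1 + d)) / (s + 1)"
  have \<epsilon>: "0 < \<epsilon>" "(s + 1) * \<epsilon> = e0 - s * (1 + d)" using e0 s by (auto simp: \<epsilon>_def)
  have \<alpha>s: "s * (1 + \<alpha>) < e0"
  proof -
    have "s * (1 + \<alpha>) = s * (1 + d) + s * \<epsilon>" by (simp add: \<alpha>_def \<epsilon>_def algebra_simps)
    also have "\<dots> < s * (1 + d) + (s + 1) * \<epsilon>" using \<epsilon>(1) by (simp add: distrib_right)
    finally show ?thesis using \<epsilon>(2) by simp
  qed
  \<comment> \<open>The slack has two tasks. The first bound gives
    \<open>e - e' = (\<alpha> - d) * q - 2 * \<eta> > 0\<close>, so small charges are negligible;
    the second keeps \<open>s * (1 + \<alpha>)\<close> below \<open>e\<close>.\<close>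
  define \<eta> where "\<eta> = min ((\<alpha> - d) * q / 4) ((e0 - s * (1 + \<alpha>)) / 2)"
  have \<eta>: "0 < \<eta>" using \<alpha> q \<alpha>s by (simp add: \<eta>_def)
  have "\<eta> \<le> (\<alpha> - d) * q / 4" unfolding \<eta>_def by (rule min.cobounded1)
  then have \<eta>1: "4 * \<eta> \<le> (\<alpha> - d) * q" by simp
  have "\<eta> \<le> (e0 - s * (1 + \<alpha>)) / 2" unfolding \<eta>_def by (rule min.cobounded2)
  then have \<eta>2: "2 * \<eta> \<le> e0 - s * (1 + \<alpha>)" unfolding le_divide_eq by simp
  define e where "e = e0 - \<eta>"
  define e' where "e' = d + \<eta> - \<alpha> * q"
  have se: "s * (1 + \<alpha>) < e" using \<eta>2 \<alpha>s by (simp add: e_def)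
  have "0 \<le> s * (1 + \<alpha>)" using s \<alpha> d by simp
  then have e_pos: "0 < e" using se by linarith
  have "e0 = d - d * q" using q(3) by (simp add: algebra_simps)
  then have e'e: "e' < e" using \<eta>1 \<eta> by (simp add: e_def e'_def algebra_simps)
  have "d \<le> slope q" using slope_left_le[of q] q d by simp
  then have "d * (1 - q) \<le> lq q" using q by (simp add: slope_def field_simps)
  then have "ereal e < beta \<nu> q" using q \<eta> by (simp add: beta_eq_lq e_def)
  then have freq: "\<exists>\<^sub>F n in sequentially. 2 powr (real n * e) < psum n q"
    by (rule frequently_psum_greater)
  have "beta \<nu> 0 < ereal (d + \<eta>)" using d \<eta> by (simp add: beta_eq_lq)
  then have ev0: "\<forall>\<^sub>F n in sequentially. psum n 0 < 2 powr (real n * (d + \<eta>))"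
    by (rule eventually_psum_less)
  define c where "c = mass powr q"
  have c: "0 < c" using mass_pos by (simp add: c_def)
  define x where "x = (\<lambda>n. 2 powr (real n * (1 + \<alpha>) + 1))"
  have ev1: "\<forall>\<^sub>F n in sequentially. 1 * 2 powr (real n * e') < 1 / 2 * 2 powr (real n * e)"
    using e'e by (intro eventually_two_powr_less) auto
  have ev2: "\<forall>\<^sub>F n in sequentially. 3 * 2 powr s * 2 powr (real n * (s * (1 + \<alpha>))) < 1 / (4 * c) * 2 powr (real n * e)"
    using se c by (intro eventually_two_powr_less) auto
  have ev3: "\<forall>\<^sub>F n in sequentially. 2 * 2 powr (real n * 0) < 1 / (4 * c) * 2 powr (real n * e)"
    using e_pos c by (intro eventually_two_powr_less) auto
  have "\<forall>\<^sub>F n in sequentially. 2 powr (real n * e) < psum n q \<longrightarrow> x n powr s \<le> real (eigencount (x n))"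
    using ev0 ev1 ev2 ev3
  proof eventually_elim
    case (elim n)
    show ?case
    proof
      assume n: "2 powr (real n * e) < psum n q"
      have "(\<Sum>k\<in>charged n - large \<alpha> n. charge n k powr q) \<le> 2 powr (- (real n * (\<alpha> * (q - 0)))) * psum n 0"
        using q by (intro sum_small_charges_le) simp
      also have "\<dots> \<le> 2 powr (- (real n * (\<alpha> * (q - 0)))) * 2 powr (real n * (d + \<eta>))"
        using elim(1) by (intro mult_left_mono) auto
      also have "\<dots> = 2 powr (real n * e')"
      proof -
        have "- (real n * (\<alpha> * (q - 0))) + real n * (d + \<eta>) = real n * e'"
          by (simp add: e'_def algebra_simps)
        then show ?thesis unfolding powr_add[symmetric] by simp
      qed
      finally have small: "(\<Sum>k\<in>charged n - large \<alpha> n. charge n k powr q) \<le> 2 powr (real n * e')" .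
      have "psum n q = (\<Sum>k\<in>large \<alpha> n. charge n k powr q) + (\<Sum>k\<in>charged n - large \<alpha> n. charge n k powr q)"
        unfolding psum_def by (subst sum.subset_diff[of "large \<alpha> n"]) (auto simp: large_def)
      then have "1 / 2 * 2 powr (real n * e) \<le> (\<Sum>k\<in>large \<alpha> n. charge n k powr q)"
        using n small elim(2) by linarith
      also have "\<dots> \<le> (\<Sum>k\<in>large \<alpha> n. c)"
        unfolding c_def using q charge_pos charge_le_mass
        by (intro sum_mono powr_mono2) (auto simp: large_def charged_def)
      also have "\<dots> = real (card (large \<alpha> n)) * c" by simp
      finally have "1 / (2 * c) * 2 powr (real n * e) \<le> real (card (large \<alpha> n))"
        using c by (simp add: field_simps)
      \<comment> \<open>One half absorbs three times \<open>x n powr s\<close>, the other the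
        additive 2 of the counting estimate.\<close>
      moreover have "1 / (2 * c) * 2 powr (real n * e) = 1 / (4 * c) * 2 powr (real n * e) + 1 / (4 * c) * 2 powr (real n * e)"
        using c by (simp add: field_simps)
      moreover have "x n powr s = 2 powr s * 2 powr (real n * (s * (1 + \<alpha>)))"
      proof -
        have "(real n * (1 + \<alpha>) + 1) * s = s + real n * (s * (1 + \<alpha>))" by (simp add: algebra_simps)
        then show ?thesis unfolding x_def powr_powr by (simp only: powr_add)
      qed
      moreover have "real (card (large \<alpha> n)) \<le> 3 * real (eigencount (x n)) + 2"
        by (rule card_large_le_eigencount) (simp add: x_def)
      ultimately show "x n powr s \<le> real (eigencount (x n))" using elim(3,4) by simp
    qed
  qed
  then have "\<exists>\<^sub>F n in sequentially. x n powr s \<le> real (eigencount (x n))"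
    using freq by (rule frequently_rev_mp[rotated])
  moreover have "filterlim x at_top sequentially"
  proof (rule filterlim_at_top_mono[OF filterlim_real_sequentially])
    show "\<forall>\<^sub>F n in sequentially. real n \<le> x n"
    proof (rule always_eventually, rule allI)
      fix n
      have "real n \<le> 2 ^ n" using of_nat_less_two_power[of n] by (simp add: less_imp_le)
      also have "\<dots> = 2 powr real n" by (simp add: powr_realpow)
      also have "\<dots> \<le> x n"
        unfolding x_def using \<alpha> d by (intro powr_mono) (auto simp: algebra_simps)
      finally show "real n \<le> x n" .
    qed
  qed
  ultimately show ?thesis using upper_spectral_dim_ge by blast
qed

section \<open>The bounds and the case of equality\<close>

lemma delta_star_real:
  obtains d where "delta_star \<nu> = ereal d" "lq 0 \<le> d" "0 \<le> d" "d \<le> 1"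
proof -
  have "ereal (lq 0) \<le> delta_star \<nu>" using beta_0_le_delta_star by (simp add: beta_eq_lq)
  moreover have "0 \<le> lq 0" by (rule lq_nonneg) auto
  ultimately show ?thesis using delta_star_le_1 that
    by (cases "delta_star \<nu>") (auto simp: one_ereal_def)
qed

lemma lq_le_line: "0 \<le> q \<Longrightarrow> q \<le> 1 \<Longrightarrow> lq q \<le> (1 - q) * lq 0"
  using lq_convex[of 0 1 "1 - q"] by (simp add: lq_1)

lemma lower_bound:
  "ereal (slope_right / (1 + slope_left)) \<le> lower_spectral_dim \<nu>"
proof (rule dense_le)
  fix z assume z: "z < ereal (slope_right / (1 + slope_left))"
  show "z \<le> lower_spectral_dim \<nu>"
  proof (cases "z \<le> 0")
    case True
    then show ?thesis using lower_spectral_dim_nonneg by (rule order_trans)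
  next
    case False
    then obtain s where s: "z = ereal s" "0 < s" using z by (cases z) auto
    let ?d = "slope_left"
    have d: "0 \<le> ?d" by (rule slope_left_nonneg)
    have "s * (1 + ?d) < slope_right" using z s d by (simp add: pos_less_divide_eq)
    then obtain \<gamma> where \<gamma>: "s * (1 + ?d) < \<gamma>" "\<gamma> < slope_right" using dense by blast
    \<comment> \<open>Division by \<open>s + 1\<close> instead of \<open>s\<close> makes
      \<open>s * \<epsilon>\<close> strictly smaller than the gap, so \<alpha> may exceed the left
      slope by \<epsilon>.\<close>
    define \<epsilon> where "\<epsilon> = (\<gamma> - s * (1 + ?d)) / (s + 1)"
    have \<epsilon>: "0 < \<epsilon>" "(s + 1) * \<epsilon> = \<gamma> - s * (1 + ?d)" using \<gamma> s by (auto simp: \<epsilon>_def)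
    have "s * (1 + (?d + \<epsilon>)) = s * (1 + ?d) + s * \<epsilon>" by (simp add: algebra_simps)
    also have "\<dots> < s * (1 + ?d) + (s + 1) * \<epsilon>" using \<epsilon>(1) by (simp add: distrib_right)
    finally have "s * (1 + (?d + \<epsilon>)) < \<gamma>" using \<epsilon>(2) by simp
    then show ?thesis
      unfolding s(1) using \<gamma>(2) \<epsilon>(1) s(2) by (intro lower_spectral_dim_ge_of_slopes[of "?d + \<epsilon>" \<gamma>]) auto
  qed
qed

text \<open>The condition \<open>q > d / (1 + d)\<close> is the same as
  \<open>(1 - q) * d < q\<close>, and on \<open>[0, 1]\<close> convexity keeps \<open>lq\<close>
  below the chord \<open>(1 - q) * d\<close>.\<close>

lemma upper_bound:
  assumes d: "delta_star \<nu> = ereal d" "lq 0 \<le> d" "0 \<le> d" "d \<le> 1"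
  shows "upper_spectral_dim \<nu> \<le> ereal (d / (1 + d))"
proof (rule dense_ge)
  fix z assume z: "ereal (d / (1 + d)) < z"
  have "d / (1 + d) < 1" using d(3) by simp
  \<comment> \<open>The minimum with 1 keeps \<open>q\<close> in the range where the chord bounds
    \<open>lq\<close>.\<close>
  then have "ereal (d / (1 + d)) < min z 1" using z by (simp add: one_ereal_def)
  then obtain w where w: "ereal (d / (1 + d)) < w" "w < min z 1" using dense by blast
  then obtain q where q: "w = ereal q" by (cases w) auto
  have q1: "d / (1 + d) < q" "q < 1" "ereal q < z" using w q by (auto simp: one_ereal_def)
  have q0: "0 < q" using q1(1) d(3) by (meson add_nonneg_nonneg divide_nonneg_nonneg le_less_trans zero_le_one)
  have "d < q * (1 + d)" using q1(1) d(3) by (simp add: pos_divide_less_eq)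
  then have "(1 - q) * d < q" by (simp add: algebra_simps)
  moreover have "lq q \<le> (1 - q) * d"
    using lq_le_line[of q] d(2) q0 q1(2) by (meson diff_ge_0_iff_ge less_imp_le mult_left_mono order_trans)
  ultimately have "lq q < q" by linarith
  then have "upper_spectral_dim \<nu> \<le> ereal q" by (rule upper_spectral_dim_le_of_lq_less[OF q0])
  then show "upper_spectral_dim \<nu> \<le> z" using q1(3) by simp
qed

lemma slope_left_le_delta_star: "delta_star \<nu> = ereal d \<Longrightarrow> lq 0 \<le> d \<Longrightarrow> slope_left \<le> d"
  using slope_left_le[of 0] by (simp add: slope_def)

text \<open>A left slope at 1 that is smaller than \<open>d\<close> pushes \<^term>\<open>lq\<close> strictly below the chord from
  (0, \<open>d\<close>) to (1, 0), hence its fixed point strictly below the fixed point of the chord.\<close>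

lemma upper_strict:
  assumes d: "lq 0 \<le> d" "0 \<le> d" and less: "slope_left < d"
  shows "upper_spectral_dim \<nu> < ereal (d / (1 + d))"
proof -
  have d0: "0 < d" using less slope_left_nonneg by linarith
  define p where "p = d / (1 + d)"
  have p: "0 < p" "p < 1" "(1 - p) * d = p" using d0 by (auto simp: p_def field_simps)
  obtain t where t: "0 \<le> t" "t < 1" "slope t < d" using less by (rule slope_left_lessE)
  have lt: "lq t < (1 - t) * d" using t by (simp add: slope_def field_simps)
  have "lq p < p"
  \<comment> \<open>If \<open>t\<close> lies to the left of \<open>p\<close>, monotonicity of
    \<open>slope\<close> passes the strict inequality on from \<open>t\<close> to \<open>p\<close>;
    otherwise \<open>p\<close> lies between 0 and \<open>t\<close> and convexity does.\<close>
  proof (cases "t \<le> p")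
    case True
    have "slope p \<le> slope t"
      using slope_antimono[of t p] t p True by (cases "t = p") auto
    then have "slope p < d" using t(3) by simp
    then have "lq p < (1 - p) * d" using p by (simp add: slope_def pos_divide_less_eq mult.commute)
    then show ?thesis using p(3) by simp
  next
    case False
    define \<theta> where "\<theta> = 1 - p / t"
    have t0: "0 < t" using False p by simp
    have th: "0 \<le> \<theta>" "\<theta> < 1" "(1 - \<theta>) * t = p" using False p t0 by (auto simp: \<theta>_def)
    have "lq p \<le> \<theta> * lq 0 + (1 - \<theta>) * lq t"
      using lq_convex[of 0 t \<theta>] t th by simp
    also have "\<dots> < \<theta> * d + (1 - \<theta>) * ((1 - t) * d)"
      using d(1) lt th by (intro add_le_less_mono mult_left_mono mult_strict_left_mono) auto
    also have "\<dots> = (1 - (1 - \<theta>) * t) * d" by (simp add: algebra_simps)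
    also have "\<dots> = p" unfolding th(3) p(3) ..
    finally show ?thesis .
  qed
  \<comment> \<open>\<open>m\<close> is the gap at \<open>p\<close>, and \<theta> is the amount by
    which \<open>p\<close> is moved towards 0. Since \<open>\<theta> * (d + m) = m / 2\<close>,
    convexity uses up only half of the gap, so \<open>lq q < q\<close> still holds at some
    \<open>q < p\<close>.\<close>
  define m where "m = p - lq p"
  define \<theta> where "\<theta> = m / (2 * (d + m))"
  define q where "q = (1 - \<theta>) * p"
  have m: "0 < m" using \<open>lq p < p\<close> by (simp add: m_def)
  have dm: "0 < d + m" using m d0 by simp
  have th: "0 < \<theta>" "\<theta> < 1"
    using m d0 dm by (simp_all add: \<theta>_def pos_divide_less_eq)
  have cancel: "m / (2 * c) * c = m / 2" if "c \<noteq> 0" for c using that by simp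
  have th3: "\<theta> * (d + m) = m / 2"
    unfolding \<theta>_def by (rule cancel[OF less_imp_neq[OF dm, symmetric]])
  have q: "0 < q" using th p by (simp add: q_def)
  have "(1 - \<theta>) * p < 1 * p" using th p by (intro mult_strict_right_mono) auto
  then have qp: "q < p" by (simp add: q_def)
  have "lq q \<le> \<theta> * lq 0 + (1 - \<theta>) * lq p"
    using lq_convex[of 0 p \<theta>] p th by (simp add: q_def)
  also have "\<dots> \<le> \<theta> * d + (1 - \<theta>) * lq p" using d(1) th by simp
  also have "\<dots> = q + (\<theta> * (d + m) - m)" by (simp add: q_def m_def algebra_simps)
  also have "\<dots> < q" using th3 m by simp
  finally have "upper_spectral_dim \<nu> \<le> ereal q"
    by (rule upper_spectral_dim_le_of_lq_less[OF q])
  also have "\<dots> < ereal (d / (1 + d))" using qp by (simp add: p_def)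
  finally show ?thesis .
qed

theorem spectral_dimension_bounds:
  "delta_lower \<nu> / (1 + delta_upper \<nu>) \<le> lower_spectral_dim \<nu>
    \<and> lower_spectral_dim \<nu> \<le> upper_spectral_dim \<nu>
    \<and> upper_spectral_dim \<nu> \<le> delta_star \<nu> / (1 + delta_star \<nu>)
    \<and> delta_star \<nu> / (1 + delta_star \<nu>) \<le> 1 / 2
    \<and> (upper_spectral_dim \<nu> = delta_star \<nu> / (1 + delta_star \<nu>)
         \<longleftrightarrow> delta_upper \<nu> = delta_star \<nu>)"
proof -
  obtain d where d: "delta_star \<nu> = ereal d" "lq 0 \<le> d" "0 \<le> d" "d \<le> 1" by (rule delta_star_real)
  have star: "delta_star \<nu> / (1 + delta_star \<nu>) = ereal (d / (1 + d))"
    using d by (simp add: one_ereal_def)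
  have low: "delta_lower \<nu> / (1 + delta_upper \<nu>) = ereal (slope_right / (1 + slope_left))"
    using slope_left_nonneg by (simp add: delta_lower_eq delta_upper_eq one_ereal_def)
  have half: "(1 / 2 :: ereal) = ereal (1 / 2)"
    by (simp add: one_ereal_def numeral_eq_ereal)
  have mono: "lower_spectral_dim \<nu> \<le> upper_spectral_dim \<nu>"
    unfolding lower_spectral_dim_def upper_spectral_dim_def by (rule Liminf_le_Limsup) simp
  have "upper_spectral_dim \<nu> = ereal (d / (1 + d)) \<longleftrightarrow> slope_left = d"
  proof
    assume eq: "upper_spectral_dim \<nu> = ereal (d / (1 + d))"
    show "slope_left = d"
    proof (rule ccontr)
      assume "slope_left \<noteq> d"
      then have "slope_left < d" using slope_left_le_delta_star[OF d(1,2)] by simp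
      then show False using upper_strict[OF d(2,3)] eq by simp
    qed
  next
    assume eq: "slope_left = d"
    have "ereal (d / (1 + d)) \<le> upper_spectral_dim \<nu>"
    proof (rule dense_le)
      fix z assume z: "z < ereal (d / (1 + d))"
      show "z \<le> upper_spectral_dim \<nu>"
      proof (cases "z \<le> 0")
        case True
        then show ?thesis using lower_spectral_dim_nonneg mono by (meson order_trans)
      next
        case False
        then obtain s where s: "z = ereal s" "0 < s" using z by (cases z) auto
        have sd: "s * (1 + d) < d" using z s d(3) by (simp add: pos_less_divide_eq)
        have "0 < s * (1 + d)" using s(2) d(3) by simp
        then have "0 < d" using sd by linarith
        then show ?thesis unfolding s(1) using eq d(2) s(2) sd by (intro upper_spectral_dim_ge_of_linear) auto
      qed
    qed
    then show "upper_spectral_dim \<nu> = ereal (d / (1 + d))"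
      using upper_bound[OF d] by (rule antisym[rotated])
  qed
  then show ?thesis
    unfolding star low half using lower_bound mono upper_bound[OF d] d(3,4)
    by (simp add: delta_upper_eq d(1) divide_le_eq)
qed

end

theorem corollary1p7:
  fixes \<nu> :: "real measure"
  assumes "borel_measure_on_unit \<nu>"
    and "finite_measure \<nu>"
    and "emeasure \<nu> {0<..<1} \<noteq> 0"
  shows "delta_lower \<nu> / (1 + delta_upper \<nu>) \<le> lower_spectral_dim \<nu>
    \<and> lower_spectral_dim \<nu> \<le> upper_spectral_dim \<nu>
    \<and> upper_spectral_dim \<nu> \<le> delta_star \<nu> / (1 + delta_star \<nu>)
    \<and> delta_star \<nu> / (1 + delta_star \<nu>) \<le> 1 / 2
    \<and> (upper_spectral_dim \<nu> = delta_star \<nu> / (1 + delta_star \<nu>)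
         \<longleftrightarrow> delta_upper \<nu> = delta_star \<nu>)"
proof -
  interpret finite_measure \<nu> by (rule assms(2))
  interpret unit_borel_measure \<nu>
    by unfold_locales (use assms in \<open>auto simp: borel_measure_on_unit_def\<close>)
  show ?thesis by (rule spectral_dimension_bounds)
qed

end
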